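(* Let $k=(k_1,\dots,k_l)\in\mathbb{Z}_+^l$ be a partition of $n$ and let $h\in\mathbb{Z}_+^l$ be such that $1\le h_j\le k_j-1$ for all $j=1,\dots,l$. Then, for every $m\in\mathbb{Z}_+$, the Banach algebra of operators on the weighted Bergman space $\mathcal{A}^2_m(\mathbb{P}^n(\mathbb{C}))$ generated by the Toeplitz operators $T_\varphi$ with bounded measurable symbols $\varphi\in\mathcal{A}_{k,h}$ is commutative.
   Context: $\mathbb{Z}_+$ is the set of non-negative integers. A partition of $n$ is $k=(k_1,\dots,k_l)$ with positive integer entries, $k_1\le\dots\le k_l$ and $k_1+\dots+k_l=n$. Put $k_0=1$. Vectors $w\in\mathbb{C}^{n+1}=\mathbb{C}\times\mathbb{C}^{k_1}\times\dots\times\mathbb{C}^{k_l}$ are written $w=(w_0,w_1,\dots,w_n)=(w_{(0)},w_{(1)},\dots,w_{(l)})$ with $w_{(0)}=w_0\in\mathbb{C}$ and $w_{(j)}\in\mathbb{C}^{k_j}$ (consecutive blocks); multi-indices $p\in\mathbb{Z}_+^{n+1}$ are decomposed in the same way, $p=(p_{(0)},\dots,p_{(l)})$, and $(p_{(j)})_r$ is the $r$-th entry of the block $p_{(j)}$, $1\le r\le k_j$. $|p|$ denotes the sum of the entries of a multi-index, and $v^{p}=\prod_i v_i^{p_i}$. $\mathcal{A}_{k,h}$ is the set of functions $\varphi$ on $\mathbb{P}^n(\mathbb{C})$ (defined almost everywhere) of the form $$\varphi([w])=a(|w_{(0)}|,|w_{(1)}|,\dots,|w_{(l)}|)\prod_{j=0}^l\left(\frac{w_{(j)}}{|w_{(j)}|}\right)^{p_{(j)}}\left(\frac{\overline{w}_{(j)}}{|w_{(j)}|}\right)^{q_{(j)}},$$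 where $a$ is homogeneous of degree $0$ and $p,q\in\mathbb{Z}_+^{n+1}$ satisfy: $p\cdot q=\sum_i p_iq_i=0$; $|p_{(j)}|=|q_{(j)}|$ for all $j=0,\dots,l$ (so $p_0=q_0=0$); and for each $j=1,\dots,l$, $(p_{(j)})_r=0$ for $h_j<r\le k_j$ and $(q_{(j)})_s=0$ for $1\le s\le h_j$. For $m\in\mathbb{Z}_+$ let $d\nu_m(z)=\frac{(n+m)!}{\pi^n m!}\frac{dV(z)}{(1+|z_1|^2+\dots+|z_n|^2)^{n+m+1}}$ on $\mathbb{C}^n$ ($dV$ Lebesgue measure). Via the embedding $\mathbb{C}^n\hookrightarrow\mathbb{P}^n(\mathbb{C})$, $z\mapsto[1,z]$ (whose image has null complement), the weighted Bergman space $\mathcal{A}^2_m(\mathbb{P}^n(\mathbb{C}))$ (holomorphic sections of the $m$-th power of the dual of the tautological line bundle) is identified with the space $P_m(\mathbb{C}^n)$ of polynomials of degree at most $m$, a subspace of $L_2(\mathbb{C}^n,\nu_m)$. The Bergman projection is $B_m(\psi)(z)=\int_{\mathbb{C}^n}\psi(w)(1+z_1\overline{w}_1+\dots+z_n\overline{w}_n)^m\,d\nu_m(w)$, the orthogonal projection onto this space. For a bounded measurable symbol $\varphi$ on $\mathbb{P}^n(\mathbb{C})$, viewed on $\mathbb{C}^n$ as $z\mapsto\varphi([1,z])$, the Toeplitz operator on $\mathcal{A}^2_m(\mathbb{P}^n(\mathbb{C}))$ is $T_\varphi(f)=B_m(\varphi f)$. *)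

theory Defs
  imports "HOL-Analysis.Analysis"
begin

text \<open>
  Points of \<open>\<complex>\<^sup>n\<close> and \<open>\<complex>\<^sup>n\<^sup>+\<^sup>1\<close> are functions \<open>nat \<Rightarrow> complex\<close> of which only the coordinates
  \<open>1, \<dots>, n\<close> and \<open>0, \<dots>, n\<close>, respectively, are used; multi-indices are functions \<open>nat \<Rightarrow> nat\<close>.
  Lists store \<open>k\<^sub>j\<close> and \<open>h\<^sub>j\<close> (\<open>1 \<le> j \<le> l\<close>) at position \<open>j - 1\<close>, so that \<open>1 # k\<close> stores
  \<open>k\<^sub>0 = 1, k\<^sub>1, \<dots>, k\<^sub>l\<close> at the positions \<open>0, \<dots>, l\<close>.
\<close>

definition is_partition :: "nat list \<Rightarrow> nat \<Rightarrow> bool" where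
  "is_partition k n \<longleftrightarrow> (\<forall>x\<in>set k. 0 < x) \<and> sorted k \<and> sum_list k = n"

definition block_start :: "nat list \<Rightarrow> nat \<Rightarrow> nat" where
  "block_start k j = sum_list (take j (1 # k))"

definition block :: "nat list \<Rightarrow> nat \<Rightarrow> nat set" where
  "block k j = {block_start k j ..< block_start k j + (1 # k) ! j}"

definition entry :: "nat list \<Rightarrow> (nat \<Rightarrow> 'a) \<Rightarrow> nat \<Rightarrow> nat \<Rightarrow> 'a" where
  \<comment> \<open>\<open>(v\<^sub>(\<^sub>j\<^sub>))\<^sub>r\<close> for \<open>1 \<le> r \<le> k\<^sub>j\<close>\<close>
  "entry k v j r = v (block_start k j + r - 1)"

definition block_norm :: "nat list \<Rightarrow> (nat \<Rightarrow> complex) \<Rightarrow> nat \<Rightarrow> real" where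
  "block_norm k w j = L2_set (\<lambda>i. cmod (w i)) (block k j)"


text \<open>A point \<open>[w]\<close> of projective space is the set of nonzero multiples of \<open>w \<noteq> 0\<close>.\<close>

definition proj_point :: "nat \<Rightarrow> (nat \<Rightarrow> complex) \<Rightarrow> (nat \<Rightarrow> complex) set" where
  "proj_point n w = {v \<in> extensional {..n}. \<exists>c. c \<noteq> 0 \<and> (\<forall>i\<le>n. v i = c * w i)}"

definition proj_space :: "nat \<Rightarrow> (nat \<Rightarrow> complex) set set" where
  "proj_space n = proj_point n ` {w. \<exists>i\<le>n. w i \<noteq> 0}"

definition affine_chart :: "nat \<Rightarrow> (nat \<Rightarrow> complex) \<Rightarrow> (nat \<Rightarrow> complex) set" where
  "affine_chart n z = proj_point n (z(0 := 1))"


definition admissible_indices ::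
    "nat list \<Rightarrow> nat list \<Rightarrow> (nat \<Rightarrow> nat) \<Rightarrow> (nat \<Rightarrow> nat) \<Rightarrow> bool" where
  "admissible_indices k h p q \<longleftrightarrow>
     (\<Sum>i\<le>sum_list k. p i * q i) = 0 \<and>
     (\<forall>j\<le>length k. sum p (block k j) = sum q (block k j)) \<and>
     (\<forall>j\<in>{1..length k}.
        (\<forall>r. h ! (j - 1) < r \<and> r \<le> k ! (j - 1) \<longrightarrow> entry k p j r = 0) \<and>
        (\<forall>s. 1 \<le> s \<and> s \<le> h ! (j - 1) \<longrightarrow> entry k q j s = 0))"

definition homogeneous_deg0 :: "nat \<Rightarrow> (real list \<Rightarrow> complex) \<Rightarrow> bool" where
  "homogeneous_deg0 d a \<longleftrightarrow>
     (\<forall>t>0. \<forall>r. length r = d \<and> (\<forall>x\<in>set r. 0 \<le> x) \<longrightarrow> a (map (\<lambda>x. t * x) r) = a r)"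

text \<open>
  The defining formula makes sense only where no block \<open>w\<^sub>(\<^sub>j\<^sub>)\<close> vanishes; on the remaining null set
  the symbol is left unspecified.
\<close>

definition symbol_class :: "nat list \<Rightarrow> nat list \<Rightarrow> ((nat \<Rightarrow> complex) set \<Rightarrow> complex) set" where
  "symbol_class k h =
     {\<phi>. \<exists>a p q. homogeneous_deg0 (length k + 1) a \<and> admissible_indices k h p q \<and>
        (\<forall>w. (\<forall>j\<le>length k. block_norm k w j \<noteq> 0) \<longrightarrow>
           \<phi> (proj_point (sum_list k) w) =
             a (map (block_norm k w) [0..<length k + 1]) *
             (\<Prod>j\<le>length k.
                (\<Prod>i\<in>block k j. (w i / of_real (block_norm k w j)) ^ p i) *
                (\<Prod>i\<in>block k j. (cnj (w i) / of_real (block_norm k w j)) ^ q i)))}"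


definition lebesgue_Cn :: "nat \<Rightarrow> (nat \<Rightarrow> complex) measure" where
  "lebesgue_Cn n = completion (PiM {1..n} (\<lambda>_. lborel))"

definition nu :: "nat \<Rightarrow> nat \<Rightarrow> (nat \<Rightarrow> complex) measure" where
  "nu n m = density (lebesgue_Cn n)
     (\<lambda>z. ennreal (fact (n + m) / (pi ^ n * fact m) *
            (1 / (1 + (\<Sum>i=1..n. (cmod (z i))\<^sup>2)) ^ (n + m + 1))))"

text \<open>
  The image of the affine chart has null complement, so measurability of a symbol is
  measurability in that chart.
\<close>

definition bounded_measurable :: "nat \<Rightarrow> ((nat \<Rightarrow> complex) set \<Rightarrow> complex) \<Rightarrow> bool" where
  "bounded_measurable n \<phi> \<longleftrightarrow>
     bounded (\<phi> ` proj_space n) \<and>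
     (\<lambda>z. \<phi> (affine_chart n z)) \<in> borel_measurable (lebesgue_Cn n)"

text \<open>
  The weighted Bergman space, as the space of polynomials of degree at most \<open>m\<close> in \<open>z\<^sub>1, \<dots>, z\<^sub>n\<close>.
  A polynomial function depends on these coordinates only and is determined by its values on
  \<open>space (nu n m)\<close>, so equality of elements is plain equality of functions.
\<close>

definition bergman_space :: "nat \<Rightarrow> nat \<Rightarrow> ((nat \<Rightarrow> complex) \<Rightarrow> complex) set" where
  "bergman_space n m =
     {f. \<exists>c. f = (\<lambda>z. \<Sum>\<alpha> | (\<forall>i. i \<notin> {1..n} \<longrightarrow> \<alpha> i = (0::nat)) \<and> (\<Sum>i=1..n. \<alpha> i) \<le> m.
                    c \<alpha> * (\<Prod>i=1..n. z i ^ \<alpha> i))}"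

definition bergman_norm :: "nat \<Rightarrow> nat \<Rightarrow> ((nat \<Rightarrow> complex) \<Rightarrow> complex) \<Rightarrow> real" where
  "bergman_norm n m f = sqrt (LINT z|nu n m. (cmod (f z))\<^sup>2)"

definition bergman_proj ::
    "nat \<Rightarrow> nat \<Rightarrow> ((nat \<Rightarrow> complex) \<Rightarrow> complex) \<Rightarrow> (nat \<Rightarrow> complex) \<Rightarrow> complex" where
  "bergman_proj n m \<psi> z =
     (LINT w|nu n m. \<psi> w * (1 + (\<Sum>i=1..n. z i * cnj (w i))) ^ m)"


text \<open>
  An operator on the Bergman space is represented by a map that is \<open>extensional\<close> on it, so that
  two operators are equal iff they agree on the Bergman space.
\<close>

type_synonym operator = "((nat \<Rightarrow> complex) \<Rightarrow> complex) \<Rightarrow> ((nat \<Rightarrow> complex) \<Rightarrow> complex)"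

definition toeplitz :: "nat \<Rightarrow> nat \<Rightarrow> ((nat \<Rightarrow> complex) set \<Rightarrow> complex) \<Rightarrow> operator" where
  "toeplitz n m \<phi> =
     (\<lambda>f\<in>bergman_space n m. bergman_proj n m (\<lambda>w. \<phi> (affine_chart n w) * f w))"

definition bounded_operators :: "nat \<Rightarrow> nat \<Rightarrow> operator set" where
  "bounded_operators n m =
     {T \<in> bergman_space n m \<rightarrow>\<^sub>E bergman_space n m.
        (\<forall>f\<in>bergman_space n m. \<forall>g\<in>bergman_space n m.
           T (\<lambda>z. f z + g z) = (\<lambda>z. T f z + T g z)) \<and>
        (\<forall>c. \<forall>f\<in>bergman_space n m. T (\<lambda>z. c * f z) = (\<lambda>z. c * T f z)) \<and>
        (\<exists>C. \<forall>f\<in>bergman_space n m. bergman_norm n m (T f) \<le> C * bergman_norm n m f)}"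

definition op_add :: "nat \<Rightarrow> nat \<Rightarrow> operator \<Rightarrow> operator \<Rightarrow> operator" where
  "op_add n m S T = (\<lambda>f\<in>bergman_space n m. \<lambda>z. S f z + T f z)"

definition op_scale :: "nat \<Rightarrow> nat \<Rightarrow> complex \<Rightarrow> operator \<Rightarrow> operator" where
  "op_scale n m c T = (\<lambda>f\<in>bergman_space n m. \<lambda>z. c * T f z)"

definition op_comp :: "nat \<Rightarrow> nat \<Rightarrow> operator \<Rightarrow> operator \<Rightarrow> operator" where
  "op_comp n m S T = compose (bergman_space n m) S T"

definition op_norm :: "nat \<Rightarrow> nat \<Rightarrow> operator \<Rightarrow> real" where
  "op_norm n m T =
     (SUP f\<in>{f \<in> bergman_space n m. bergman_norm n m f \<le> 1}. bergman_norm n m (T f))"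

definition op_dist :: "nat \<Rightarrow> nat \<Rightarrow> operator \<Rightarrow> operator \<Rightarrow> real" where
  "op_dist n m S T = op_norm n m (op_add n m S (op_scale n m (-1) T))"

definition banach_subalgebra :: "nat \<Rightarrow> nat \<Rightarrow> operator set \<Rightarrow> bool" where
  "banach_subalgebra n m A \<longleftrightarrow>
     A \<subseteq> bounded_operators n m \<and> A \<noteq> {} \<and>
     (\<forall>S\<in>A. \<forall>T\<in>A. op_add n m S T \<in> A \<and> op_comp n m S T \<in> A) \<and>
     (\<forall>c. \<forall>T\<in>A. op_scale n m c T \<in> A) \<and>
     (\<forall>X T. (\<forall>i. X i \<in> A) \<and> T \<in> bounded_operators n m \<and>
        (\<lambda>i::nat. op_dist n m (X i) T) \<longlonglongrightarrow> 0 \<longrightarrow> T \<in> A)"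

text \<open>
  The smallest norm-closed subalgebra containing \<open>G\<close>.  No unit is adjoined; this is immaterial for
  Toeplitz operators, as the symbol \<open>1\<close> belongs to every class \<open>symbol_class k h\<close> and yields the identity.
\<close>

definition generated_banach_algebra :: "nat \<Rightarrow> nat \<Rightarrow> operator set \<Rightarrow> operator set" where
  "generated_banach_algebra n m G = banach_subalgebra n m hull G"

definition commutative_operators :: "nat \<Rightarrow> nat \<Rightarrow> operator set \<Rightarrow> bool" where
  "commutative_operators n m A \<longleftrightarrow> (\<forall>S\<in>A. \<forall>T\<in>A. op_comp n m S T = op_comp n m T S)"

end

theory Submission
  imports Defs
begin

text \<open>
  In the chart \<open>[1, z]\<close> a symbol of the class is a function \<open>U\<close> of the block radii times \<open>z\<^sup>p\<close> times the
  conjugate of \<open>z\<^sup>q\<close>, where \<open>p\<close> and \<open>q\<close> have equal degree in each block and \<open>p\<close> lives on a set \<open>P\<close> of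
  coordinates, \<open>q\<close> on its complement; the set \<open>P\<close>, the first \<open>h\<^sub>j\<close> coordinates of each block, is the same
  for all symbols (\<open>symbol_quasi_radial\<close>).

  Invariance of the weighted measure under the torus makes monomials orthogonal against functions of the
  radii. Hence the Toeplitz operator sends \<open>z\<^sup>\<alpha>\<close> to a multiple of \<open>z\<^sup>\<beta>\<close> with \<open>\<beta> = \<alpha> + p - q\<close>
  (\<open>toeplitz_monomial\<close>), the factor being the coefficient of the reproducing kernel at \<open>\<beta>\<close> times the
  moment \<open>\<integral> U \<bar>z\<^sup>\<gamma>\<bar>\<^sup>2\<close> with \<open>\<gamma> = \<alpha> + p\<close>. Invariance under rotations inside a block shows that this
  moment is \<open>\<gamma>!\<close> times a function of the block degrees of \<open>\<gamma>\<close> (\<open>moment_block_degree\<close>), and the kernel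
  coefficient is \<open>1 / \<beta>!\<close> times a function of the total degree. So the factor is \<open>(\<alpha> + p)! / (\<alpha> + p - q)!\<close>
  times a function of the block degrees of \<open>\<alpha>\<close>, which all these operators preserve. The quotient is the
  product of \<open>\<alpha>\<^sub>i! / (\<alpha>\<^sub>i - q\<^sub>i)!\<close> over the coordinates off \<open>P\<close>; lowering the exponents by \<open>q\<close> and then by
  \<open>q'\<close> multiplies these to \<open>\<alpha>\<^sub>i! / (\<alpha>\<^sub>i - q\<^sub>i - q'\<^sub>i)!\<close>, which is symmetric (\<open>shift_coeff_commute\<close>).
  Therefore the Toeplitz operators commute (\<open>toeplitz_commute\<close>), and so does the closed algebra that they
  generate, by the double commutant argument (\<open>commutative_generated\<close>).

  The rotation invariance enters only through plane rotations of two coordinates, which are products of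
  shears; the moments are compared by expanding the rotated monomials, and need not be computed.
\<close>

section \<open>Phase changes and rotations preserve the weighted measures\<close>

lemma measurable_update_coordinate:
  assumes "g \<in> measurable M N'" "f \<in> measurable M (PiM I (\<lambda>_. N'))" "i \<in> I"
  shows "(\<lambda>x. (f x)(i := g x)) \<in> measurable M (PiM I (\<lambda>_. N'))"
  using assms by (intro measurable_fun_upd[where J=I]) auto

text \<open>
  By Fubini, a map that changes one coordinate, by a measure-preserving map depending on the other
  coordinates only, preserves the product measure. Phase changes and shears are of this kind.
\<close>

lemma distr_PiM_fibre:
  fixes g :: "('i \<Rightarrow> 'a::euclidean_space) \<Rightarrow> 'a \<Rightarrow> 'a"
  assumes I: "finite I" "i \<in> I"
    and meas: "(\<lambda>z. z(i := g z (z i))) \<in> PiM I (\<lambda>_. lborel) \<rightarrow>\<^sub>M PiM I (\<lambda>_. lborel)"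
    and indep: "\<And>z y. g (z(i := y)) = g z"
    and pres: "\<And>z. g z \<in> lborel \<rightarrow>\<^sub>M lborel" "\<And>z. distr lborel lborel (g z) = lborel"
  shows "distr (PiM I (\<lambda>_. lborel)) (PiM I (\<lambda>_. lborel)) (\<lambda>z. z(i := g z (z i))) = PiM I (\<lambda>_. lborel)"
    (is "distr ?M ?M ?F = ?M")
proof (rule measure_eqI)
  fix A assume "A \<in> sets (distr ?M ?M ?F)"
  then have A: "A \<in> sets ?M" by simp
  interpret product_sigma_finite "\<lambda>_::'i. lborel :: 'a measure" ..
  define J where "J = I - {i}"
  have J: "finite J" "i \<notin> J" "insert i J = I" using I by (auto simp: J_def)
  have ind: "(indicator A :: _ \<Rightarrow> ennreal) \<in> borel_measurable (PiM (insert i J) (\<lambda>_. lborel))"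
    using A J(3) by simp
  have indF: "(\<lambda>z. indicator A (?F z) :: ennreal) \<in> borel_measurable (PiM (insert i J) (\<lambda>_. lborel))"
    unfolding J(3) by (rule measurable_compose[OF meas]) (use A in simp)
  have "emeasure (distr ?M ?M ?F) A = (\<integral>\<^sup>+z. indicator A z \<partial>distr ?M ?M ?F)"
    using A by simp
  also have "\<dots> = (\<integral>\<^sup>+z. indicator A (?F z) \<partial>?M)"
    using meas A by (subst nn_integral_distr) auto
  also have "\<dots> = (\<integral>\<^sup>+x. \<integral>\<^sup>+y. indicator A (x(i := g x y)) \<partial>lborel \<partial>PiM J (\<lambda>_. lborel))"
    using product_nn_integral_insert[OF J(1,2) indF] by (simp add: J(3) indep)
  also have "\<dots> = (\<integral>\<^sup>+x. \<integral>\<^sup>+y. indicator A (x(i := y)) \<partial>lborel \<partial>PiM J (\<lambda>_. lborel))"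
  proof (rule nn_integral_cong)
    fix x assume x: "x \<in> space (PiM J (\<lambda>_. lborel :: 'a measure))"
    have [measurable]: "(\<lambda>y. x(i := y)) \<in> lborel \<rightarrow>\<^sub>M ?M"
      using measurable_component_update[OF x J(2)] by (simp add: J(3))
    have "(\<integral>\<^sup>+y. indicator A (x(i := g x y)) \<partial>lborel) =
          (\<integral>\<^sup>+y. indicator A (x(i := y)) \<partial>distr lborel lborel (g x))"
      using A pres(1) by (subst nn_integral_distr) auto
    then show "(\<integral>\<^sup>+y. indicator A (x(i := g x y)) \<partial>lborel) = (\<integral>\<^sup>+y. indicator A (x(i := y)) \<partial>lborel)"
      by (simp add: pres(2))
  qed
  also have "\<dots> = (\<integral>\<^sup>+z. indicator A z \<partial>?M)"
    using product_nn_integral_insert[OF J(1,2) ind] by (simp add: J(3))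
  finally show "emeasure (distr ?M ?M ?F) A = emeasure ?M A" using A by simp
qed simp

definition shear :: "'i \<Rightarrow> 'i \<Rightarrow> real \<Rightarrow> ('i \<Rightarrow> 'a::euclidean_space) \<Rightarrow> ('i \<Rightarrow> 'a)" where
  "shear i j t z = z(i := z i + t *\<^sub>R z j)"

lemma shear_preserves:
  fixes I :: "'i set"
  assumes I: "finite I" "i \<in> I" "j \<in> I" "i \<noteq> j"
  shows "shear i j t \<in> PiM I (\<lambda>_. lborel::'a::euclidean_space measure) \<rightarrow>\<^sub>M PiM I (\<lambda>_. lborel)" (is ?m)
    and "distr (PiM I (\<lambda>_. lborel)) (PiM I (\<lambda>_. lborel)) (shear i j t) = PiM I (\<lambda>_. lborel::'a measure)" (is ?d)
proof -
  have [measurable]: "(\<lambda>z. z k) \<in> PiM I (\<lambda>_. lborel::'a measure) \<rightarrow>\<^sub>M borel" if "k \<in> I" for k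
    using measurable_component_singleton[OF that, of "\<lambda>_. lborel::'a measure"] by simp
  have "(\<lambda>z. z(i := z i + t *\<^sub>R z j)) \<in> PiM I (\<lambda>_. lborel) \<rightarrow>\<^sub>M PiM I (\<lambda>_. lborel::'a measure)"
    using I by (intro measurable_update_coordinate) auto
  moreover show ?m unfolding shear_def[abs_def] by fact
  moreover have "distr lborel lborel (\<lambda>y. y + t *\<^sub>R z j) = lborel" for z :: "'i \<Rightarrow> 'a"
    using lborel_distr_plus[of "t *\<^sub>R z j"] by (simp add: add.commute cong: distr_cong)
  ultimately show ?d
    unfolding shear_def[abs_def]
    using I by (intro distr_PiM_fibre[where g="\<lambda>z y. y + t *\<^sub>R z j"]) auto
qed

definition rotate2 :: "'i \<Rightarrow> 'i \<Rightarrow> real \<Rightarrow> real \<Rightarrow> ('i \<Rightarrow> 'a::euclidean_space) \<Rightarrow> ('i \<Rightarrow> 'a)" where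
  "rotate2 i j c s z = z(i := c *\<^sub>R z i - s *\<^sub>R z j, j := s *\<^sub>R z i + c *\<^sub>R z j)"

text \<open>
  A plane rotation by an angle \<open>\<theta> \<noteq> \<pi>\<close> is a product of three shears, with parameter
  \<open>t = tan (\<theta>/2)\<close>. Invariance of Lebesgue measure under rotations thus reduces to translation
  invariance in a single coordinate.
\<close>

lemma rotate2_eq_shears:
  assumes "i \<noteq> j" "c\<^sup>2 + s\<^sup>2 = 1" "c \<noteq> -1"
  defines "t \<equiv> s / (1 + c)"
  shows "rotate2 i j c s = shear i j (-t) \<circ> shear j i s \<circ> shear i j (-t)"
proof
  fix z :: "'a \<Rightarrow> 'b"
  have c1: "1 + c \<noteq> 0" using assms(3) by auto
  have ts: "1 - s * t = c"
    using assms(2) c1 by (simp add: t_def field_simps power2_eq_square)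
  have tc: "t * (1 + c) = s" using c1 by (simp add: t_def)
  have tc': "t + t * c = s" using tc by (simp add: algebra_simps)
  have A: "z j + s *\<^sub>R (z i - t *\<^sub>R z j) = s *\<^sub>R z i + c *\<^sub>R z j"
    by (subst ts[symmetric]) (simp add: algebra_simps)
  have "z i - t *\<^sub>R z j - t *\<^sub>R (s *\<^sub>R z i + c *\<^sub>R z j) = (1 - s*t) *\<^sub>R z i - (t + t*c) *\<^sub>R z j"
    by (simp add: algebra_simps)
  then have B: "z i - t *\<^sub>R z j - t *\<^sub>R (s *\<^sub>R z i + c *\<^sub>R z j) = c *\<^sub>R z i - s *\<^sub>R z j"
    by (simp only: ts tc')
  show "rotate2 i j c s z = (shear i j (-t) \<circ> shear j i s \<circ> shear i j (-t)) z"
    using assms(1) A B by (simp add: rotate2_def shear_def fun_eq_iff)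
qed

lemma distr_comp_preserves:
  assumes "f \<in> M \<rightarrow>\<^sub>M M" "distr M M f = M" "g \<in> M \<rightarrow>\<^sub>M M" "distr M M g = M"
  shows "distr M M (f \<circ> g) = M"
  using distr_distr[of f M M g M] assms by simp

lemma rotate2_preserves:
  fixes I :: "'i set"
  assumes I: "finite I" "i \<in> I" "j \<in> I" "i \<noteq> j" and cs: "c\<^sup>2 + s\<^sup>2 = 1" "c \<noteq> -1"
  shows "rotate2 i j c s \<in> PiM I (\<lambda>_. lborel::'a::euclidean_space measure) \<rightarrow>\<^sub>M PiM I (\<lambda>_. lborel)"
    and "distr (PiM I (\<lambda>_. lborel)) (PiM I (\<lambda>_. lborel)) (rotate2 i j c s) = PiM I (\<lambda>_. lborel::'a measure)"
  unfolding rotate2_eq_shears[OF I(4) cs]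
  using I by (auto intro!: distr_comp_preserves measurable_comp shear_preserves)

text \<open>
  Multiplication by \<open>u\<close> is the rotation of the real coordinate plane \<open>{1, \<i>}\<close>, over which
  Lebesgue measure on \<open>\<complex>\<close> is a product.
\<close>

lemma lborel_complex_rotate:
  assumes "cmod u = 1" "u \<noteq> -1"
  shows "distr lborel lborel ((*) u) = (lborel :: complex measure)"
proof -
  let ?M = "PiM (Basis::complex set) (\<lambda>_. lborel :: real measure)"
  let ?S = "\<lambda>f. \<Sum>b\<in>(Basis::complex set). f b *\<^sub>R b"
  have cs: "(Re u)\<^sup>2 + (Im u)\<^sup>2 = 1" "Re u \<noteq> -1"
  proof -
    show 1: "(Re u)\<^sup>2 + (Im u)\<^sup>2 = 1" using assms(1) by (simp add: cmod_def)
    show "Re u \<noteq> -1"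
    proof
      assume "Re u = -1"
      with 1 have "Im u = 0" by simp
      with \<open>Re u = -1\<close> assms(2) show False by (simp add: complex_eq_iff)
    qed
  qed
  have mS: "?S \<in> ?M \<rightarrow>\<^sub>M borel"
    by (intro borel_measurable_sum borel_measurable_scaleR) (auto intro: measurable_component_singleton)
  note R = rotate2_preserves[where 'a=real and I="Basis :: complex set" and i=1 and j=\<i>, OF _ _ _ _ cs]
  have mR: "rotate2 1 \<i> (Re u) (Im u) \<in> ?M \<rightarrow>\<^sub>M ?M" and
       dR: "distr ?M ?M (rotate2 1 \<i> (Re u) (Im u)) = ?M"
    using R by (auto simp: Basis_complex_def)
  have eq: "(*) u \<circ> ?S = ?S \<circ> rotate2 1 \<i> (Re u) (Im u)"
    by (auto simp: fun_eq_iff Basis_complex_def rotate2_def complex_eq_iff algebra_simps)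
  have "distr lborel lborel ((*) u) = distr (distr ?M borel ?S) borel ((*) u)"
    by (subst lborel_eq) (simp cong: distr_cong)
  also have "\<dots> = distr ?M borel ((*) u \<circ> ?S)"
    using mS by (subst distr_distr) auto
  also have "\<dots> = distr (distr ?M ?M (rotate2 1 \<i> (Re u) (Im u))) borel ?S"
    unfolding eq using mS mR by (subst distr_distr) auto
  also have "\<dots> = lborel" by (simp add: dR lborel_eq[symmetric])
  finally show ?thesis .
qed

definition phase :: "'i \<Rightarrow> complex \<Rightarrow> ('i \<Rightarrow> complex) \<Rightarrow> ('i \<Rightarrow> complex)" where
  "phase i u z = z(i := u * z i)"

lemma phase_preserves:
  assumes I: "finite I" "i \<in> I" and u: "cmod u = 1" "u \<noteq> -1"
  shows "phase i u \<in> PiM I (\<lambda>_. lborel) \<rightarrow>\<^sub>M PiM I (\<lambda>_. lborel)" (is ?m)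
    and "distr (PiM I (\<lambda>_. lborel)) (PiM I (\<lambda>_. lborel)) (phase i u) = PiM I (\<lambda>_. lborel)" (is ?d)
proof -
  have [measurable]: "(\<lambda>z. z i) \<in> PiM I (\<lambda>_. lborel::complex measure) \<rightarrow>\<^sub>M borel"
    using measurable_component_singleton[OF I(2), of "\<lambda>_. lborel::complex measure"] by simp
  have "(\<lambda>z. z(i := u * z i)) \<in> PiM I (\<lambda>_. lborel) \<rightarrow>\<^sub>M PiM I (\<lambda>_. lborel::complex measure)"
    using I by (intro measurable_update_coordinate) auto
  moreover show ?m unfolding phase_def[abs_def] by fact
  ultimately show ?d
    unfolding phase_def[abs_def]
    using distr_PiM_fibre[where g="\<lambda>z y. u * y" and I=I and i=i] I lborel_complex_rotate[OF u]
    by simp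
qed

definition sqnorm :: "nat \<Rightarrow> (nat \<Rightarrow> complex) \<Rightarrow> real" where
  "sqnorm n z = (\<Sum>i=1..n. (cmod (z i))\<^sup>2)"

text \<open>
  Symbols are measurable only with respect to the completed Lebesgue measure, so invariance is
  needed there as well.
\<close>

lemma preserves_completion:
  assumes "f \<in> M \<rightarrow>\<^sub>M M" "distr M M f = M"
  shows "f \<in> completion M \<rightarrow>\<^sub>M completion M" "distr (completion M) (completion M) f = completion M"
proof -
  have d: "distr (completion M) M f = M" using assms by (simp add: distr_completion)
  have m: "f \<in> completion M \<rightarrow>\<^sub>M M" using assms by (simp add: measurable_completion)
  show "f \<in> completion M \<rightarrow>\<^sub>M completion M"
    using m by (rule completion.measurable_completion2) (simp add: d)
  have "completion (distr (completion M) M f) = distr (completion M) (completion M) f"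
    using m by (rule completion.completion_distr_eq) (simp add: d)
  then show "distr (completion M) (completion M) f = completion M" by (simp add: d)
qed

lemma sqnorm_measurable [measurable]: "sqnorm n \<in> borel_measurable (lebesgue_Cn n)"
proof -
  have "(\<lambda>z. z i) \<in> PiM {1..n} (\<lambda>_. lborel::complex measure) \<rightarrow>\<^sub>M borel" if "i \<in> {1..n}" for i
    using measurable_component_singleton[OF that, of "\<lambda>_. lborel::complex measure"] by simp
  then have "sqnorm n \<in> borel_measurable (PiM {1..n} (\<lambda>_. lborel::complex measure))"
    unfolding sqnorm_def[abs_def]
    by (intro borel_measurable_sum borel_measurable_power borel_measurable_norm measurable_compose[OF _ borel_measurable_norm]) auto
  then show ?thesis unfolding lebesgue_Cn_def by (rule measurable_completion)
qed

lemma sets_nu [simp, measurable_cong]: "sets (nu n m) = sets (lebesgue_Cn n)"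
  by (simp add: nu_def)

text \<open>
  The density of the weighted measure is a function of \<open>sqnorm\<close>.
\<close>

lemma nu_preserves:
  assumes "f \<in> PiM {1..n} (\<lambda>_. lborel) \<rightarrow>\<^sub>M PiM {1..n} (\<lambda>_. lborel)"
    and "distr (PiM {1..n} (\<lambda>_. lborel)) (PiM {1..n} (\<lambda>_. lborel)) f = PiM {1..n} (\<lambda>_. lborel)"
    and inv: "\<And>z. sqnorm n (f z) = sqnorm n z"
  shows "f \<in> nu n m \<rightarrow>\<^sub>M nu n m" "distr (nu n m) (nu n m) f = nu n m"
proof -
  let ?L = "lebesgue_Cn n"
  define d where "d z = ennreal (fact (n + m) / (pi ^ n * fact m) * (1 / (1 + sqnorm n z) ^ (n + m + 1)))" for z
  have nu: "nu n m = density ?L d" by (simp add: nu_def d_def[abs_def] sqnorm_def)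
  have fL: "f \<in> ?L \<rightarrow>\<^sub>M ?L" and dL: "distr ?L ?L f = ?L"
    using preserves_completion[OF assms(1,2)] by (simp_all add: lebesgue_Cn_def)
  show "f \<in> nu n m \<rightarrow>\<^sub>M nu n m" using fL by (simp add: nu cong: measurable_cong_sets)
  have [measurable]: "d \<in> borel_measurable ?L" unfolding d_def[abs_def] by measurable
  have "density (distr ?L ?L f) d = distr (density ?L (\<lambda>x. d (f x))) ?L f"
    by (rule density_distr) (use fL in auto)
  also have "(\<lambda>x. d (f x)) = d" by (simp add: d_def[abs_def] inv)
  finally have "density ?L d = distr (density ?L d) ?L f" by (simp add: dL)
  also have "\<dots> = distr (density ?L d) (density ?L d) f" by (rule distr_cong) auto
  finally show "distr (nu n m) (nu n m) f = nu n m" by (simp add: nu)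
qed

lemma cmod_rotate2:
  assumes "c\<^sup>2 + s\<^sup>2 = 1"
  shows "(cmod (c *\<^sub>R x - s *\<^sub>R y))\<^sup>2 + (cmod (s *\<^sub>R x + c *\<^sub>R y))\<^sup>2 = (cmod x)\<^sup>2 + (cmod y)\<^sup>2"
proof -
  have "(c * a - s * b)\<^sup>2 + (s * a + c * b)\<^sup>2 = (c\<^sup>2 + s\<^sup>2) * (a\<^sup>2 + b\<^sup>2)" for a b :: real
    by (simp add: power2_eq_square algebra_simps)
  then have "(c * a - s * b)\<^sup>2 + (s * a + c * b)\<^sup>2 = a\<^sup>2 + b\<^sup>2" for a b :: real using assms by simp
  from this[of "Re x" "Re y"] this[of "Im x" "Im y"] show ?thesis
    by (simp add: cmod_power2)
qed

lemma sum_split2: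
  fixes i j :: "'i"
  assumes "finite I" "i \<in> I" "j \<in> I" "i \<noteq> j"
  shows "sum f I = f i + f j + sum f (I - {i, j})"
proof -
  have "sum f I = f i + sum f (I - {i})" using assms by (simp add: sum.remove)
  also have "sum f (I - {i}) = f j + sum f (I - {i} - {j})" using assms by (subst sum.remove[of _ j]) auto
  finally show ?thesis by (simp add: Diff_insert2[symmetric] insert_commute add.assoc)
qed

lemma sum_cmod_rotate2:
  assumes "i \<in> I" "j \<in> I" "i \<noteq> j" "finite I" "c\<^sup>2 + s\<^sup>2 = 1"
  shows "(\<Sum>r\<in>I. (cmod (rotate2 i j c s z r))\<^sup>2) = (\<Sum>r\<in>I. (cmod (z r))\<^sup>2)"
proof -
  have "(\<Sum>r\<in>I - {i, j}. (cmod (rotate2 i j c s z r))\<^sup>2) = (\<Sum>r\<in>I - {i, j}. (cmod (z r))\<^sup>2)"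
    by (intro sum.cong) (auto simp: rotate2_def)
  with cmod_rotate2[OF assms(5), of "z i" "z j"] show ?thesis
    unfolding sum_split2[OF assms(4,1-3)] using assms(3) by (simp add: rotate2_def)
qed

lemma nu_rotate2:
  assumes "i \<in> {1..n}" "j \<in> {1..n}" "i \<noteq> j" "c\<^sup>2 + s\<^sup>2 = 1" "c \<noteq> -1"
  shows "rotate2 i j c s \<in> nu n m \<rightarrow>\<^sub>M nu n m" "distr (nu n m) (nu n m) (rotate2 i j c s) = nu n m"
  by (rule nu_preserves; use assms in \<open>simp add: rotate2_preserves sqnorm_def sum_cmod_rotate2\<close>)+

lemma nu_phase:
  assumes "i \<in> {1..n}" "cmod u = 1" "u \<noteq> -1"
  shows "phase i u \<in> nu n m \<rightarrow>\<^sub>M nu n m" "distr (nu n m) (nu n m) (phase i u) = nu n m"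
proof -
  have "sqnorm n (phase i u z) = sqnorm n z" for z
    unfolding sqnorm_def by (intro sum.cong) (auto simp: phase_def norm_mult assms)
  with assms show "phase i u \<in> nu n m \<rightarrow>\<^sub>M nu n m" "distr (nu n m) (nu n m) (phase i u) = nu n m"
    by (auto intro!: nu_preserves phase_preserves)
qed

section \<open>Integrability against the weighted measures\<close>

lemma nn_integral_inverse_square_real:
  assumes A: "A > 0"
  shows "(\<integral>\<^sup>+x. ennreal (1 / (A + x\<^sup>2)) \<partial>lborel) \<le> ennreal (pi / sqrt A)"
proof -
  let ?f = "\<lambda>x::real. 1 / (A + x\<^sup>2)"
  have pos: "A + x\<^sup>2 > 0" for x :: real using A by (simp add: add_pos_nonneg)
  have half: "(\<integral>\<^sup>+x. ennreal (?f x) * indicator {0..} x \<partial>lborel) = ennreal (pi / 2 / sqrt A - arctan (0 / sqrt A) / sqrt A)"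
  proof (rule nn_integral_FTC_atLeast)
    fix x :: real
    have e1: "A * (1 + (x / sqrt A)\<^sup>2) = A + x\<^sup>2"
      using A by (simp add: power_divide field_simps)
    have e2: "inverse q * (1 / sqrt A) / sqrt A = 1 / (A * q)" for q
    proof -
      have r: "sqrt A * sqrt A = A" using A by simp
      have "inverse q * (1 / sqrt A) / sqrt A = inverse q / (sqrt A * sqrt A)"
        by (simp only: times_divide_eq_right mult_1_right divide_divide_eq_left)
      also have "\<dots> = 1 / (A * q)" unfolding r
        by (simp only: divide_inverse mult_1_left inverse_mult_distrib mult.commute)
      finally show ?thesis .
    qed
    have eq: "?f x = inverse (1 + (x / sqrt A)\<^sup>2) * (1 / sqrt A) / sqrt A"
      unfolding e2 e1 by (rule refl)
    show "DERIV (\<lambda>x. arctan (x / sqrt A) / sqrt A) x :> ?f x"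
      unfolding eq using A
      by (intro DERIV_cdivide DERIV_chain2[OF DERIV_arctan] DERIV_ident)
    show "0 \<le> ?f x" using pos[of x] by simp
  next
    have "filterlim (\<lambda>x. 1 / sqrt A * x) at_top at_top"
      using A by (intro filterlim_tendsto_pos_mult_at_top[OF tendsto_const]) (auto simp: filterlim_ident)
    then have "((\<lambda>x. arctan (1 / sqrt A * x)) \<longlongrightarrow> pi / 2) at_top"
      by (rule filterlim_compose[OF tendsto_arctan_at_top])
    then show "((\<lambda>x. arctan (x / sqrt A) / sqrt A) \<longlongrightarrow> pi / 2 / sqrt A) at_top"
      using A by (intro tendsto_divide tendsto_const) auto
  qed simp
  have "(\<integral>\<^sup>+x. ennreal (?f x) * indicator {..0} x \<partial>lborel) =
        (\<integral>\<^sup>+x. ennreal (?f x) * indicator {..0} x \<partial>distr lborel borel uminus)"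
    by (simp add: lborel_distr_uminus)
  also have "\<dots> = (\<integral>\<^sup>+x. ennreal (?f x) * indicator {0..} x \<partial>lborel)"
    by (subst nn_integral_distr) (auto intro!: nn_integral_cong simp: indicator_def)
  finally have neg: "(\<integral>\<^sup>+x. ennreal (?f x) * indicator {..0} x \<partial>lborel) =
                     (\<integral>\<^sup>+x. ennreal (?f x) * indicator {0..} x \<partial>lborel)" .
  have "(\<integral>\<^sup>+x. ennreal (?f x) \<partial>lborel) \<le>
        (\<integral>\<^sup>+x. ennreal (?f x) * indicator {0..} x + ennreal (?f x) * indicator {..0} x \<partial>lborel)"
    by (intro nn_integral_mono) (auto simp: indicator_def)
  also have "\<dots> = (\<integral>\<^sup>+x. ennreal (?f x) * indicator {0..} x \<partial>lborel) + (\<integral>\<^sup>+x. ennreal (?f x) * indicator {..0} x \<partial>lborel)"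
    by (rule nn_integral_add) auto
  also have "\<dots> = ennreal (pi / 2 / sqrt A) + ennreal (pi / 2 / sqrt A)"
    unfolding neg half by simp
  also have "\<dots> = ennreal (pi / sqrt A)"
    using A by (subst ennreal_plus[symmetric]) auto
  finally show ?thesis .
qed

text \<open>
  The inequality \<open>(A + x\<^sup>2 + y\<^sup>2)\<^sup>2 \<ge> (A + x\<^sup>2)(A + y\<^sup>2)\<close> splits the integral into two real ones;
  the remaining factors are bounded by \<open>1 / A ^ k\<close>. The exponent drops by one, as it would in the exact
  value, which is what the induction on the dimension consumes.
\<close>

lemma nn_integral_inverse_power_complex:
  assumes A: "A > 0"
  shows "(\<integral>\<^sup>+w. ennreal (1 / (A + (cmod w)\<^sup>2) ^ (k + 2)) \<partial>lborel) \<le> ennreal (pi\<^sup>2 / A ^ (k + 1))"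
proof -
  let ?g = "\<lambda>x::real. ennreal (1 / (A + x\<^sup>2))"
  have "(\<integral>\<^sup>+w. ennreal (1 / (A + (cmod w)\<^sup>2) ^ (k + 2)) \<partial>lborel) \<le>
        (\<integral>\<^sup>+w. ennreal (1 / A ^ k) * (\<Prod>b\<in>Basis. ?g (w \<bullet> b)) \<partial>(lborel::complex measure))"
  proof (rule nn_integral_mono)
    fix w :: complex
    have p: "A + (Re w)\<^sup>2 > 0" "A + (Im w)\<^sup>2 > 0" "A ^ k > 0"
      using A by (auto simp: add_pos_nonneg)
    have "A ^ k * ((A + (Re w)\<^sup>2) * (A + (Im w)\<^sup>2)) \<le>
          (A + (cmod w)\<^sup>2) ^ k * ((A + (cmod w)\<^sup>2) * (A + (cmod w)\<^sup>2))"
      using A p by (intro mult_mono power_mono) (auto simp: cmod_power2)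
    also have "\<dots> = (A + (cmod w)\<^sup>2) ^ (k + 2)" by (simp add: power_add power2_eq_square)
    finally have "1 / (A + (cmod w)\<^sup>2) ^ (k + 2) \<le> 1 / (A ^ k * ((A + (Re w)\<^sup>2) * (A + (Im w)\<^sup>2)))"
      using p by (intro divide_left_mono) (auto intro!: mult_pos_pos zero_less_power add_pos_nonneg A)
    also have "\<dots> = 1 / A ^ k * (1 / (A + (Re w)\<^sup>2) * (1 / (A + (Im w)\<^sup>2)))" by simp
    finally show "ennreal (1 / (A + (cmod w)\<^sup>2) ^ (k + 2)) \<le> ennreal (1 / A ^ k) * (\<Prod>b\<in>Basis. ?g (w \<bullet> b))"
      using p by (simp add: Basis_complex_def ennreal_mult''[symmetric] ennreal_leI)
  qed
  also have "\<dots> = ennreal (1 / A ^ k) * (\<Prod>b\<in>(Basis::complex set). \<integral>\<^sup>+x. ?g x \<partial>lborel)"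
    by (subst nn_integral_cmult, measurable) (subst nn_integral_lborel_prod, auto)
  also have "\<dots> \<le> ennreal (1 / A ^ k) * (\<Prod>b\<in>(Basis::complex set). ennreal (pi / sqrt A))"
    using nn_integral_inverse_square_real[OF A]
    by (intro mult_left_mono) (auto simp: Basis_complex_def intro!: mult_mono)
  also have "\<dots> = ennreal (1 / A ^ k * (pi / sqrt A * (pi / sqrt A)))"
    using A by (simp add: Basis_complex_def ennreal_mult''[symmetric])
  also have "1 / A ^ k * (pi / sqrt A * (pi / sqrt A)) = pi\<^sup>2 / A ^ (k + 1)"
    using A by (simp add: power2_eq_square)
  finally show ?thesis .
qed

text \<open>
  Integrating out one complex coordinate, with \<open>A\<close> plus the squares of the others in place of \<open>A\<close>,
  lowers the exponent by one.
\<close>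

lemma nn_integral_inverse_power_PiM:
  fixes F :: "'i set"
  assumes "finite F" "A > 0"
  shows "(\<integral>\<^sup>+z. ennreal (1 / (A + (\<Sum>i\<in>F. (cmod (z i))\<^sup>2)) ^ (card F + 1)) \<partial>PiM F (\<lambda>_. lborel))
           \<le> ennreal ((pi\<^sup>2) ^ card F / A)"
  using assms
proof (induction F)
  case empty
  interpret product_sigma_finite "\<lambda>_::'i. lborel :: complex measure" ..
  show ?case using empty by (simp add: nn_integral_empty space_PiM)
next
  case (insert a F)
  interpret product_sigma_finite "\<lambda>_::'i. lborel :: complex measure" ..
  let ?S = "\<lambda>z. \<Sum>i\<in>F. (cmod (z i))\<^sup>2"
  let ?M = "\<lambda>I. PiM I (\<lambda>_::'i. lborel::complex measure)"
  have [measurable]: "(\<lambda>z. z i) \<in> ?M I \<rightarrow>\<^sub>M borel" if "i \<in> I" for i I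
    using measurable_component_singleton[OF that, of "\<lambda>_. lborel::complex measure"] by simp
  have sum_meas: "(\<lambda>z. \<Sum>i\<in>J. (cmod (z i))\<^sup>2) \<in> borel_measurable (?M I)" if "J \<subseteq> I" for I J
    using that by (intro borel_measurable_sum borel_measurable_power measurable_compose[OF _ borel_measurable_norm]) auto
  have [measurable]: "?S \<in> borel_measurable (?M F)" by (rule sum_meas) auto
  have "(\<integral>\<^sup>+z. ennreal (1 / (A + (\<Sum>i\<in>insert a F. (cmod (z i))\<^sup>2)) ^ (card (insert a F) + 1)) \<partial>?M (insert a F)) =
        (\<integral>\<^sup>+x. \<integral>\<^sup>+y. ennreal (1 / (A + (\<Sum>i\<in>insert a F. (cmod ((x(a := y)) i))\<^sup>2)) ^ (card (insert a F) + 1)) \<partial>lborel \<partial>?M F)"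
    using insert sum_meas[of "insert a F" "insert a F"] by (subst product_nn_integral_insert) auto
  also have "\<dots> \<le> (\<integral>\<^sup>+x. ennreal (pi\<^sup>2) * ennreal (1 / (A + ?S x) ^ (card F + 1)) \<partial>?M F)"
  proof (rule nn_integral_mono)
    fix x :: "'i \<Rightarrow> complex"
    have S: "(\<Sum>i\<in>insert a F. (cmod ((x(a := y)) i))\<^sup>2) = (cmod y)\<^sup>2 + ?S x" for y
    proof -
      have "(\<Sum>i\<in>F. (cmod ((x(a := y)) i))\<^sup>2) = ?S x" using insert by (intro sum.cong) auto
      then show ?thesis using insert by simp
    qed
    have pos: "A + ?S x > 0" using insert by (simp add: add_pos_nonneg sum_nonneg)
    have "(\<integral>\<^sup>+y. ennreal (1 / (A + (\<Sum>i\<in>insert a F. (cmod ((x(a := y)) i))\<^sup>2)) ^ (card (insert a F) + 1)) \<partial>lborel) =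
          (\<integral>\<^sup>+y. ennreal (1 / ((A + ?S x) + (cmod y)\<^sup>2) ^ (card F + 2)) \<partial>lborel)"
      unfolding S using insert by (simp add: ac_simps)
    also have "\<dots> \<le> ennreal (pi\<^sup>2 / (A + ?S x) ^ (card F + 1))"
      by (rule nn_integral_inverse_power_complex[OF pos])
    also have "\<dots> = ennreal (pi\<^sup>2) * ennreal (1 / (A + ?S x) ^ (card F + 1))"
      using pos by (simp add: ennreal_mult''[symmetric])
    finally show "(\<integral>\<^sup>+y. ennreal (1 / (A + (\<Sum>i\<in>insert a F. (cmod ((x(a := y)) i))\<^sup>2)) ^ (card (insert a F) + 1)) \<partial>lborel)
        \<le> ennreal (pi\<^sup>2) * ennreal (1 / (A + ?S x) ^ (card F + 1))" .
  qed
  also have "\<dots> = ennreal (pi\<^sup>2) * (\<integral>\<^sup>+x. ennreal (1 / (A + ?S x) ^ (card F + 1)) \<partial>?M F)"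
    by (rule nn_integral_cmult) measurable
  also have "\<dots> \<le> ennreal (pi\<^sup>2) * ennreal ((pi\<^sup>2) ^ card F / A)"
    by (intro mult_left_mono insert.IH insert.prems) auto
  also have "\<dots> = ennreal ((pi\<^sup>2) ^ card (insert a F) / A)"
    using insert by (simp add: ennreal_mult''[symmetric])
  finally show ?case .
qed

lemma sqnorm_nonneg: "sqnorm n z \<ge> 0"
  by (simp add: sqnorm_def sum_nonneg)

text \<open>
  The growth bound cancels all but \<open>n + 1\<close> powers of the denominator of the density, the number for
  which the integral converges.
\<close>

lemma integrable_nu:
  fixes g :: "(nat \<Rightarrow> complex) \<Rightarrow> complex"
  assumes g: "g \<in> borel_measurable (lebesgue_Cn n)"
    and bound: "AE z in nu n m. cmod (g z) \<le> K * (1 + sqnorm n z) ^ m"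
  shows "integrable (nu n m) g"
proof -
  define c :: real where "c = fact (n + m) / (pi ^ n * fact m)"
  have c: "c \<ge> 0" by (simp add: c_def)
  have nu: "nu n m = density (lebesgue_Cn n) (\<lambda>z. ennreal (c * (1 / (1 + sqnorm n z) ^ (n + m + 1))))"
    by (simp add: nu_def c_def sqnorm_def)
  have "integrable (nu n m) (\<lambda>z. \<bar>K\<bar> * (1 + sqnorm n z) ^ m)"
  proof (rule integrableI_bounded)
    have [measurable]: "sqnorm n \<in> borel_measurable (nu n m)" by simp
    show "(\<lambda>z. \<bar>K\<bar> * (1 + sqnorm n z) ^ m) \<in> borel_measurable (nu n m)" by measurable
    have "(\<integral>\<^sup>+z. ennreal (norm (\<bar>K\<bar> * (1 + sqnorm n z) ^ m)) \<partial>nu n m) =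
          (\<integral>\<^sup>+z. ennreal (c * (1 / (1 + sqnorm n z) ^ (n + m + 1))) * ennreal (norm (\<bar>K\<bar> * (1 + sqnorm n z) ^ m)) \<partial>lebesgue_Cn n)"
      unfolding nu by (subst nn_integral_density) (auto intro: sqnorm_measurable)
    also have "\<dots> = (\<integral>\<^sup>+z. ennreal (c * \<bar>K\<bar>) * ennreal (1 / (1 + sqnorm n z) ^ (n + 1)) \<partial>lebesgue_Cn n)"
    proof (rule nn_integral_cong)
      fix z
      have p: "1 + sqnorm n z > 0" using sqnorm_nonneg[of n z] by linarith
      have "(1 + sqnorm n z) ^ (n + m + 1) = (1 + sqnorm n z) ^ (n + 1) * (1 + sqnorm n z) ^ m"
        by (simp add: power_add)
      then have "c * (1 / (1 + sqnorm n z) ^ (n + m + 1)) * norm (\<bar>K\<bar> * (1 + sqnorm n z) ^ m) = c * \<bar>K\<bar> * (1 / (1 + sqnorm n z) ^ (n + 1))"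
        using p by (simp add: abs_mult)
      then show "ennreal (c * (1 / (1 + sqnorm n z) ^ (n + m + 1))) * ennreal (norm (\<bar>K\<bar> * (1 + sqnorm n z) ^ m)) =
            ennreal (c * \<bar>K\<bar>) * ennreal (1 / (1 + sqnorm n z) ^ (n + 1))"
        using p c by (simp only: ennreal_mult''[symmetric] norm_ge_zero zero_le_divide_1_iff zero_le_power less_imp_le)
    qed
    also have "\<dots> = ennreal (c * \<bar>K\<bar>) * (\<integral>\<^sup>+z. ennreal (1 / (1 + sqnorm n z) ^ (n + 1)) \<partial>lebesgue_Cn n)"
      by (rule nn_integral_cmult) measurable
    also have "(\<integral>\<^sup>+z. ennreal (1 / (1 + sqnorm n z) ^ (n + 1)) \<partial>lebesgue_Cn n) \<le> ennreal ((pi\<^sup>2) ^ n)"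
      using nn_integral_inverse_power_PiM[of "{1..n}" 1]
      by (simp add: lebesgue_Cn_def nn_integral_completion sqnorm_def)
    finally have "(\<integral>\<^sup>+z. ennreal (norm (\<bar>K\<bar> * (1 + sqnorm n z) ^ m)) \<partial>nu n m) \<le> ennreal (c * \<bar>K\<bar>) * ennreal ((pi\<^sup>2) ^ n)"
      by (simp add: mult_left_mono)
    also have "\<dots> < \<infinity>" by (simp add: ennreal_mult_less_top)
    finally show "(\<integral>\<^sup>+z. ennreal (norm (\<bar>K\<bar> * (1 + sqnorm n z) ^ m)) \<partial>nu n m) < \<infinity>" .
  qed
  then show ?thesis
  proof (rule Bochner_Integration.integrable_bound)
    show "g \<in> borel_measurable (nu n m)" using g by simp
    show "AE z in nu n m. norm (g z) \<le> norm (\<bar>K\<bar> * (1 + sqnorm n z) ^ m)"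
      using bound
    proof eventually_elim
      case (elim z)
      have "K * (1 + sqnorm n z) ^ m \<le> \<bar>K\<bar> * (1 + sqnorm n z) ^ m"
        using sqnorm_nonneg[of n z] by (intro mult_right_mono) auto
      with elim have "cmod (g z) \<le> \<bar>K\<bar> * (1 + sqnorm n z) ^ m" by linarith
      also have "\<dots> \<le> norm (\<bar>K\<bar> * (1 + sqnorm n z) ^ m)" by (simp only: real_norm_def abs_ge_self)
      finally show ?case .
    qed
  qed
qed

lemma lebesgue_Cn_AE_nonzero: "AE z in lebesgue_Cn n. \<forall>i\<in>{1..n}. z i \<noteq> 0"
proof -
  interpret product_sigma_finite "\<lambda>_::nat. lborel :: complex measure" ..
  let ?M = "PiM {1..n} (\<lambda>_. lborel::complex measure)"
  have "AE z in ?M. z i \<noteq> 0" if i: "i \<in> {1..n}" for i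
  proof (rule AE_I)
    let ?E = "PiE {1..n} (\<lambda>r. if r = i then {0::complex} else UNIV)"
    show "{z \<in> space ?M. \<not> z i \<noteq> 0} \<subseteq> ?E"
      by (auto simp: space_PiM PiE_def Pi_def split: if_splits)
    have "emeasure ?M ?E = (\<Prod>r\<in>{1..n}. emeasure lborel (if r = i then {0::complex} else UNIV))"
      by (rule emeasure_PiM) auto
    also have "\<dots> = 0" using i by (intro prod_zero bexI[of _ i]) auto
    finally show "emeasure ?M ?E = 0" .
    show "?E \<in> sets ?M" by (rule sets_PiM_I_finite) auto
  qed
  then have "AE z in ?M. \<forall>i\<in>{1..n}. z i \<noteq> 0" by (simp add: AE_ball_countable)
  then show ?thesis
    unfolding lebesgue_Cn_def by (rule AE_completion)
qed

lemma nu_AE_nonzero: "AE z in nu n m. \<forall>i\<in>{1..n}. z i \<noteq> 0"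
  unfolding nu_def sqnorm_def[symmetric]
  by (subst AE_density, measurable) (rule eventually_mono[OF lebesgue_Cn_AE_nonzero], blast)

lemma nu_not_AE_False: "\<not> (AE z in nu n m. False)"
proof
  assume "AE z in nu n m. False"
  interpret product_sigma_finite "\<lambda>_::nat. lborel :: complex measure" ..
  let ?M = "PiM {1..n} (\<lambda>_. lborel::complex measure)"
  have p: "1 + sqnorm n z > 0" for z using sqnorm_nonneg[of n z] by linarith
  have [measurable]: "(\<lambda>z. ennreal (fact (n + m) / (pi ^ n * fact m) * (1 / (1 + sqnorm n z) ^ (n + m + 1)))) \<in> borel_measurable (lebesgue_Cn n)"
    by measurable
  from \<open>AE z in nu n m. False\<close> have "AE z in lebesgue_Cn n. False"
    unfolding nu_def sqnorm_def[symmetric] using p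
    by (subst (asm) AE_density) (auto elim!: eventually_mono intro!: divide_pos_pos mult_pos_pos)
  then have "AE z in ?M. False"
    unfolding lebesgue_Cn_def by (rule AE_completion_iff[THEN iffD1])
  then have "emeasure ?M (space ?M) = 0"
    using AE_iff_measurable[OF sets.top, of ?M "\<lambda>_. False"] by simp
  moreover have "emeasure ?M (space ?M) = (\<Prod>r\<in>{1..n}. emeasure lborel (UNIV :: complex set))"
    using emeasure_PiM[of "{1..n}" "\<lambda>_. UNIV"] by (simp add: space_PiM)
  ultimately show False by (simp add: prod_zero_iff)
qed

section \<open>Moments of block-radial functions\<close>

definition monomial :: "nat \<Rightarrow> (nat \<Rightarrow> nat) \<Rightarrow> (nat \<Rightarrow> complex) \<Rightarrow> complex" where
  "monomial n \<alpha> z = (\<Prod>i=1..n. z i ^ \<alpha> i)"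

lemma coordinate_measurable:
  assumes "i \<in> {1..n}"
  shows "(\<lambda>z. z i) \<in> borel_measurable (lebesgue_Cn n)"
  using measurable_component_singleton[OF assms, of "\<lambda>_. lborel::complex measure"]
  unfolding lebesgue_Cn_def by (intro measurable_completion) simp

lemma monomial_measurable [measurable]: "monomial n \<alpha> \<in> borel_measurable (lebesgue_Cn n)"
  unfolding monomial_def[abs_def]
  by (intro borel_measurable_prod borel_measurable_power coordinate_measurable)

lemma cnj_monomial_measurable [measurable]: "(\<lambda>z. cnj (monomial n \<alpha> z)) \<in> borel_measurable (lebesgue_Cn n)"
  by (rule measurable_compose[OF monomial_measurable]) (intro borel_measurable_continuous_onI continuous_intros)

lemma monomial_cong: "(\<And>i. i \<in> {1..n} \<Longrightarrow> \<alpha> i = \<beta> i) \<Longrightarrow> monomial n \<alpha> = monomial n \<beta>"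
  by (auto simp: monomial_def fun_eq_iff intro!: prod.cong)

lemma monomial_phase:
  assumes "i \<in> {1..n}"
  shows "monomial n \<alpha> (phase i u z) = u ^ \<alpha> i * monomial n \<alpha> z"
proof -
  have "monomial n \<alpha> (phase i u z) = (\<Prod>r=1..n. (if r = i then u ^ \<alpha> i else 1) * z r ^ \<alpha> r)"
    unfolding monomial_def by (intro prod.cong) (auto simp: phase_def power_mult_distrib)
  also have "\<dots> = u ^ \<alpha> i * monomial n \<alpha> z"
    using assms by (simp add: prod.distrib monomial_def)
  finally show ?thesis .
qed

text \<open>
  The substitution of \<open>u * z i\<close> for \<open>z i\<close> multiplies the integral by \<open>u ^ \<gamma> i * cnj u ^ \<delta> i\<close>, which is
  not \<open>1\<close> for a suitable unimodular \<open>u\<close>.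
\<close>

lemma integral_monomials_orthogonal:
  assumes U [measurable]: "U \<in> borel_measurable (lebesgue_Cn n)"
    and inv: "\<And>u z. cmod u = 1 \<Longrightarrow> U (phase i u z) = U z"
    and i: "i \<in> {1..n}" and neq: "\<gamma> i \<noteq> \<delta> i"
  shows "(LINT z|nu n m. U z * monomial n \<gamma> z * cnj (monomial n \<delta> z)) = 0"
proof -
  define d where "d = real (\<gamma> i) - real (\<delta> i)"
  have d: "d \<noteq> 0" "\<bar>d\<bar> \<ge> 1" using neq by (auto simp: d_def)
  \<comment> \<open>with this angle the multiplier is \<open>cis (d * \<theta>) = \<i>\<close>, and the real part of \<open>u\<close> is nonnegative, so that \<open>u \<noteq> -1\<close>\<close>
  define \<theta> where "\<theta> = pi / 2 / d"
  have th: "\<bar>\<theta>\<bar> \<le> pi / 2"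
  proof -
    have "pi / 2 / \<bar>d\<bar> \<le> pi / 2 / 1" using d by (intro divide_left_mono) auto
    then show ?thesis by (simp add: \<theta>_def)
  qed
  define u where "u = cis \<theta>"
  have u1: "cmod u = 1" by (simp add: u_def)
  have "Re u \<ge> 0" using th by (auto simp: u_def abs_le_iff intro!: cos_ge_zero)
  then have u2: "u \<noteq> -1" by auto
  have "u ^ \<gamma> i * cnj u ^ \<delta> i = cis (real (\<gamma> i) * \<theta>) * cis (- (real (\<delta> i) * \<theta>))"
    by (simp add: u_def Complex.DeMoivre cis_cnj del: cis_mult)
  also have "\<dots> = cis (d * \<theta>)" by (simp add: cis_mult d_def algebra_simps)
  also have "\<dots> = \<i>" using d by (simp add: \<theta>_def)
  finally have ui: "u ^ \<gamma> i * cnj u ^ \<delta> i = \<i>" .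
  let ?G = "\<lambda>z. U z * monomial n \<gamma> z * cnj (monomial n \<delta> z)"
  have G: "?G \<in> borel_measurable (nu n m)" by measurable
  have "(LINT z|nu n m. ?G z) = (LINT z|distr (nu n m) (nu n m) (phase i u). ?G z)"
    using nu_phase[OF i u1 u2] by simp
  also have "\<dots> = (LINT z|nu n m. ?G (phase i u z))"
    using nu_phase[OF i u1 u2] G by (subst integral_distr) auto
  also have "\<dots> = (LINT z|nu n m. (u ^ \<gamma> i * cnj u ^ \<delta> i) * ?G z)"
    by (simp add: monomial_phase[OF i] inv[OF u1] mult_ac)
  also have "\<dots> = \<i> * (LINT z|nu n m. ?G z)" by (simp only: ui integral_mult_right_zero)
  finally have "(1 - \<i>) * (LINT z|nu n m. ?G z) = 0" by (simp add: algebra_simps)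
  then show ?thesis by (auto simp: complex_eq_iff)
qed

text \<open>
  A map \<open>b\<close> from coordinates to block labels replaces the list of block lengths: the analysis only
  needs to know which coordinates lie in the same block.
\<close>

definition block_radius :: "(nat \<Rightarrow> nat) \<Rightarrow> nat \<Rightarrow> (nat \<Rightarrow> complex) \<Rightarrow> nat \<Rightarrow> real" where
  "block_radius b n z i = L2_set (\<lambda>r. cmod (z r)) {r\<in>{1..n}. b r = b i}"

definition block_radial :: "(nat \<Rightarrow> nat) \<Rightarrow> nat \<Rightarrow> ((nat \<Rightarrow> complex) \<Rightarrow> complex) \<Rightarrow> bool" where
  "block_radial b n U \<longleftrightarrow>
     (\<forall>z z'. (\<forall>i\<in>{1..n}. block_radius b n z i = block_radius b n z' i) \<longrightarrow> U z = U z')"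

definition same_block_degree :: "(nat \<Rightarrow> nat) \<Rightarrow> nat \<Rightarrow> (nat \<Rightarrow> nat) \<Rightarrow> (nat \<Rightarrow> nat) \<Rightarrow> bool" where
  "same_block_degree b n \<gamma> \<delta> \<longleftrightarrow> (\<forall>y. sum \<gamma> {r\<in>{1..n}. b r = y} = sum \<delta> {r\<in>{1..n}. b r = y})"

lemma block_radial_phase:
  assumes "block_radial b n U" "cmod u = 1"
  shows "U (phase i u z) = U z"
proof -
  have "block_radius b n (phase i u z) r = block_radius b n z r" for r
    unfolding block_radius_def by (intro L2_set_cong) (auto simp: phase_def norm_mult assms(2))
  with assms(1) show ?thesis by (simp add: block_radial_def)
qed

lemma block_radial_rotate2:
  assumes "block_radial b n U" "i \<in> {1..n}" "j \<in> {1..n}" "i \<noteq> j" "b i = b j" "c\<^sup>2 + s\<^sup>2 = 1"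
  shows "U (rotate2 i j c s z) = U z"
proof -
  have "block_radius b n (rotate2 i j c s z) r = block_radius b n z r" for r
  proof (cases "b r = b i")
    case True
    then show ?thesis unfolding block_radius_def L2_set_def
      using assms by (subst sum_cmod_rotate2) auto
  next
    case False
    then show ?thesis unfolding block_radius_def
      using assms by (intro L2_set_cong) (auto simp: rotate2_def)
  qed
  with assms(1) show ?thesis by (simp add: block_radial_def)
qed

lemma block_radius_nonneg: "block_radius b n z i \<ge> 0"
  by (simp add: block_radius_def L2_set_nonneg)

lemma cmod_le_block_radius: "i \<in> {1..n} \<Longrightarrow> cmod (z i) \<le> block_radius b n z i"
  unfolding block_radius_def by (rule member_le_L2_set) auto

lemma block_radius_le: "block_radius b n z i \<le> sqrt (1 + sqnorm n z)"
proof -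
  have "(\<Sum>r\<in>{r\<in>{1..n}. b r = b i}. (cmod (z r))\<^sup>2) \<le> sqnorm n z"
    unfolding sqnorm_def by (rule sum_mono2) auto
  then show ?thesis unfolding block_radius_def L2_set_def by simp
qed

lemma cmod_monomial_le: "cmod (monomial n \<gamma> z) \<le> (\<Prod>i=1..n. block_radius b n z i ^ \<gamma> i)"
  unfolding monomial_def prod_norm[symmetric] norm_power
  by (intro prod_mono conjI power_mono zero_le_power cmod_le_block_radius) auto

text \<open>
  The radius is constant on each block, so the product only sees the exponents added up over each
  block.
\<close>

lemma prod_block_radius_cong:
  assumes "same_block_degree b n \<gamma> \<delta>"
  shows "(\<Prod>i=1..n. block_radius b n z i ^ \<gamma> i) = (\<Prod>i=1..n. block_radius b n z i ^ \<delta> i)"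
proof -
  let ?R = "\<lambda>y. L2_set (\<lambda>r. cmod (z r)) {r\<in>{1..n}. b r = y}"
  have *: "(\<Prod>i=1..n. block_radius b n z i ^ \<gamma> i) = (\<Prod>y\<in>b ` {1..n}. ?R y ^ sum \<gamma> {r\<in>{1..n}. b r = y})" for \<gamma>
  proof -
    have "(\<Prod>i=1..n. block_radius b n z i ^ \<gamma> i) =
          (\<Prod>y\<in>b ` {1..n}. \<Prod>i\<in>{r\<in>{1..n}. b r = y}. block_radius b n z i ^ \<gamma> i)"
      by (rule prod.image_gen) simp
    also have "\<dots> = (\<Prod>y\<in>b ` {1..n}. \<Prod>i\<in>{r\<in>{1..n}. b r = y}. ?R y ^ \<gamma> i)"
      by (intro prod.cong refl) (auto simp: block_radius_def)
    finally show ?thesis by (simp add: power_sum)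
  qed
  show ?thesis unfolding * using assms by (simp add: same_block_degree_def)
qed

text \<open>
  This is the bound that makes the moments of \<open>U\<close> of the block degrees of \<open>\<gamma>\<close> converge. It is imposed
  only where no coordinate vanishes, because the radial part of a symbol is controlled only there.
\<close>

definition block_growth :: "(nat \<Rightarrow> nat) \<Rightarrow> nat \<Rightarrow> nat \<Rightarrow> ((nat \<Rightarrow> complex) \<Rightarrow> complex) \<Rightarrow> (nat \<Rightarrow> nat) \<Rightarrow> bool" where
  "block_growth b n m U \<gamma> \<longleftrightarrow> (\<exists>K. \<forall>z. (\<forall>i\<in>{1..n}. z i \<noteq> 0) \<longrightarrow>
     cmod (U z) * (\<Prod>i=1..n. block_radius b n z i ^ \<gamma> i)\<^sup>2 \<le> K * (1 + sqnorm n z) ^ m)"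

lemma block_growth_cong:
  "same_block_degree b n \<gamma> \<delta> \<Longrightarrow> block_growth b n m U \<gamma> \<longleftrightarrow> block_growth b n m U \<delta>"
  unfolding block_growth_def by (simp only: prod_block_radius_cong)

lemma block_growth_integrable:
  assumes U [measurable]: "U \<in> borel_measurable (lebesgue_Cn n)"
    and gr: "block_growth b n m U \<gamma>"
    and same: "same_block_degree b n \<delta> \<gamma>" "same_block_degree b n \<epsilon> \<gamma>"
  shows "integrable (nu n m) (\<lambda>z. U z * monomial n \<delta> z * cnj (monomial n \<epsilon> z))"
proof -
  from gr obtain K where K: "\<And>z. (\<forall>i\<in>{1..n}. z i \<noteq> 0) \<Longrightarrow>
     cmod (U z) * (\<Prod>i=1..n. block_radius b n z i ^ \<gamma> i)\<^sup>2 \<le> K * (1 + sqnorm n z) ^ m"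
    unfolding block_growth_def by blast
  show ?thesis
  proof (rule integrable_nu)
    show "AE z in nu n m. cmod (U z * monomial n \<delta> z * cnj (monomial n \<epsilon> z)) \<le> K * (1 + sqnorm n z) ^ m"
      using nu_AE_nonzero
    proof eventually_elim
      case (elim z)
      let ?P = "\<Prod>i=1..n. block_radius b n z i ^ \<gamma> i"
      have "cmod (monomial n \<delta> z) \<le> ?P" "cmod (monomial n \<epsilon> z) \<le> ?P"
        using cmod_monomial_le prod_block_radius_cong[OF same(1)] prod_block_radius_cong[OF same(2)] by metis+
      then have "cmod (U z) * cmod (monomial n \<delta> z) * cmod (monomial n \<epsilon> z) \<le> cmod (U z) * ?P * ?P"
        by (intro mult_mono) (auto intro!: mult_nonneg_nonneg prod_nonneg zero_le_power block_radius_nonneg)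
      with K[OF elim] show ?case by (simp add: norm_mult power2_eq_square mult.assoc)
    qed
  qed measurable
qed

definition moment :: "nat \<Rightarrow> nat \<Rightarrow> ((nat \<Rightarrow> complex) \<Rightarrow> complex) \<Rightarrow> (nat \<Rightarrow> nat) \<Rightarrow> complex" where
  "moment n m U \<gamma> = (LINT z|nu n m. U z * monomial n \<gamma> z * cnj (monomial n \<gamma> z))"

lemma prod_split2:
  fixes i j :: "'i"
  assumes "finite I" "i \<in> I" "j \<in> I" "i \<noteq> j"
  shows "prod f I = f i * f j * prod f (I - {i, j})"
proof -
  have "prod f I = f i * prod f (I - {i})" using assms by (simp add: prod.remove)
  also have "prod f (I - {i}) = f j * prod f (I - {i} - {j})" using assms by (subst prod.remove[of _ j]) auto
  finally show ?thesis by (simp add: Diff_insert2[symmetric] insert_commute mult.assoc)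
qed

lemma same_block_degree_transfer:
  assumes "i \<in> {1..n}" "j \<in> {1..n}" "i \<noteq> j" "b i = b j" "p + q = \<gamma> i + \<gamma> j"
  shows "same_block_degree b n (\<gamma>(i := p, j := q)) \<gamma>"
  unfolding same_block_degree_def
proof
  fix y
  let ?S = "{r\<in>{1..n}. b r = y}"
  have rest: "sum (\<gamma>(i := p, j := q)) (T - {i, j}) = sum \<gamma> (T - {i, j})" for T
    by (intro sum.cong) auto
  show "sum (\<gamma>(i := p, j := q)) ?S = sum \<gamma> ?S"
  proof (cases "b i = y")
    case True
    then have "i \<in> ?S" "j \<in> ?S" "finite ?S" using assms by auto
    then show ?thesis using assms by (simp only: sum_split2 rest) simp
  next
    case False
    then have "?S - {i, j} = ?S" using assms by auto
    then show ?thesis using rest[of ?S] by simp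
  qed
qed

text \<open>
  The integral of \<open>U\<close> times \<open>\<bar>c z\<^sub>i - s z\<^sub>j\<bar>\<^bsup>2N\<^esup>\<close> (and the other coordinates) is the same for all
  \<open>c\<^sup>2 + s\<^sup>2 = 1\<close>, by rotation invariance. Expanded binomially, only the diagonal terms survive by
  orthogonality, which leaves the sum of \<open>(N choose a)\<^sup>2 c\<^bsup>2a\<^esup> s\<^bsup>2(N-a)\<^esup> M a\<close>, where \<open>M a\<close> is the moment with
  exponents \<open>a\<close> and \<open>N - a\<close> in the two coordinates. Since \<open>(c\<^sup>2 + s\<^sup>2)\<^bsup>N\<^esup> = 1\<close> has the coefficients
  \<open>N choose a\<close>, comparing coefficients gives \<open>(N choose a) M a = M N\<close>.
\<close>

lemma moment_planar:
  fixes \<gamma> :: "nat \<Rightarrow> nat"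
  assumes U [measurable]: "U \<in> borel_measurable (lebesgue_Cn n)"
    and rad: "block_radial b n U" and gr: "block_growth b n m U \<gamma>"
    and ij: "i \<in> {1..n}" "j \<in> {1..n}" "i \<noteq> j" "b i = b j"
    and a: "a \<le> \<gamma> i + \<gamma> j"
  shows "of_nat ((\<gamma> i + \<gamma> j) choose a) * moment n m U (\<gamma>(i := a, j := \<gamma> i + \<gamma> j - a)) =
         moment n m U (\<gamma>(i := \<gamma> i + \<gamma> j, j := 0))"
proof -
  define N where "N = \<gamma> i + \<gamma> j"
  define g where "g a = \<gamma>(i := a, j := N - a)" for a
  define M where "M a = moment n m U (g a)" for a
  have same: "same_block_degree b n (g a) \<gamma>" if "a \<le> N" for a
    unfolding g_def using that ij by (intro same_block_degree_transfer) (auto simp: N_def)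
  have int: "integrable (nu n m) (\<lambda>z. U z * monomial n (g a) z * cnj (monomial n (g a') z))"
    if "a \<le> N" "a' \<le> N" for a a'
    by (rule block_growth_integrable[OF U gr]) (use same that in auto)
  have orth: "(LINT z|nu n m. U z * monomial n (g a) z * cnj (monomial n (g a') z)) = (if a = a' then M a else 0)"
    for a a'
  proof (cases "a = a'")
    case False
    then have "g a i \<noteq> g a' i" using ij by (simp add: g_def)
    with False show ?thesis
      using integral_monomials_orthogonal[OF U _ ij(1)] block_radial_phase[OF rad] by simp
  qed (simp add: M_def moment_def)
  have mon: "monomial n (g a) z = z i ^ a * z j ^ (N - a) * (\<Prod>r\<in>{1..n} - {i, j}. z r ^ \<gamma> r)" for a z
  proof -
    have "(\<Prod>r\<in>{1..n} - {i, j}. z r ^ g a r) = (\<Prod>r\<in>{1..n} - {i, j}. z r ^ \<gamma> r)"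
      by (intro prod.cong) (auto simp: g_def)
    then show ?thesis unfolding monomial_def using ij by (simp add: prod_split2[of _ i j] g_def)
  qed
  have key: "M N = (\<Sum>a\<le>N. of_real ((of_nat (N choose a) * c ^ a * (-s) ^ (N - a))\<^sup>2) * M a)"
    if cs: "c\<^sup>2 + s\<^sup>2 = 1" "c \<noteq> -1" for c s :: real
  proof -
    let ?\<rho> = "rotate2 i j c s"
    define \<kappa> where "\<kappa> a = of_nat (N choose a) * c ^ a * (-s) ^ (N - a)" for a
    have rot: "monomial n (g N) (?\<rho> z) = (\<Sum>a\<le>N. of_real (\<kappa> a) * monomial n (g a) z)" for z
    proof -
      have "?\<rho> z i = of_real c * z i + of_real (-s) * z j"
        using ij by (simp add: rotate2_def scaleR_conv_of_real)
      then have "(?\<rho> z i) ^ N = (\<Sum>a\<le>N. of_real (\<kappa> a) * (z i ^ a * z j ^ (N - a)))"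
        by (simp only: binomial_ring \<kappa>_def power_mult_distrib of_real_mult of_real_power of_real_of_nat_eq mult_ac)
      moreover have "(\<Prod>r\<in>{1..n} - {i, j}. ?\<rho> z r ^ \<gamma> r) = (\<Prod>r\<in>{1..n} - {i, j}. z r ^ \<gamma> r)"
        by (intro prod.cong) (auto simp: rotate2_def)
      ultimately show ?thesis by (simp add: mon sum_distrib_right mult.assoc)
    qed
    have "M N = (LINT z|distr (nu n m) (nu n m) ?\<rho>. U z * monomial n (g N) z * cnj (monomial n (g N) z))"
      using nu_rotate2[OF ij(1-3) cs] by (simp add: M_def moment_def)
    also have "\<dots> = (LINT z|nu n m. U (?\<rho> z) * monomial n (g N) (?\<rho> z) * cnj (monomial n (g N) (?\<rho> z)))"
    proof (rule integral_distr)
      show "(\<lambda>z. U z * monomial n (g N) z * cnj (monomial n (g N) z)) \<in> borel_measurable (nu n m)"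
        by measurable
    qed (rule nu_rotate2[OF ij(1-3) cs])
    also have "\<dots> = (LINT z|nu n m. (\<Sum>a\<le>N. \<Sum>a'\<le>N. of_real (\<kappa> a * \<kappa> a') *
                        (U z * monomial n (g a) z * cnj (monomial n (g a') z))))"
      by (simp add: block_radial_rotate2[OF rad ij cs(1)] rot sum_distrib_left sum_distrib_right mult_ac)
    also have "\<dots> = (\<Sum>a\<le>N. LINT z|nu n m. (\<Sum>a'\<le>N. of_real (\<kappa> a * \<kappa> a') *
                        (U z * monomial n (g a) z * cnj (monomial n (g a') z))))"
      by (intro Bochner_Integration.integral_sum Bochner_Integration.integrable_sum integrable_mult_right int) simp_all
    also have "\<dots> = (\<Sum>a\<le>N. (\<Sum>a'\<le>N. LINT z|nu n m. of_real (\<kappa> a * \<kappa> a') *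
                        (U z * monomial n (g a) z * cnj (monomial n (g a') z))))"
      by (intro sum.cong refl Bochner_Integration.integral_sum integrable_mult_right int) simp_all
    also have "\<dots> = (\<Sum>a\<le>N. (\<Sum>a'\<le>N. of_real (\<kappa> a * \<kappa> a') *
                        (LINT z|nu n m. U z * monomial n (g a) z * cnj (monomial n (g a') z))))"
      by (simp only: integral_mult_right_zero)
    also have "\<dots> = (\<Sum>a\<le>N. of_real ((\<kappa> a)\<^sup>2) * M a)"
      by (simp add: orth if_distrib[of "\<lambda>x. _ * x"] power2_eq_square cong: if_cong)
    finally show ?thesis by (simp add: \<kappa>_def)
  qed
  define q where "q a = of_nat (N choose a) ^ 2 * M a - of_nat (N choose a) * M N" for a
  have "(\<Sum>a\<le>N. q a * of_real t ^ a) = 0" if t: "t > 0" for t :: real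
  proof -
    \<comment> \<open>now \<open>c\<^sup>2 / s\<^sup>2 = t\<close>, so that multiplying by \<open>(1 + t) ^ N\<close> turns the identity into one between polynomials in \<open>t\<close>\<close>
    define c where "c = sqrt (t / (1 + t))"
    define s where "s = sqrt (1 / (1 + t))"
    have c2: "c\<^sup>2 = t / (1 + t)" and s2: "s\<^sup>2 = 1 / (1 + t)" using t by (simp_all add: c_def s_def)
    have "c\<^sup>2 + s\<^sup>2 = 1" using t unfolding c2 s2 by (simp add: add_divide_distrib[symmetric])
    moreover have "c \<ge> 0" using t by (simp add: c_def)
    then have "c \<noteq> -1" by simp
    ultimately have eq: "M N = (\<Sum>a\<le>N. of_real ((of_nat (N choose a) * c ^ a * (-s) ^ (N - a))\<^sup>2) * M a)"
      by (rule key)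
    have term_eq: "(1 + t) ^ N * (real (N choose a) * c ^ a * (-s) ^ (N - a))\<^sup>2 = real (N choose a) ^ 2 * t ^ a"
      if "a \<le> N" for a
    proof -
      have sg: "((-s) ^ (N - a))\<^sup>2 = (s\<^sup>2) ^ (N - a)" by (simp add: power_mult[symmetric] mult.commute)
      have "(c ^ a)\<^sup>2 = (c\<^sup>2) ^ a" by (simp add: power_mult[symmetric] mult.commute)
      then have "(real (N choose a) * c ^ a * (-s) ^ (N - a))\<^sup>2 = real (N choose a) ^ 2 * ((t / (1 + t)) ^ a * (1 / (1 + t)) ^ (N - a))"
        by (simp add: power_mult_distrib sg c2 s2)
      also have "(t / (1 + t)) ^ a * (1 / (1 + t)) ^ (N - a) = t ^ a / ((1 + t) ^ a * (1 + t) ^ (N - a))"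
        by (simp add: power_divide)
      also have "(1 + t) ^ a * (1 + t) ^ (N - a) = (1 + t) ^ N"
        using that by (simp add: power_add[symmetric])
      finally show ?thesis using t by simp
    qed
    have "of_real ((1 + t) ^ N) * M N = (\<Sum>a\<le>N. of_real ((1 + t) ^ N) * (of_real ((of_nat (N choose a) * c ^ a * (-s) ^ (N - a))\<^sup>2) * M a))"
      by (subst eq) (rule sum_distrib_left)
    also have "\<dots> = (\<Sum>a\<le>N. of_real (real (N choose a) ^ 2 * t ^ a) * M a)"
    proof (intro sum.cong refl)
      fix a assume "a \<in> {..N}"
      then have "a \<le> N" by simp
      from term_eq[OF this] show "of_real ((1 + t) ^ N) * (of_real ((of_nat (N choose a) * c ^ a * (-s) ^ (N - a))\<^sup>2) * M a) =
         of_real (real (N choose a) ^ 2 * t ^ a) * M a"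
        by (metis mult.assoc of_real_mult)
    qed
    finally have 1: "of_real ((1 + t) ^ N) * M N = (\<Sum>a\<le>N. of_real (real (N choose a) ^ 2 * t ^ a) * M a)" .
    have "of_real ((1 + t) ^ N) * M N = (\<Sum>a\<le>N. of_nat (N choose a) * of_real t ^ a * M N)"
      using binomial_ring[of "of_real t :: complex" 1 N] by (simp add: add.commute sum_distrib_right)
    moreover have "q a * of_real t ^ a = of_real (real (N choose a) ^ 2 * t ^ a) * M a - of_nat (N choose a) * of_real t ^ a * M N" for a
      by (simp add: q_def algebra_simps)
    ultimately show ?thesis using 1 by (simp only: sum_subtractf) simp
  qed
  then have "of_real ` {0<..} \<subseteq> {x::complex. (\<Sum>a\<le>N. q a * x ^ a) = 0}" by auto
  moreover have "infinite (complex_of_real ` {0<..})"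
    using finite_imageD[of complex_of_real "{0<..}"] infinite_Ioi[of "0::real"] by (auto simp: inj_on_def)
  ultimately have "infinite {x::complex. (\<Sum>a\<le>N. q a * x ^ a) = 0}" using finite_subset by blast
  then have "q a = 0" using a polyfun_finite_roots[of q N] by (auto simp: N_def)
  moreover have "of_nat (N choose a) \<noteq> (0::complex)" using a by (simp add: N_def)
  ultimately have "of_nat (N choose a) * M a = M N" by (simp add: q_def power2_eq_square)
  then show ?thesis by (simp add: M_def g_def N_def)
qed

lemma moment_transfer:
  fixes \<gamma> :: "nat \<Rightarrow> nat"
  assumes U: "U \<in> borel_measurable (lebesgue_Cn n)"
    and rad: "block_radial b n U" and gr: "block_growth b n m U \<gamma>"
    and ij: "i \<in> {1..n}" "j \<in> {1..n}" "i \<noteq> j" "b i = b j"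
    and pos: "\<gamma> i > 0"
  shows "of_nat (Suc (\<gamma> j)) * moment n m U \<gamma> = of_nat (\<gamma> i) * moment n m U (\<gamma>(i := \<gamma> i - 1, j := Suc (\<gamma> j)))"
proof -
  obtain x where x: "\<gamma> i = Suc x" using pos by (cases "\<gamma> i") auto
  let ?N = "\<gamma> i + \<gamma> j"
  let ?M' = "moment n m U (\<gamma>(i := \<gamma> i - 1, j := Suc (\<gamma> j)))"
  note pl = moment_planar[OF U rad gr ij]
  have "\<gamma>(i := \<gamma> i, j := ?N - \<gamma> i) = \<gamma>" by simp
  with pl[of "\<gamma> i"] have A: "of_nat (?N choose \<gamma> i) * moment n m U \<gamma> = moment n m U (\<gamma>(i := ?N, j := 0))"
    by simp
  have "?N - (\<gamma> i - 1) = Suc (\<gamma> j)" using x by simp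
  with pl[of "\<gamma> i - 1"] x have B: "of_nat (?N choose (\<gamma> i - 1)) * ?M' = moment n m U (\<gamma>(i := ?N, j := 0))"
    by simp
  have "\<gamma> i * (?N choose \<gamma> i) = Suc (\<gamma> j) * (?N choose (\<gamma> i - 1))"
  proof -
    have "Suc x * (Suc (x + \<gamma> j) choose Suc x) = Suc (x + \<gamma> j) * (x + \<gamma> j choose x)"
      using Suc_times_binomial[of x "x + \<gamma> j"] by simp
    moreover have "Suc (\<gamma> j) * (Suc (x + \<gamma> j) choose x) = Suc (x + \<gamma> j) * (x + \<gamma> j choose x)"
      using binomial_absorb_comp[of "Suc (x + \<gamma> j)" x] by (simp add: Suc_diff_le)
    ultimately show ?thesis by (simp add: x)
  qed
  then have C: "of_nat (\<gamma> i) * of_nat (?N choose \<gamma> i) = (of_nat (Suc (\<gamma> j)) * of_nat (?N choose (\<gamma> i - 1)) :: complex)"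
    by (metis of_nat_mult)
  have nz: "of_nat (?N choose \<gamma> i) \<noteq> (0::complex)" by simp
  have "of_nat (?N choose \<gamma> i) * (of_nat (Suc (\<gamma> j)) * moment n m U \<gamma>) =
        of_nat (Suc (\<gamma> j)) * (of_nat (?N choose (\<gamma> i - 1)) * ?M')"
    using A B by (simp add: mult_ac del: of_nat_Suc)
  also have "\<dots> = (of_nat (\<gamma> i) * of_nat (?N choose \<gamma> i)) * ?M'"
    by (simp only: C mult.assoc)
  also have "\<dots> = of_nat (?N choose \<gamma> i) * (of_nat (\<gamma> i) * ?M')"
    by (simp only: mult_ac)
  finally show ?thesis using nz mult_left_cancel by blast
qed

lemma same_block_degree_trans:
  "same_block_degree b n \<gamma> \<delta> \<Longrightarrow> same_block_degree b n \<delta> \<epsilon> \<Longrightarrow> same_block_degree b n \<gamma> \<epsilon>"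
  by (simp add: same_block_degree_def)

text \<open>
  Up to the factor \<open>\<gamma>!\<close> a moment of a block-radial function depends on the block degrees of \<open>\<gamma>\<close> only:
  moving single units of exponent within blocks leads from \<open>\<gamma>\<close> to \<open>\<delta>\<close>, and each move changes the moment
  in the ratio of the factorials. This replaces the explicit integration over a product of spheres.
\<close>

lemma moment_block_degree:
  fixes \<gamma> \<delta> :: "nat \<Rightarrow> nat"
  assumes U: "U \<in> borel_measurable (lebesgue_Cn n)"
    and rad: "block_radial b n U" and gr: "block_growth b n m U \<gamma>"
    and same: "same_block_degree b n \<gamma> \<delta>"
  shows "(\<Prod>i=1..n. fact (\<delta> i)) * moment n m U \<gamma> = (\<Prod>i=1..n. fact (\<gamma> i)) * moment n m U \<delta>"
  using gr same
proof (induction "\<Sum>i=1..n. \<gamma> i - \<delta> i" arbitrary: \<gamma> rule: less_induct)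
  case less
  note gr = less.prems(1) and same = less.prems(2)
  show ?case
  proof (cases "\<forall>i\<in>{1..n}. \<gamma> i \<le> \<delta> i")
    case True
    have "\<gamma> i = \<delta> i" if i: "i \<in> {1..n}" for i
    proof (rule ccontr)
      assume "\<gamma> i \<noteq> \<delta> i"
      with True i have "\<gamma> i < \<delta> i" by (simp add: le_neq_implies_less)
      then have "sum \<gamma> {r\<in>{1..n}. b r = b i} < sum \<delta> {r\<in>{1..n}. b r = b i}"
        using True i by (intro sum_strict_mono_ex1) auto
      with same show False by (simp add: same_block_degree_def)
    qed
    then have "monomial n \<gamma> = monomial n \<delta>" "(\<Prod>i=1..n. fact (\<delta> i)) = ((\<Prod>i=1..n. fact (\<gamma> i)) :: complex)"
      by (auto intro: monomial_cong)
    then show ?thesis by (simp add: moment_def)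
  next
    case False
    then obtain i where i: "i \<in> {1..n}" "\<gamma> i > \<delta> i" by (auto simp: not_le)
    have "\<exists>j\<in>{r\<in>{1..n}. b r = b i}. \<gamma> j < \<delta> j"
    proof (rule ccontr)
      assume "\<not> ?thesis"
      then have "sum \<delta> {r\<in>{1..n}. b r = b i} < sum \<gamma> {r\<in>{1..n}. b r = b i}"
        using i by (intro sum_strict_mono_ex1) (auto simp: not_less)
      with same show False by (simp add: same_block_degree_def)
    qed
    then obtain j where j: "j \<in> {1..n}" "b j = b i" "\<gamma> j < \<delta> j" by auto
    with i have ij: "i \<noteq> j" by auto
    \<comment> \<open>this move brings both exponents one step closer to those of \<open>\<delta>\<close>\<close>
    define \<gamma>' where "\<gamma>' = \<gamma>(i := \<gamma> i - 1, j := Suc (\<gamma> j))"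
    have tr: "of_nat (Suc (\<gamma> j)) * moment n m U \<gamma> = of_nat (\<gamma> i) * moment n m U \<gamma>'"
      unfolding \<gamma>'_def using i j ij by (intro moment_transfer[OF U rad gr]) auto
    have sg: "same_block_degree b n \<gamma>' \<gamma>"
      unfolding \<gamma>'_def using i j ij by (intro same_block_degree_transfer) auto
    have gr': "block_growth b n m U \<gamma>'" using gr block_growth_cong[OF sg] by simp
    have same': "same_block_degree b n \<gamma>' \<delta>" using same_block_degree_trans[OF sg same] .
    have "(\<Sum>r=1..n. \<gamma>' r - \<delta> r) < (\<Sum>r=1..n. \<gamma> r - \<delta> r)"
      by (rule sum_strict_mono_ex1) (use i j ij in \<open>auto simp: \<gamma>'_def intro!: bexI[of _ i]\<close>)
    from less.hyps[OF this gr' same']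
    have IH: "(\<Prod>i=1..n. fact (\<delta> i)) * moment n m U \<gamma>' = (\<Prod>i=1..n. fact (\<gamma>' i)) * moment n m U \<delta>" .
    have rest: "(\<Prod>r\<in>{1..n} - {i, j}. fact (\<gamma>' r)) = ((\<Prod>r\<in>{1..n} - {i, j}. fact (\<gamma> r)) :: complex)"
      by (intro prod.cong) (auto simp: \<gamma>'_def)
    have fi: "fact (\<gamma> i) = (of_nat (\<gamma> i) * fact (\<gamma> i - 1) :: complex)" using i by (intro fact_reduce) auto
    have F: "of_nat (\<gamma> i) * (\<Prod>i=1..n. fact (\<gamma>' i)) = of_nat (Suc (\<gamma> j)) * ((\<Prod>i=1..n. fact (\<gamma> i)) :: complex)"
      using i j ij unfolding prod_split2[OF finite_atLeastAtMost i(1) j(1) ij] rest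
      by (simp add: \<gamma>'_def fi mult_ac del: of_nat_Suc)
    have "of_nat (Suc (\<gamma> j)) * ((\<Prod>i=1..n. fact (\<delta> i)) * moment n m U \<gamma>) =
          (\<Prod>i=1..n. fact (\<delta> i)) * (of_nat (\<gamma> i) * moment n m U \<gamma>')"
      by (subst tr[symmetric]) (simp only: mult_ac)
    also have "\<dots> = of_nat (\<gamma> i) * ((\<Prod>i=1..n. fact (\<gamma>' i)) * moment n m U \<delta>)"
      by (subst IH[symmetric]) (simp only: mult_ac)
    also have "\<dots> = of_nat (Suc (\<gamma> j)) * ((\<Prod>i=1..n. fact (\<gamma> i)) * moment n m U \<delta>)"
      by (metis F mult.assoc)
    finally show ?thesis using mult_left_cancel of_nat_neq_0 by blast
  qed
qed

section \<open>The Bergman space and its linear operators\<close>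

definition multi_indices :: "'i set \<Rightarrow> nat \<Rightarrow> ('i \<Rightarrow> nat) set" where
  "multi_indices F m = {\<alpha>. (\<forall>i. i \<notin> F \<longrightarrow> \<alpha> i = 0) \<and> sum \<alpha> F \<le> m}"

definition indices :: "nat \<Rightarrow> nat \<Rightarrow> (nat \<Rightarrow> nat) set" where
  "indices n m = multi_indices {1..n} m"

lemma finite_multi_indices [simp]:
  assumes "finite F"
  shows "finite (multi_indices F m)"
proof (rule finite_subset)
  show "multi_indices F m \<subseteq> {\<alpha>. \<forall>i. (i \<in> F \<longrightarrow> \<alpha> i \<in> {..m}) \<and> (i \<notin> F \<longrightarrow> \<alpha> i = 0)}"
  proof safe
    fix \<alpha> i assume a: "\<alpha> \<in> multi_indices F m" and "i \<in> F"
    then have "\<alpha> i \<le> sum \<alpha> F" using assms by (intro member_le_sum) auto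
    with a show "\<alpha> i \<le> m" by (simp add: multi_indices_def)
  qed (auto simp: multi_indices_def)
  show "finite {\<alpha>. \<forall>i. (i \<in> F \<longrightarrow> \<alpha> i \<in> {..m}) \<and> (i \<notin> F \<longrightarrow> \<alpha> i = (0::nat))}"
    using assms by (rule finite_set_of_finite_funs) auto
qed

lemma finite_indices [simp]: "finite (indices n m)"
  by (simp add: indices_def)

lemma indices_neqE:
  assumes "\<alpha> \<in> indices n m" "\<beta> \<in> indices n m" "\<alpha> \<noteq> \<beta>"
  obtains i where "i \<in> {1..n}" "\<alpha> i \<noteq> \<beta> i"
proof -
  from assms(3) obtain i where "\<alpha> i \<noteq> \<beta> i" by auto
  with assms(1,2) have "i \<in> {1..n}" by (cases "i \<in> {1..n}") (auto simp: indices_def multi_indices_def)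
  with that \<open>\<alpha> i \<noteq> \<beta> i\<close> show thesis by blast
qed

lemma bergman_space_eq:
  "bergman_space n m = {f. \<exists>c. f = (\<lambda>z. \<Sum>\<alpha>\<in>indices n m. c \<alpha> * monomial n \<alpha> z)}"
  unfolding bergman_space_def indices_def multi_indices_def monomial_def by (rule refl)

lemma bergman_spaceI: "(\<lambda>z. \<Sum>\<alpha>\<in>indices n m. c \<alpha> * monomial n \<alpha> z) \<in> bergman_space n m"
  unfolding bergman_space_eq by blast

lemma prod_block_radius_le:
  assumes "\<alpha> \<in> indices n m"
  shows "(\<Prod>i=1..n. block_radius b n z i ^ \<alpha> i) \<le> sqrt (1 + sqnorm n z) ^ m"
proof -
  let ?r = "sqrt (1 + sqnorm n z)"
  have r: "1 \<le> ?r" using sqnorm_nonneg[of n z] by simp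
  have "(\<Prod>i=1..n. block_radius b n z i ^ \<alpha> i) \<le> (\<Prod>i=1..n. ?r ^ \<alpha> i)"
    by (intro prod_mono conjI power_mono zero_le_power block_radius_nonneg block_radius_le)
  also have "\<dots> = ?r ^ (\<Sum>i=1..n. \<alpha> i)" by (rule power_sum[symmetric])
  also have "\<dots> \<le> ?r ^ m"
    using assms r by (intro power_increasing) (auto simp: indices_def multi_indices_def)
  finally show ?thesis .
qed

lemma cmod_monomial_indices_le:
  assumes "\<alpha> \<in> indices n m"
  shows "cmod (monomial n \<alpha> z) \<le> sqrt (1 + sqnorm n z) ^ m"
  by (rule order_trans[OF cmod_monomial_le[where b=id] prod_block_radius_le[OF assms]])

lemma integrable_symbol_monomials:
  assumes [measurable]: "\<Phi> \<in> borel_measurable (lebesgue_Cn n)" and K: "\<And>z. cmod (\<Phi> z) \<le> K"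
    and idx: "\<alpha> \<in> indices n m" "\<beta> \<in> indices n m"
  shows "integrable (nu n m) (\<lambda>z. \<Phi> z * monomial n \<alpha> z * cnj (monomial n \<beta> z))"
proof (rule integrable_nu)
  show "AE z in nu n m. cmod (\<Phi> z * monomial n \<alpha> z * cnj (monomial n \<beta> z)) \<le> K * (1 + sqnorm n z) ^ m"
  proof (rule AE_I2)
    fix z
    have "K \<ge> 0" using K[of z] norm_ge_zero[of "\<Phi> z"] by linarith
    then have "cmod (\<Phi> z) * cmod (monomial n \<alpha> z) * cmod (monomial n \<beta> z)
        \<le> K * sqrt (1 + sqnorm n z) ^ m * sqrt (1 + sqnorm n z) ^ m"
      using sqnorm_nonneg[of n z]
      by (intro mult_mono K cmod_monomial_indices_le idx) auto
    also have "\<dots> = K * (1 + sqnorm n z) ^ m"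
      using sqnorm_nonneg[of n z] by (simp add: power_mult_distrib[symmetric] mult.assoc)
    finally show "cmod (\<Phi> z * monomial n \<alpha> z * cnj (monomial n \<beta> z)) \<le> K * (1 + sqnorm n z) ^ m"
      by (simp add: norm_mult)
  qed
qed measurable

lemma integrable_monomials:
  assumes "\<alpha> \<in> indices n m" "\<beta> \<in> indices n m"
  shows "integrable (nu n m) (\<lambda>z. monomial n \<alpha> z * cnj (monomial n \<beta> z))"
  using integrable_symbol_monomials[of "\<lambda>_. 1" n 1, OF _ _ assms] by simp

definition weight :: "nat \<Rightarrow> nat \<Rightarrow> (nat \<Rightarrow> nat) \<Rightarrow> real" where
  "weight n m \<alpha> = (LINT z|nu n m. (cmod (monomial n \<alpha> z))\<^sup>2)"

lemma integral_monomials: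
  assumes "\<alpha> \<in> indices n m" "\<beta> \<in> indices n m"
  shows "(LINT z|nu n m. monomial n \<alpha> z * cnj (monomial n \<beta> z)) = (if \<alpha> = \<beta> then of_real (weight n m \<alpha>) else 0)"
proof (cases "\<alpha> = \<beta>")
  case True
  then show ?thesis
    by (simp only: complex_norm_square[symmetric] integral_complex_of_real weight_def simp_thms if_True)
next
  case False
  obtain i where i: "i \<in> {1..n}" "\<alpha> i \<noteq> \<beta> i" by (rule indices_neqE[OF assms False])
  from integral_monomials_orthogonal[of "\<lambda>_. 1" n i \<alpha> \<beta> m, OF _ _ i] False show ?thesis by simp
qed

text \<open>
  A monomial vanishes on a null set only, and the weighted measure is not zero.
\<close>

lemma weight_pos:
  assumes "\<alpha> \<in> indices n m"
  shows "weight n m \<alpha> > 0"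
proof -
  have int: "integrable (nu n m) (\<lambda>z. (cmod (monomial n \<alpha> z))\<^sup>2)"
    using integrable_norm[OF integrable_monomials[OF assms assms]] by (simp add: norm_mult power2_eq_square)
  have "weight n m \<alpha> \<noteq> 0"
  proof
    assume "weight n m \<alpha> = 0"
    then have "AE z in nu n m. (cmod (monomial n \<alpha> z))\<^sup>2 = 0"
      using integral_nonneg_eq_0_iff_AE[OF int] by (simp add: weight_def)
    with nu_AE_nonzero have "AE z in nu n m. False"
      by eventually_elim (auto simp: monomial_def)
    then show False using nu_not_AE_False by blast
  qed
  moreover have "weight n m \<alpha> \<ge> 0" by (simp add: weight_def)
  ultimately show ?thesis by simp
qed

text \<open>
  By orthogonality of the monomials this is the coefficient of \<open>monomial n \<alpha>\<close> in a polynomial \<open>f\<close>; as an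
  integral it is manifestly a function of \<open>f\<close>.
\<close>

definition coefficient :: "nat \<Rightarrow> nat \<Rightarrow> ((nat \<Rightarrow> complex) \<Rightarrow> complex) \<Rightarrow> (nat \<Rightarrow> nat) \<Rightarrow> complex" where
  "coefficient n m f \<alpha> = (LINT z|nu n m. f z * cnj (monomial n \<alpha> z)) / of_real (weight n m \<alpha>)"

lemma coefficient_polynomial:
  assumes "\<beta> \<in> indices n m"
  shows "coefficient n m (\<lambda>z. \<Sum>\<alpha>\<in>indices n m. c \<alpha> * monomial n \<alpha> z) \<beta> = c \<beta>"
proof -
  have "(LINT z|nu n m. (\<Sum>\<alpha>\<in>indices n m. c \<alpha> * monomial n \<alpha> z) * cnj (monomial n \<beta> z)) =
        (LINT z|nu n m. (\<Sum>\<alpha>\<in>indices n m. c \<alpha> * (monomial n \<alpha> z * cnj (monomial n \<beta> z))))"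
    by (simp add: sum_distrib_right mult.assoc)
  also have "\<dots> = (\<Sum>\<alpha>\<in>indices n m. LINT z|nu n m. c \<alpha> * (monomial n \<alpha> z * cnj (monomial n \<beta> z)))"
    by (intro Bochner_Integration.integral_sum integrable_mult_right integrable_monomials assms)
  also have "\<dots> = (\<Sum>\<alpha>\<in>indices n m. if \<alpha> = \<beta> then c \<alpha> * of_real (weight n m \<alpha>) else 0)"
    by (intro sum.cong refl) (simp add: integral_monomials assms)
  also have "\<dots> = c \<beta> * of_real (weight n m \<beta>)" using assms by simp
  finally show ?thesis using weight_pos[OF assms] by (simp add: coefficient_def)
qed

lemma bergman_expansion:
  assumes "f \<in> bergman_space n m"
  shows "f = (\<lambda>z. \<Sum>\<alpha>\<in>indices n m. coefficient n m f \<alpha> * monomial n \<alpha> z)"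
proof -
  obtain c where c: "f = (\<lambda>z. \<Sum>\<alpha>\<in>indices n m. c \<alpha> * monomial n \<alpha> z)"
    using assms by (auto simp: bergman_space_eq)
  have "coefficient n m f \<alpha> = c \<alpha>" if "\<alpha> \<in> indices n m" for \<alpha>
    unfolding c by (rule coefficient_polynomial[OF that])
  then show ?thesis by (subst c) simp
qed

lemma bergman_eqI:
  assumes "f \<in> bergman_space n m" "g \<in> bergman_space n m"
    and "\<And>\<alpha>. \<alpha> \<in> indices n m \<Longrightarrow> coefficient n m f \<alpha> = coefficient n m g \<alpha>"
  shows "f = g"
proof -
  have "(\<lambda>z. \<Sum>\<alpha>\<in>indices n m. coefficient n m f \<alpha> * monomial n \<alpha> z) =
        (\<lambda>z. \<Sum>\<alpha>\<in>indices n m. coefficient n m g \<alpha> * monomial n \<alpha> z)"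
    using assms(3) by simp
  then show ?thesis by (simp only: bergman_expansion[OF assms(1), symmetric] bergman_expansion[OF assms(2), symmetric])
qed

lemma bergman_add:
  assumes "f \<in> bergman_space n m" "g \<in> bergman_space n m"
  shows "(\<lambda>z. f z + g z) \<in> bergman_space n m"
proof -
  obtain c d where "f = (\<lambda>z. \<Sum>\<alpha>\<in>indices n m. c \<alpha> * monomial n \<alpha> z)" "g = (\<lambda>z. \<Sum>\<alpha>\<in>indices n m. d \<alpha> * monomial n \<alpha> z)"
    using assms by (auto simp: bergman_space_eq)
  then have "(\<lambda>z. f z + g z) = (\<lambda>z. \<Sum>\<alpha>\<in>indices n m. (c \<alpha> + d \<alpha>) * monomial n \<alpha> z)"
    by (simp add: sum.distrib distrib_right)
  then show ?thesis using bergman_spaceI[where n=n and m=m and c="\<lambda>\<alpha>. c \<alpha> + d \<alpha>"] by (simp only:)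
qed

lemma bergman_scale:
  assumes "f \<in> bergman_space n m"
  shows "(\<lambda>z. a * f z) \<in> bergman_space n m"
proof -
  obtain c where "f = (\<lambda>z. \<Sum>\<alpha>\<in>indices n m. c \<alpha> * monomial n \<alpha> z)"
    using assms by (auto simp: bergman_space_eq)
  then have "(\<lambda>z. a * f z) = (\<lambda>z. \<Sum>\<alpha>\<in>indices n m. (a * c \<alpha>) * monomial n \<alpha> z)"
    by (simp add: sum_distrib_left mult.assoc)
  then show ?thesis using bergman_spaceI[where n=n and m=m and c="\<lambda>\<alpha>. a * c \<alpha>"] by (simp only:)
qed

lemma bergman_zero: "(\<lambda>z. 0) \<in> bergman_space n m"
  unfolding bergman_space_eq mem_Collect_eq by (rule exI[of _ "\<lambda>_. 0"]) simp

lemma bergman_monomial: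
  assumes "\<alpha> \<in> indices n m"
  shows "monomial n \<alpha> \<in> bergman_space n m"
proof -
  have "monomial n \<alpha> z = (\<Sum>\<beta>\<in>indices n m. (if \<beta> = \<alpha> then 1 else 0) * monomial n \<beta> z)" for z
  proof -
    have "(\<Sum>\<beta>\<in>indices n m. (if \<beta> = \<alpha> then 1 else 0) * monomial n \<beta> z) =
          (\<Sum>\<beta>\<in>indices n m. if \<beta> = \<alpha> then monomial n \<beta> z else 0)"
      by (intro sum.cong) auto
    then show ?thesis using assms by simp
  qed
  then have "monomial n \<alpha> = (\<lambda>z. \<Sum>\<beta>\<in>indices n m. (if \<beta> = \<alpha> then 1 else 0) * monomial n \<beta> z)"
    by blast
  then show ?thesis using bergman_spaceI[where n=n and m=m and c="\<lambda>\<alpha>'. if \<alpha>' = \<alpha> then 1 else 0"] by (simp only:)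
qed

lemma bergman_sum:
  assumes "finite A" "\<And>a. a \<in> A \<Longrightarrow> f a \<in> bergman_space n m"
  shows "(\<lambda>z. \<Sum>a\<in>A. f a z) \<in> bergman_space n m"
  using assms
proof (induction A)
  case empty
  then show ?case by (simp add: bergman_zero)
next
  case (insert a A)
  then have "(\<lambda>z. f a z + (\<Sum>a\<in>A. f a z)) \<in> bergman_space n m"
    by (intro bergman_add) simp_all
  with insert.hyps show ?case by simp
qed

lemma coefficient_add:
  assumes "f \<in> bergman_space n m" "g \<in> bergman_space n m" "\<beta> \<in> indices n m"
  shows "coefficient n m (\<lambda>z. f z + g z) \<beta> = coefficient n m f \<beta> + coefficient n m g \<beta>"
proof -
  obtain c d where cd: "f = (\<lambda>z. \<Sum>\<alpha>\<in>indices n m. c \<alpha> * monomial n \<alpha> z)" "g = (\<lambda>z. \<Sum>\<alpha>\<in>indices n m. d \<alpha> * monomial n \<alpha> z)"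
    using assms by (auto simp: bergman_space_eq)
  then have "(\<lambda>z. f z + g z) = (\<lambda>z. \<Sum>\<alpha>\<in>indices n m. (c \<alpha> + d \<alpha>) * monomial n \<alpha> z)"
    by (simp add: sum.distrib distrib_right)
  then show ?thesis
    using coefficient_polynomial[OF assms(3), of "\<lambda>\<alpha>. c \<alpha> + d \<alpha>"]
      coefficient_polynomial[OF assms(3), of c] coefficient_polynomial[OF assms(3), of d]
    by (simp only: cd)
qed

lemma coefficient_scale: "coefficient n m (\<lambda>z. a * f z) \<beta> = a * coefficient n m f \<beta>"
  by (simp add: coefficient_def mult.assoc)

lemma coefficient_sum:
  assumes "finite A" "\<And>a. a \<in> A \<Longrightarrow> f a \<in> bergman_space n m" "\<beta> \<in> indices n m"
  shows "coefficient n m (\<lambda>z. \<Sum>a\<in>A. f a z) \<beta> = (\<Sum>a\<in>A. coefficient n m (f a) \<beta>)"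
  using assms
proof (induction A)
  case empty
  then show ?case by (simp add: coefficient_def)
next
  case (insert a A)
  then have "coefficient n m (\<lambda>z. f a z + (\<Sum>a\<in>A. f a z)) \<beta> = coefficient n m (f a) \<beta> + coefficient n m (\<lambda>z. \<Sum>a\<in>A. f a z) \<beta>"
    by (intro coefficient_add bergman_sum) simp_all
  with insert show ?case by simp
qed

text \<open>
  The orthogonality of the monomials makes the norm a weighted euclidean norm of the coefficients.
  Equivalence of norms in finite dimension then takes the concrete form of the two inequalities that
  follow.
\<close>

lemma bergman_norm_eq:
  assumes f: "f \<in> bergman_space n m"
  shows "bergman_norm n m f = L2_set (\<lambda>\<alpha>. cmod (coefficient n m f \<alpha>) * sqrt (weight n m \<alpha>)) (indices n m)"
proof -
  let ?I = "indices n m" let ?c = "coefficient n m f"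
  note fe = bergman_expansion[OF f]
  have sq: "of_real ((cmod (f z))\<^sup>2) =
     (\<Sum>\<alpha>\<in>?I. \<Sum>\<beta>\<in>?I. ?c \<alpha> * cnj (?c \<beta>) * (monomial n \<alpha> z * cnj (monomial n \<beta> z)))" for z
  proof -
    have "of_real ((cmod (f z))\<^sup>2) = f z * cnj (f z)" by (rule complex_norm_square)
    also have "\<dots> = (\<Sum>\<alpha>\<in>?I. ?c \<alpha> * monomial n \<alpha> z) * cnj (\<Sum>\<alpha>\<in>?I. ?c \<alpha> * monomial n \<alpha> z)"
      using fun_cong[OF fe, of z] by (simp only:)
    finally show ?thesis by (simp add: sum_product mult_ac)
  qed
  have "complex_of_real (LINT z|nu n m. (cmod (f z))\<^sup>2) = (LINT z|nu n m. of_real ((cmod (f z))\<^sup>2))"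
    by (rule integral_complex_of_real[symmetric])
  also have "\<dots> = (LINT z|nu n m. (\<Sum>\<alpha>\<in>?I. \<Sum>\<beta>\<in>?I. ?c \<alpha> * cnj (?c \<beta>) * (monomial n \<alpha> z * cnj (monomial n \<beta> z))))"
    by (simp only: sq)
  also have "\<dots> = (\<Sum>\<alpha>\<in>?I. LINT z|nu n m. (\<Sum>\<beta>\<in>?I. ?c \<alpha> * cnj (?c \<beta>) * (monomial n \<alpha> z * cnj (monomial n \<beta> z))))"
    by (intro Bochner_Integration.integral_sum Bochner_Integration.integrable_sum integrable_mult_right integrable_monomials)
  also have "\<dots> = (\<Sum>\<alpha>\<in>?I. \<Sum>\<beta>\<in>?I. LINT z|nu n m. ?c \<alpha> * cnj (?c \<beta>) * (monomial n \<alpha> z * cnj (monomial n \<beta> z)))"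
    by (intro sum.cong refl Bochner_Integration.integral_sum integrable_mult_right integrable_monomials)
  also have "\<dots> = (\<Sum>\<alpha>\<in>?I. \<Sum>\<beta>\<in>?I. if \<alpha> = \<beta> then ?c \<alpha> * cnj (?c \<alpha>) * of_real (weight n m \<alpha>) else 0)"
    by (intro sum.cong refl) (simp add: integral_monomials)
  also have "\<dots> = (\<Sum>\<alpha>\<in>?I. of_real ((cmod (?c \<alpha>))\<^sup>2 * weight n m \<alpha>))"
    by (intro sum.cong refl) (simp add: complex_norm_square[symmetric])
  finally have "(LINT z|nu n m. (cmod (f z))\<^sup>2) = (\<Sum>\<alpha>\<in>?I. (cmod (?c \<alpha>))\<^sup>2 * weight n m \<alpha>)"
    by (simp only: of_real_sum[symmetric] of_real_eq_iff)
  also have "\<dots> = (\<Sum>\<alpha>\<in>?I. (cmod (?c \<alpha>) * sqrt (weight n m \<alpha>))\<^sup>2)"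
    using weight_pos by (intro sum.cong refl) (simp add: power_mult_distrib less_imp_le)
  finally show ?thesis by (simp add: bergman_norm_def L2_set_def)
qed

lemma coefficient_le_norm:
  assumes "f \<in> bergman_space n m" "\<alpha> \<in> indices n m"
  shows "cmod (coefficient n m f \<alpha>) * sqrt (weight n m \<alpha>) \<le> bergman_norm n m f"
  unfolding bergman_norm_eq[OF assms(1)] using assms(2)
  by (intro member_le_L2_set[where f="\<lambda>\<alpha>. cmod (coefficient n m f \<alpha>) * sqrt (weight n m \<alpha>)"]) auto

lemma bergman_norm_le_sum:
  assumes "f \<in> bergman_space n m"
  shows "bergman_norm n m f \<le> (\<Sum>\<alpha>\<in>indices n m. cmod (coefficient n m f \<alpha>) * sqrt (weight n m \<alpha>))"
  unfolding bergman_norm_eq[OF assms] by (rule L2_set_le_sum) (auto simp: weight_pos less_imp_le)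

lemma bergman_norm_nonneg: "bergman_norm n m f \<ge> 0"
  by (simp add: bergman_norm_def)

lemma bergman_norm_scale: "bergman_norm n m (\<lambda>z. a * f z) = cmod a * bergman_norm n m f"
  by (simp add: bergman_norm_def norm_mult power_mult_distrib real_sqrt_mult)

definition linear_operators :: "nat \<Rightarrow> nat \<Rightarrow> operator set" where
  "linear_operators n m =
     {T \<in> bergman_space n m \<rightarrow>\<^sub>E bergman_space n m.
        (\<forall>f\<in>bergman_space n m. \<forall>g\<in>bergman_space n m.
           T (\<lambda>z. f z + g z) = (\<lambda>z. T f z + T g z)) \<and>
        (\<forall>c. \<forall>f\<in>bergman_space n m. T (\<lambda>z. c * f z) = (\<lambda>z. c * T f z))}"

lemma linear_operator_space: "T \<in> linear_operators n m \<Longrightarrow> f \<in> bergman_space n m \<Longrightarrow> T f \<in> bergman_space n m"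
  by (auto simp: linear_operators_def)

lemma linear_operator_add:
  "T \<in> linear_operators n m \<Longrightarrow> f \<in> bergman_space n m \<Longrightarrow> g \<in> bergman_space n m \<Longrightarrow>
    T (\<lambda>z. f z + g z) = (\<lambda>z. T f z + T g z)"
  unfolding linear_operators_def by blast

lemma linear_operator_scale:
  "T \<in> linear_operators n m \<Longrightarrow> f \<in> bergman_space n m \<Longrightarrow> T (\<lambda>z. c * f z) = (\<lambda>z. c * T f z)"
  unfolding linear_operators_def by blast

lemma linear_operator_sum:
  assumes T: "T \<in> linear_operators n m" and "finite A" "\<And>a. a \<in> A \<Longrightarrow> f a \<in> bergman_space n m"
  shows "T (\<lambda>z. \<Sum>a\<in>A. f a z) = (\<lambda>z. \<Sum>a\<in>A. T (f a) z)"
  using assms(2,3)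
proof (induction A)
  case empty
  show ?case using linear_operator_scale[OF T bergman_zero, of 0] by simp
next
  case (insert a A)
  have "T (\<lambda>z. f a z + (\<Sum>a\<in>A. f a z)) = (\<lambda>z. T (f a) z + T (\<lambda>z. \<Sum>a\<in>A. f a z) z)"
    by (intro linear_operator_add[OF T] bergman_sum insert.hyps) (simp_all add: insert.prems)
  moreover have "T (\<lambda>z. \<Sum>a\<in>A. f a z) = (\<lambda>z. \<Sum>a\<in>A. T (f a) z)"
    by (rule insert.IH) (simp add: insert.prems)
  ultimately show ?case using insert.hyps by simp
qed

lemma linear_operator_expansion:
  assumes T: "T \<in> linear_operators n m" and f: "f \<in> bergman_space n m"
  shows "T f = (\<lambda>z. \<Sum>\<alpha>\<in>indices n m. coefficient n m f \<alpha> * T (monomial n \<alpha>) z)"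
proof -
  have "T f = T (\<lambda>z. \<Sum>\<alpha>\<in>indices n m. coefficient n m f \<alpha> * monomial n \<alpha> z)"
    by (simp only: bergman_expansion[OF f, symmetric])
  also have "\<dots> = (\<lambda>z. \<Sum>\<alpha>\<in>indices n m. T (\<lambda>z. coefficient n m f \<alpha> * monomial n \<alpha> z) z)"
    by (intro linear_operator_sum[OF T] bergman_scale bergman_monomial) auto
  also have "\<dots> = (\<lambda>z. \<Sum>\<alpha>\<in>indices n m. coefficient n m f \<alpha> * T (monomial n \<alpha>) z)"
  proof (intro ext sum.cong refl)
    fix z \<alpha> assume "\<alpha> \<in> indices n m"
    then have "T (\<lambda>z. coefficient n m f \<alpha> * monomial n \<alpha> z) = (\<lambda>z. coefficient n m f \<alpha> * T (monomial n \<alpha>) z)"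
      by (intro linear_operator_scale[OF T] bergman_monomial)
    then show "T (\<lambda>z. coefficient n m f \<alpha> * monomial n \<alpha> z) z = coefficient n m f \<alpha> * T (monomial n \<alpha>) z"
      by simp
  qed
  finally show ?thesis .
qed

lemma coefficient_linear_operator:
  assumes T: "T \<in> linear_operators n m" and f: "f \<in> bergman_space n m" and \<beta>: "\<beta> \<in> indices n m"
  shows "coefficient n m (T f) \<beta> =
    (\<Sum>\<alpha>\<in>indices n m. coefficient n m f \<alpha> * coefficient n m (T (monomial n \<alpha>)) \<beta>)"
  unfolding linear_operator_expansion[OF T f]
  using coefficient_sum[of "indices n m" "\<lambda>\<alpha> z. coefficient n m f \<alpha> * T (monomial n \<alpha>) z" n m \<beta>] \<beta>
  by (simp add: bergman_scale linear_operator_space[OF T] bergman_monomial coefficient_scale)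

text \<open>
  The Bergman space has finite dimension. Explicitly, each coefficient of \<open>T f\<close> is a fixed linear
  combination of coefficients of \<open>f\<close>, and these are bounded by the norm of \<open>f\<close>.
\<close>

lemma linear_operators_bounded: "linear_operators n m = bounded_operators n m"
proof (intro equalityI subsetI)
  fix T assume T: "T \<in> linear_operators n m"
  let ?I = "indices n m"
  let ?C = "\<Sum>\<beta>\<in>?I. (\<Sum>\<alpha>\<in>?I. cmod (coefficient n m (T (monomial n \<alpha>)) \<beta>) / sqrt (weight n m \<alpha>)) * sqrt (weight n m \<beta>)"
  have "bergman_norm n m (T f) \<le> ?C * bergman_norm n m f" if f: "f \<in> bergman_space n m" for f
  proof -
    have "bergman_norm n m (T f) \<le> (\<Sum>\<beta>\<in>?I. cmod (coefficient n m (T f) \<beta>) * sqrt (weight n m \<beta>))"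
      by (intro bergman_norm_le_sum linear_operator_space[OF T f])
    also have "\<dots> \<le> (\<Sum>\<beta>\<in>?I. ((\<Sum>\<alpha>\<in>?I. cmod (coefficient n m (T (monomial n \<alpha>)) \<beta>) / sqrt (weight n m \<alpha>)) * bergman_norm n m f) * sqrt (weight n m \<beta>))"
    proof (intro sum_mono mult_right_mono)
      fix \<beta> assume \<beta>: "\<beta> \<in> ?I"
      have "cmod (coefficient n m (T f) \<beta>) \<le> (\<Sum>\<alpha>\<in>?I. cmod (coefficient n m f \<alpha> * coefficient n m (T (monomial n \<alpha>)) \<beta>))"
        unfolding coefficient_linear_operator[OF T f \<beta>] by (rule norm_sum)
      also have "\<dots> \<le> (\<Sum>\<alpha>\<in>?I. cmod (coefficient n m (T (monomial n \<alpha>)) \<beta>) / sqrt (weight n m \<alpha>) * bergman_norm n m f)"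
      proof (rule sum_mono)
        fix \<alpha> assume \<alpha>: "\<alpha> \<in> ?I"
        have w: "sqrt (weight n m \<alpha>) > 0" using weight_pos[OF \<alpha>] by simp
        have "cmod (coefficient n m f \<alpha>) \<le> bergman_norm n m f / sqrt (weight n m \<alpha>)"
          using coefficient_le_norm[OF f \<alpha>] w by (simp add: pos_le_divide_eq)
        then have "cmod (coefficient n m f \<alpha>) * cmod (coefficient n m (T (monomial n \<alpha>)) \<beta>)
           \<le> bergman_norm n m f / sqrt (weight n m \<alpha>) * cmod (coefficient n m (T (monomial n \<alpha>)) \<beta>)"
          by (intro mult_right_mono) auto
        then show "cmod (coefficient n m f \<alpha> * coefficient n m (T (monomial n \<alpha>)) \<beta>)
           \<le> cmod (coefficient n m (T (monomial n \<alpha>)) \<beta>) / sqrt (weight n m \<alpha>) * bergman_norm n m f"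
          by (simp add: norm_mult mult_ac)
      qed
      finally show "cmod (coefficient n m (T f) \<beta>) \<le>
         (\<Sum>\<alpha>\<in>?I. cmod (coefficient n m (T (monomial n \<alpha>)) \<beta>) / sqrt (weight n m \<alpha>)) * bergman_norm n m f"
        by (simp add: sum_distrib_right)
    qed (simp add: weight_pos less_imp_le)
    also have "\<dots> = ?C * bergman_norm n m f"
      by (subst (3) sum_distrib_right) (simp only: mult_ac)
    finally show ?thesis .
  qed
  then show "T \<in> bounded_operators n m"
    using T unfolding linear_operators_def bounded_operators_def by blast
qed (auto simp: linear_operators_def bounded_operators_def)

lemma linear_operatorsI:
  assumes "\<And>f. f \<notin> bergman_space n m \<Longrightarrow> T f = undefined"
    and "\<And>f. f \<in> bergman_space n m \<Longrightarrow> T f \<in> bergman_space n m"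
    and "\<And>f g. f \<in> bergman_space n m \<Longrightarrow> g \<in> bergman_space n m \<Longrightarrow> T (\<lambda>z. f z + g z) = (\<lambda>z. T f z + T g z)"
    and "\<And>c f. f \<in> bergman_space n m \<Longrightarrow> T (\<lambda>z. c * f z) = (\<lambda>z. c * T f z)"
  shows "T \<in> linear_operators n m"
  unfolding linear_operators_def using assms by (blast intro: PiE_I)

lemma op_add_apply: "f \<in> bergman_space n m \<Longrightarrow> op_add n m S T f = (\<lambda>z. S f z + T f z)"
  by (simp add: op_add_def)

lemma op_scale_apply: "f \<in> bergman_space n m \<Longrightarrow> op_scale n m c T f = (\<lambda>z. c * T f z)"
  by (simp add: op_scale_def)

lemma op_comp_apply: "f \<in> bergman_space n m \<Longrightarrow> op_comp n m S T f = S (T f)"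
  by (simp add: op_comp_def compose_eq)

lemma op_add_linear:
  assumes S: "S \<in> linear_operators n m" and T: "T \<in> linear_operators n m"
  shows "op_add n m S T \<in> linear_operators n m"
proof (rule linear_operatorsI)
  note simps = op_add_apply bergman_add bergman_scale linear_operator_space[OF S] linear_operator_space[OF T]
    linear_operator_add[OF S] linear_operator_add[OF T] linear_operator_scale[OF S] linear_operator_scale[OF T]
  fix f g c assume "f \<in> bergman_space n m" "g \<in> bergman_space n m"
  then show "op_add n m S T (\<lambda>z. f z + g z) = (\<lambda>z. op_add n m S T f z + op_add n m S T g z)"
    by (simp add: simps add_ac)
next
  note simps = op_add_apply bergman_add bergman_scale linear_operator_space[OF S] linear_operator_space[OF T]
    linear_operator_scale[OF S] linear_operator_scale[OF T]
  fix f c assume "f \<in> bergman_space n m"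
  then show "op_add n m S T (\<lambda>z. c * f z) = (\<lambda>z. c * op_add n m S T f z)"
     "op_add n m S T f \<in> bergman_space n m"
    by (simp_all add: simps distrib_left)
qed (simp add: op_add_def)

lemma op_scale_linear:
  assumes T: "T \<in> linear_operators n m"
  shows "op_scale n m c T \<in> linear_operators n m"
proof (rule linear_operatorsI)
  note simps = op_scale_apply bergman_add bergman_scale linear_operator_space[OF T]
    linear_operator_add[OF T] linear_operator_scale[OF T]
  fix f g assume "f \<in> bergman_space n m" "g \<in> bergman_space n m"
  then show "op_scale n m c T (\<lambda>z. f z + g z) = (\<lambda>z. op_scale n m c T f z + op_scale n m c T g z)"
    by (simp add: simps distrib_left)
next
  note simps = op_scale_apply bergman_scale linear_operator_space[OF T] linear_operator_scale[OF T]
  fix f a assume "f \<in> bergman_space n m"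
  then show "op_scale n m c T (\<lambda>z. a * f z) = (\<lambda>z. a * op_scale n m c T f z)"
     "op_scale n m c T f \<in> bergman_space n m"
    by (simp_all add: simps mult.left_commute)
qed (simp add: op_scale_def)

lemma op_comp_linear:
  assumes S: "S \<in> linear_operators n m" and T: "T \<in> linear_operators n m"
  shows "op_comp n m S T \<in> linear_operators n m"
proof (rule linear_operatorsI)
  note simps = op_comp_apply bergman_add bergman_scale linear_operator_space[OF S] linear_operator_space[OF T]
    linear_operator_add[OF S] linear_operator_add[OF T] linear_operator_scale[OF S] linear_operator_scale[OF T]
  fix f g assume "f \<in> bergman_space n m" "g \<in> bergman_space n m"
  then show "op_comp n m S T (\<lambda>z. f z + g z) = (\<lambda>z. op_comp n m S T f z + op_comp n m S T g z)"
    by (simp add: simps)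
next
  note simps = op_comp_apply bergman_scale linear_operator_space[OF S] linear_operator_space[OF T]
    linear_operator_scale[OF S] linear_operator_scale[OF T]
  fix f c assume "f \<in> bergman_space n m"
  then show "op_comp n m S T (\<lambda>z. c * f z) = (\<lambda>z. c * op_comp n m S T f z)"
     "op_comp n m S T f \<in> bergman_space n m"
    by (simp_all add: simps)
qed (simp add: op_comp_def compose_def)

lemma op_comp_eqI:
  assumes "\<And>f. f \<in> bergman_space n m \<Longrightarrow> S (T f) = T (S f)"
  shows "op_comp n m S T = op_comp n m T S"
  unfolding op_comp_def compose_def by (rule restrict_ext) (rule assms)

section \<open>Algebras generated by commuting operators\<close>

text \<open>
  Convergence in operator norm implies convergence of all coefficients of all values, which suffices
  for passing to the limit in a commutation relation.
\<close>

lemma op_dist_coefficient: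
  assumes X: "\<And>i. X i \<in> linear_operators n m" and T: "T \<in> linear_operators n m"
    and lim: "(\<lambda>i::nat. op_dist n m (X i) T) \<longlonglongrightarrow> 0"
    and f: "f \<in> bergman_space n m" and \<beta>: "\<beta> \<in> indices n m"
  shows "(\<lambda>i. coefficient n m (X i f) \<beta>) \<longlonglongrightarrow> coefficient n m (T f) \<beta>"
proof -
  define D where "D i = op_add n m (X i) (op_scale n m (-1) T)" for i
  have D: "D i \<in> linear_operators n m" for i
    unfolding D_def by (intro op_add_linear op_scale_linear X T)
  have Df: "D i f = (\<lambda>z. X i f z + (-1) * T f z)" for i
    using f by (simp add: D_def op_add_def op_scale_def)
  \<comment> \<open>the factor \<open>r\<close> moves \<open>f\<close> into the unit ball, over which the operator norm takes its supremum\<close>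
  define r where "r = 1 / (1 + bergman_norm n m f)"
  have r: "r > 0" "r * bergman_norm n m f \<le> 1"
    using bergman_norm_nonneg[of n m f] by (auto simp: r_def add_pos_nonneg field_simps)
  have w: "sqrt (weight n m \<beta>) > 0" using weight_pos[OF \<beta>] by simp
  have bound: "r * bergman_norm n m (D i f) \<le> op_dist n m (X i) T" for i
  proof -
    let ?B = "{f \<in> bergman_space n m. bergman_norm n m f \<le> 1}"
    have fr: "(\<lambda>z. of_real r * f z) \<in> ?B"
      using r f by (simp add: bergman_scale bergman_norm_scale)
    obtain C where C: "\<And>g. g \<in> bergman_space n m \<Longrightarrow> bergman_norm n m (D i g) \<le> C * bergman_norm n m g"
      using D[of i] unfolding linear_operators_bounded bounded_operators_def by blast
    have "bergman_norm n m (D i g) \<le> \<bar>C\<bar>" if "g \<in> ?B" for g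
    proof -
      have "C * bergman_norm n m g \<le> \<bar>C\<bar> * 1"
        using that bergman_norm_nonneg by (intro mult_mono) auto
      with C[of g] that show ?thesis by auto
    qed
    then have "bdd_above ((\<lambda>g. bergman_norm n m (D i g)) ` ?B)" by (intro bdd_aboveI[of _ "\<bar>C\<bar>"]) auto
    then have "bergman_norm n m (D i (\<lambda>z. of_real r * f z)) \<le> op_norm n m (D i)"
      unfolding op_norm_def using fr by (intro cSUP_upper)
    moreover have "D i (\<lambda>z. of_real r * f z) = (\<lambda>z. of_real r * D i f z)"
      using D[of i] f unfolding linear_operators_def by blast
    ultimately show ?thesis using r by (simp add: bergman_norm_scale op_dist_def D_def)
  qed
  have co: "coefficient n m (X i f) \<beta> - coefficient n m (T f) \<beta> = coefficient n m (D i f) \<beta>" for i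
    unfolding Df using X T f \<beta>
    by (subst coefficient_add) (auto simp: coefficient_scale[of n m "-1", simplified] linear_operator_space bergman_scale[of _ n m "-1", simplified])
  have le: "norm (coefficient n m (X i f) \<beta> - coefficient n m (T f) \<beta>) \<le> op_dist n m (X i) T * (1 / (r * sqrt (weight n m \<beta>)))" for i
  proof -
    have "r * (cmod (coefficient n m (D i f) \<beta>) * sqrt (weight n m \<beta>)) \<le> r * bergman_norm n m (D i f)"
      using r by (intro mult_left_mono coefficient_le_norm linear_operator_space[OF D] f \<beta>) auto
    also have "\<dots> \<le> op_dist n m (X i) T" by (rule bound)
    finally show ?thesis unfolding co using r w by (simp add: pos_le_divide_eq mult_ac)
  qed
  have "(\<lambda>i. op_dist n m (X i) T * (1 / (r * sqrt (weight n m \<beta>)))) \<longlonglongrightarrow> 0"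
    by (rule tendsto_mult_left_zero[OF lim])
  then have "(\<lambda>i. coefficient n m (X i f) \<beta> - coefficient n m (T f) \<beta>) \<longlonglongrightarrow> 0"
    by (rule Lim_null_comparison[OF always_eventually, rotated]) (intro allI le)
  then show ?thesis by (rule LIM_zero_cancel)
qed

definition commutant :: "nat \<Rightarrow> nat \<Rightarrow> operator set \<Rightarrow> operator set" where
  "commutant n m G = {T \<in> linear_operators n m. \<forall>S\<in>G. \<forall>f\<in>bergman_space n m. T (S f) = S (T f)}"

text \<open>
  For closedness, both sides of \<open>X i (S f) = S (X i f)\<close> are followed coefficient by coefficient: the
  coefficients of \<open>S g\<close> are finite linear combinations of those of \<open>g\<close>.
\<close>

lemma banach_subalgebra_commutant:
  assumes G: "G \<subseteq> linear_operators n m"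
  shows "banach_subalgebra n m (commutant n m G)"
  unfolding banach_subalgebra_def
proof (intro conjI ballI allI impI)
  show "commutant n m G \<subseteq> bounded_operators n m"
    by (auto simp: commutant_def linear_operators_bounded)
  have "(\<lambda>f\<in>bergman_space n m. f) \<in> linear_operators n m"
    by (rule linear_operatorsI) (simp_all add: bergman_add bergman_scale)
  moreover have "S f \<in> bergman_space n m" if "S \<in> G" "f \<in> bergman_space n m" for S f
    using that G linear_operator_space by blast
  ultimately have "(\<lambda>f\<in>bergman_space n m. f) \<in> commutant n m G"
    by (simp add: commutant_def)
  then show "commutant n m G \<noteq> {}" by blast
next
  fix S T assume "S \<in> commutant n m G" "T \<in> commutant n m G"
  then have S: "S \<in> linear_operators n m" "\<And>R f. R \<in> G \<Longrightarrow> f \<in> bergman_space n m \<Longrightarrow> S (R f) = R (S f)"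
    and T: "T \<in> linear_operators n m" "\<And>R f. R \<in> G \<Longrightarrow> f \<in> bergman_space n m \<Longrightarrow> T (R f) = R (T f)"
    by (auto simp: commutant_def)
  have R: "R \<in> linear_operators n m" if "R \<in> G" for R using that G by blast
  note sp = linear_operator_space[OF S(1)] linear_operator_space[OF T(1)]
  show "op_comp n m S T \<in> commutant n m G"
    unfolding commutant_def
    using op_comp_linear[OF S(1) T(1)] by (simp add: op_comp_apply linear_operator_space[OF R] sp S(2) T(2))
  show "op_add n m S T \<in> commutant n m G"
    unfolding commutant_def
    using op_add_linear[OF S(1) T(1)]
    by (simp add: op_add_apply linear_operator_space[OF R] linear_operator_add[OF R] sp S(2) T(2))
next
  fix c T assume "T \<in> commutant n m G"
  then have T: "T \<in> linear_operators n m" "\<And>R f. R \<in> G \<Longrightarrow> f \<in> bergman_space n m \<Longrightarrow> T (R f) = R (T f)"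
    by (auto simp: commutant_def)
  have R: "R \<in> linear_operators n m" if "R \<in> G" for R using that G by blast
  show "op_scale n m c T \<in> commutant n m G"
    unfolding commutant_def
    using op_scale_linear[OF T(1)]
    by (simp add: op_scale_apply linear_operator_space[OF R] linear_operator_scale[OF R] linear_operator_space[OF T(1)] T(2))
next
  fix X :: "nat \<Rightarrow> operator" and T
  assume "(\<forall>i. X i \<in> commutant n m G) \<and> T \<in> bounded_operators n m \<and> (\<lambda>i. op_dist n m (X i) T) \<longlonglongrightarrow> 0"
  then have X: "\<And>i. X i \<in> linear_operators n m" and T: "T \<in> linear_operators n m"
    and lim: "(\<lambda>i. op_dist n m (X i) T) \<longlonglongrightarrow> 0"
    and com: "\<And>i S f. S \<in> G \<Longrightarrow> f \<in> bergman_space n m \<Longrightarrow> X i (S f) = S (X i f)"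
    by (auto simp: commutant_def linear_operators_bounded)
  have "T (S f) = S (T f)" if S: "S \<in> G" and f: "f \<in> bergman_space n m" for S f
  proof (rule bergman_eqI)
    have SL: "S \<in> linear_operators n m" using S G by auto
    note sp = linear_operator_space
    show "T (S f) \<in> bergman_space n m" "S (T f) \<in> bergman_space n m"
      using sp[OF T] sp[OF SL] f by auto
    fix \<beta> assume \<beta>: "\<beta> \<in> indices n m"
    have "(\<lambda>i. coefficient n m (X i (S f)) \<beta>) \<longlonglongrightarrow> coefficient n m (T (S f)) \<beta>"
      by (rule op_dist_coefficient[OF X T lim sp[OF SL f] \<beta>])
    moreover have "(\<lambda>i. coefficient n m (S (X i f)) \<beta>) \<longlonglongrightarrow> coefficient n m (S (T f)) \<beta>"
      unfolding coefficient_linear_operator[OF SL sp[OF X f] \<beta>] coefficient_linear_operator[OF SL sp[OF T f] \<beta>]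
      by (intro tendsto_sum tendsto_mult tendsto_const op_dist_coefficient[OF X T lim f])
    ultimately show "coefficient n m (T (S f)) \<beta> = coefficient n m (S (T f)) \<beta>"
      by (simp add: com[OF S f] LIMSEQ_unique)
  qed
  with T show "T \<in> commutant n m G" by (simp add: commutant_def)
qed

text \<open>
  The double commutant argument: the commutant of \<open>G\<close> is a closed algebra containing \<open>G\<close>, hence contains
  the generated algebra. So \<open>G\<close> lies in the commutant of the generated algebra, and then so does the
  generated algebra itself.
\<close>

lemma commutative_generated:
  assumes G: "G \<subseteq> linear_operators n m"
    and com: "\<And>S T. S \<in> G \<Longrightarrow> T \<in> G \<Longrightarrow> op_comp n m S T = op_comp n m T S"
  shows "commutative_operators n m (generated_banach_algebra n m G)"
proof -
  let ?H = "generated_banach_algebra n m G"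
  have "S (T f) = T (S f)" if "S \<in> G" "T \<in> G" "f \<in> bergman_space n m" for S T f
    using fun_cong[OF com[OF that(1,2)], of f] by (simp only: op_comp_apply[OF that(3)])
  then have "G \<subseteq> commutant n m G" using G unfolding commutant_def by blast
  then have 1: "?H \<subseteq> commutant n m G"
    unfolding generated_banach_algebra_def by (intro hull_minimal banach_subalgebra_commutant G)
  then have H: "?H \<subseteq> linear_operators n m" by (auto simp: commutant_def)
  have "G \<subseteq> commutant n m ?H"
  proof
    fix S assume S: "S \<in> G"
    have "S (T f) = T (S f)" if "T \<in> ?H" "f \<in> bergman_space n m" for T f
      using 1 that S by (auto simp: commutant_def)
    with S G show "S \<in> commutant n m ?H" by (auto simp: commutant_def)
  qed
  from hull_minimal[where S="banach_subalgebra n m", OF this banach_subalgebra_commutant[OF H]] have "?H \<subseteq> commutant n m ?H"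
    by (simp only: generated_banach_algebra_def)
  then show ?thesis
    unfolding commutative_operators_def by (intro ballI op_comp_eqI) (auto simp: commutant_def)
qed

section \<open>Toeplitz operators with quasi-radial symbols\<close>

text \<open>
  Induction on the index set: the binomial theorem separates the power \<open>k\<close> of the new variable, and
  \<open>m choose k\<close> times the multinomial coefficient of degree \<open>m - k\<close> is the new multinomial coefficient.
\<close>

lemma multinomial_one_plus:
  fixes x :: "'i \<Rightarrow> complex"
  assumes "finite F"
  shows "(1 + sum x F) ^ m =
    (\<Sum>\<alpha>\<in>multi_indices F m. fact m / ((\<Prod>i\<in>F. fact (\<alpha> i)) * fact (m - sum \<alpha> F)) * (\<Prod>i\<in>F. x i ^ \<alpha> i))"
  using assms
proof (induction F arbitrary: m)
  case empty
  have "multi_indices {} m = {\<lambda>_::'i. 0}" by (auto simp: multi_indices_def)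
  then show ?case by simp
next
  case (insert a F)
  let ?t = "\<lambda>F m \<alpha>. fact m / ((\<Prod>i\<in>F. fact (\<alpha> i)) * fact (m - sum \<alpha> F)) * (\<Prod>i\<in>F. x i ^ \<alpha> i)"
  let ?J = "\<lambda>(k, \<alpha>). \<alpha>(a := k)"
  have tt: "of_nat (m choose k) * x a ^ k * ?t F (m - k) \<alpha> = ?t (insert a F) m (\<alpha>(a := k))"
    if k: "k \<le> m" and \<alpha>: "\<alpha> \<in> multi_indices F (m - k)" for k \<alpha>
  proof -
    have eq: "(\<Prod>i\<in>F. fact ((\<alpha>(a := k)) i)) = ((\<Prod>i\<in>F. fact (\<alpha> i)) :: complex)"
      "(\<Prod>i\<in>F. x i ^ (\<alpha>(a := k)) i) = (\<Prod>i\<in>F. x i ^ \<alpha> i)" "sum (\<alpha>(a := k)) F = sum \<alpha> F"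
      using insert.hyps by (auto intro!: prod.cong sum.cong)
    have nz: "(\<Prod>i\<in>F. fact (\<alpha> i)) \<noteq> (0::complex)" using insert.hyps by (simp add: prod_zero_iff)
    have m: "m - (k + sum \<alpha> F) = m - k - sum \<alpha> F" by simp
    have "?t (insert a F) m (\<alpha>(a := k)) =
       fact m / (fact k * (\<Prod>i\<in>F. fact (\<alpha> i)) * fact (m - k - sum \<alpha> F)) * (x a ^ k * (\<Prod>i\<in>F. x i ^ \<alpha> i))"
      by (simp only: prod.insert[OF insert.hyps] sum.insert[OF insert.hyps] eq fun_upd_same m)
    also have "fact m / (fact k * (\<Prod>i\<in>F. fact (\<alpha> i)) * fact (m - k - sum \<alpha> F)) =
       of_nat (m choose k) * (fact (m - k) / ((\<Prod>i\<in>F. fact (\<alpha> i)) * fact (m - k - sum \<alpha> F)) :: complex)"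
      using binomial_fact[OF k, where 'a=complex] nz by (simp add: field_simps)
    finally show ?thesis by (simp only: mult_ac)
  qed
  have bij: "bij_betw ?J (SIGMA k:{..m}. multi_indices F (m - k)) (multi_indices (insert a F) m)"
  proof (rule bij_betwI[where g="\<lambda>\<alpha>. (\<alpha> a, \<alpha>(a := 0))"])
    have s: "sum (\<alpha>(a := k)) F = sum \<alpha> F" for \<alpha> and k :: nat
      using insert.hyps by (auto intro!: sum.cong)
    have s': "(\<Sum>r\<in>F. if r = a then k else \<alpha> r) = sum \<alpha> F" for \<alpha> and k :: nat
      using insert.hyps by (auto intro!: sum.cong)
    show "?J \<in> (SIGMA k:{..m}. multi_indices F (m - k)) \<rightarrow> multi_indices (insert a F) m"
      using insert.hyps by (auto simp: multi_indices_def s fun_upd_same fun_upd_other simp del: fun_upd_apply)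
    show "(\<lambda>\<alpha>. (\<alpha> a, \<alpha>(a := 0))) \<in> multi_indices (insert a F) m \<rightarrow> (SIGMA k:{..m}. multi_indices F (m - k))"
      using insert.hyps by (auto simp: multi_indices_def s')
    show "(\<lambda>\<alpha>. (\<alpha> a, \<alpha>(a := 0))) (?J y) = y" if "y \<in> (SIGMA k:{..m}. multi_indices F (m - k))" for y
      using that insert.hyps by (auto simp: multi_indices_def fun_eq_iff)
    show "?J (\<alpha> a, \<alpha>(a := 0)) = \<alpha>" for \<alpha> by simp
  qed
  have "(1 + sum x (insert a F)) ^ m = (x a + (1 + sum x F)) ^ m"
    using insert.hyps by (simp add: add_ac)
  also have "\<dots> = (\<Sum>k\<le>m. of_nat (m choose k) * x a ^ k * (1 + sum x F) ^ (m - k))"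
    by (rule binomial_ring)
  also have "\<dots> = (\<Sum>k\<le>m. \<Sum>\<alpha>\<in>multi_indices F (m - k). of_nat (m choose k) * x a ^ k * ?t F (m - k) \<alpha>)"
    by (simp only: insert.IH sum_distrib_left)
  also have "\<dots> = (\<Sum>k\<le>m. \<Sum>\<alpha>\<in>multi_indices F (m - k). ?t (insert a F) m (?J (k, \<alpha>)))"
    by (intro sum.cong refl) (simp only: tt atMost_iff prod.case)
  also have "\<dots> = (\<Sum>y\<in>(SIGMA k:{..m}. multi_indices F (m - k)). ?t (insert a F) m (?J y))"
    using insert.hyps by (subst sum.Sigma) (auto simp only: finite_multi_indices finite_atMost split_def prod.collapse)
  also have "\<dots> = (\<Sum>\<alpha>\<in>multi_indices (insert a F) m. ?t (insert a F) m \<alpha>)"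
    by (rule sum.reindex_bij_betw[OF bij])
  finally show ?case .
qed

definition kernel_coeff :: "nat \<Rightarrow> nat \<Rightarrow> (nat \<Rightarrow> nat) \<Rightarrow> complex" where
  "kernel_coeff n m \<beta> = fact m / ((\<Prod>i=1..n. fact (\<beta> i)) * fact (m - (\<Sum>i=1..n. \<beta> i)))"

lemma kernel_expansion:
  "(1 + (\<Sum>i=1..n. z i * cnj (w i))) ^ m =
     (\<Sum>\<beta>\<in>indices n m. kernel_coeff n m \<beta> * monomial n \<beta> z * cnj (monomial n \<beta> w))"
  unfolding indices_def
  by (subst multinomial_one_plus)
     (simp_all add: kernel_coeff_def monomial_def power_mult_distrib prod.distrib mult.assoc)

definition chart_symbol :: "nat \<Rightarrow> ((nat \<Rightarrow> complex) set \<Rightarrow> complex) \<Rightarrow> (nat \<Rightarrow> complex) \<Rightarrow> complex" where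
  "chart_symbol n \<phi> z = \<phi> (affine_chart n z)"

lemma bounded_measurable_chart:
  assumes "bounded_measurable n \<phi>"
  shows "chart_symbol n \<phi> \<in> borel_measurable (lebesgue_Cn n)" "\<exists>K. \<forall>z. cmod (chart_symbol n \<phi> z) \<le> K"
proof -
  show "chart_symbol n \<phi> \<in> borel_measurable (lebesgue_Cn n)"
    using assms by (simp add: bounded_measurable_def chart_symbol_def[abs_def])
  obtain K where K: "\<And>x. x \<in> proj_space n \<Longrightarrow> cmod (\<phi> x) \<le> K"
    using assms by (auto simp: bounded_measurable_def bounded_iff)
  have "affine_chart n z \<in> proj_space n" for z
    unfolding affine_chart_def proj_space_def by (intro imageI) (auto intro!: exI[of _ 0])
  with K show "\<exists>K. \<forall>z. cmod (chart_symbol n \<phi> z) \<le> K" by (auto simp: chart_symbol_def)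
qed

lemma integrable_symbol_bergman:
  assumes "\<Phi> \<in> borel_measurable (lebesgue_Cn n)" "\<And>z. cmod (\<Phi> z) \<le> K"
    and f: "f \<in> bergman_space n m" and \<beta>: "\<beta> \<in> indices n m"
  shows "integrable (nu n m) (\<lambda>z. \<Phi> z * f z * cnj (monomial n \<beta> z))"
proof -
  have "\<Phi> z * f z * cnj (monomial n \<beta> z) =
     (\<Sum>\<alpha>\<in>indices n m. coefficient n m f \<alpha> * (\<Phi> z * monomial n \<alpha> z * cnj (monomial n \<beta> z)))" for z
  proof -
    have "f z = (\<Sum>\<alpha>\<in>indices n m. coefficient n m f \<alpha> * monomial n \<alpha> z)"
      by (rule fun_cong[OF bergman_expansion[OF f]])
    then have "\<Phi> z * f z * cnj (monomial n \<beta> z) =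
       \<Phi> z * (\<Sum>\<alpha>\<in>indices n m. coefficient n m f \<alpha> * monomial n \<alpha> z) * cnj (monomial n \<beta> z)"
      by (simp only:)
    then show ?thesis by (simp add: sum_distrib_left sum_distrib_right mult_ac)
  qed
  then show ?thesis
    by (simp only:) (intro Bochner_Integration.integrable_sum integrable_mult_right
        integrable_symbol_monomials[OF assms(1,2)] \<beta>)
qed

text \<open>
  Expanding the reproducing kernel turns the defining integral into a polynomial whose coefficients
  are the matrix entries of the symbol.
\<close>

lemma toeplitz_apply:
  assumes \<phi>: "bounded_measurable n \<phi>" and f: "f \<in> bergman_space n m"
  shows "toeplitz n m \<phi> f = (\<lambda>z. \<Sum>\<beta>\<in>indices n m.
    (kernel_coeff n m \<beta> * (LINT w|nu n m. chart_symbol n \<phi> w * f w * cnj (monomial n \<beta> w))) * monomial n \<beta> z)"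
proof
  fix z
  obtain K where K: "\<And>z. cmod (chart_symbol n \<phi> z) \<le> K" using bounded_measurable_chart(2)[OF \<phi>] by blast
  note int = integrable_symbol_bergman[OF bounded_measurable_chart(1)[OF \<phi>] K f]
  let ?t = "\<lambda>\<beta> w. kernel_coeff n m \<beta> * monomial n \<beta> z * (chart_symbol n \<phi> w * f w * cnj (monomial n \<beta> w))"
  have "toeplitz n m \<phi> f z = (LINT w|nu n m. (\<Sum>\<beta>\<in>indices n m. ?t \<beta> w))"
    unfolding toeplitz_def restrict_apply'[OF f] bergman_proj_def kernel_expansion chart_symbol_def[symmetric] sum_distrib_left
    by (simp only: mult_ac)
  also have "\<dots> = (\<Sum>\<beta>\<in>indices n m. LINT w|nu n m. ?t \<beta> w)"
    by (intro Bochner_Integration.integral_sum integrable_mult_right int)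
  also have "\<dots> = (\<Sum>\<beta>\<in>indices n m.
    (kernel_coeff n m \<beta> * (LINT w|nu n m. chart_symbol n \<phi> w * f w * cnj (monomial n \<beta> w))) * monomial n \<beta> z)"
    by (intro sum.cong refl) (simp only: integral_mult_right_zero, simp only: mult_ac)
  finally show "toeplitz n m \<phi> f z = \<dots>" .
qed

lemma toeplitz_linear:
  assumes \<phi>: "bounded_measurable n \<phi>"
  shows "toeplitz n m \<phi> \<in> linear_operators n m"
proof (rule linear_operatorsI)
  obtain K where K: "\<And>z. cmod (chart_symbol n \<phi> z) \<le> K" using bounded_measurable_chart(2)[OF \<phi>] by blast
  note int = integrable_symbol_bergman[OF bounded_measurable_chart(1)[OF \<phi>] K]
  show "toeplitz n m \<phi> f = undefined" if "f \<notin> bergman_space n m" for f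
    using that by (simp add: toeplitz_def)
  show "toeplitz n m \<phi> f \<in> bergman_space n m" if "f \<in> bergman_space n m" for f
    unfolding toeplitz_apply[OF \<phi> that] by (rule bergman_spaceI)
  fix f g assume f: "f \<in> bergman_space n m" and g: "g \<in> bergman_space n m"
  have add: "(LINT w|nu n m. chart_symbol n \<phi> w * (f w + g w) * cnj (monomial n \<beta> w)) =
      (LINT w|nu n m. chart_symbol n \<phi> w * f w * cnj (monomial n \<beta> w)) +
      (LINT w|nu n m. chart_symbol n \<phi> w * g w * cnj (monomial n \<beta> w))" if "\<beta> \<in> indices n m" for \<beta>
    using Bochner_Integration.integral_add[OF int[OF f that] int[OF g that]]
    by (simp add: distrib_left distrib_right)
  show "toeplitz n m \<phi> (\<lambda>z. f z + g z) = (\<lambda>z. toeplitz n m \<phi> f z + toeplitz n m \<phi> g z)"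
    unfolding toeplitz_apply[OF \<phi> f] toeplitz_apply[OF \<phi> g] toeplitz_apply[OF \<phi> bergman_add[OF f g]]
    unfolding sum.distrib[symmetric]
    by (intro ext sum.cong refl) (simp only: add, simp only: distrib_left distrib_right)
next
  fix c f assume f: "f \<in> bergman_space n m"
  have "(LINT w|nu n m. chart_symbol n \<phi> w * (c * f w) * cnj (monomial n \<beta> w)) =
      c * (LINT w|nu n m. chart_symbol n \<phi> w * f w * cnj (monomial n \<beta> w))" for \<beta>
    by (subst integral_mult_right_zero[symmetric]) (simp only: mult_ac)
  then show "toeplitz n m \<phi> (\<lambda>z. c * f z) = (\<lambda>z. c * toeplitz n m \<phi> f z)"
    unfolding toeplitz_apply[OF \<phi> f] toeplitz_apply[OF \<phi> bergman_scale[OF f]]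
    by (simp add: sum_distrib_left mult_ac)
qed

lemma same_block_degree_total:
  assumes "same_block_degree b n \<gamma> \<delta>"
  shows "(\<Sum>i=1..n. \<gamma> i) = (\<Sum>i=1..n. \<delta> i)"
proof -
  have "(\<Sum>i=1..n. \<gamma> i) = (\<Sum>y\<in>b ` {1..n}. sum \<gamma> {r\<in>{1..n}. b r = y})" for \<gamma> :: "nat \<Rightarrow> nat"
    by (rule sum.image_gen) simp
  with assms show ?thesis by (simp add: same_block_degree_def)
qed

text \<open>
  The form of the symbols in the affine chart: a block-radial function times \<open>z\<^sup>p\<close> times the conjugate of
  \<open>z\<^sup>q\<close>, where all powers of the block radii have been absorbed into \<open>U\<close>. The set \<open>P\<close> collects the
  coordinates that may enter holomorphically; two symbols with the same \<open>P\<close> never have one raising and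
  the other lowering the exponent of the same coordinate, which is what makes their operators commute.
\<close>

locale quasi_radial =
  fixes b :: "nat \<Rightarrow> nat" and n :: nat and P :: "nat set"
    and \<Phi> U :: "(nat \<Rightarrow> complex) \<Rightarrow> complex" and p q :: "nat \<Rightarrow> nat"
  assumes \<Phi>_measurable: "\<Phi> \<in> borel_measurable (lebesgue_Cn n)"
    and U_measurable: "U \<in> borel_measurable (lebesgue_Cn n)"
    and U_radial: "block_radial b n U"
    and factor: "\<And>z. (\<forall>i\<in>{1..n}. z i \<noteq> 0) \<Longrightarrow> \<Phi> z = U z * monomial n p z * cnj (monomial n q z)"
    and growth: "block_growth b n 0 U p"
    and degrees: "same_block_degree b n p q"
    and outside: "\<And>i. i \<notin> {1..n} \<Longrightarrow> p i = 0 \<and> q i = 0"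
    and q_P: "\<And>i. i \<in> P \<Longrightarrow> q i = 0" and p_P: "\<And>i. i \<notin> P \<Longrightarrow> p i = 0"
begin

definition shift :: "(nat \<Rightarrow> nat) \<Rightarrow> (nat \<Rightarrow> nat)" where
  "shift \<alpha> = (\<lambda>i. \<alpha> i + p i - q i)"

definition shiftable :: "(nat \<Rightarrow> nat) \<Rightarrow> bool" where
  "shiftable \<alpha> \<longleftrightarrow> (\<forall>i. q i \<le> \<alpha> i + p i)"

definition shift_coeff :: "nat \<Rightarrow> (nat \<Rightarrow> nat) \<Rightarrow> complex" where
  "shift_coeff m \<alpha> = (if shiftable \<alpha> then kernel_coeff n m (shift \<alpha>) * moment n m U (\<lambda>i. \<alpha> i + p i) else 0)"

text \<open>
  A monomial of degree at most \<open>m\<close> contributes at most the \<open>m\<close>-th power of \<open>1 + sqnorm n z\<close> to the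
  square of the product.
\<close>

lemma growth_shifted:
  assumes "\<alpha> \<in> indices n m"
  shows "block_growth b n m U (\<lambda>i. \<alpha> i + p i)"
proof -
  from growth obtain K where K: "\<And>z. (\<forall>i\<in>{1..n}. z i \<noteq> 0) \<Longrightarrow>
     cmod (U z) * (\<Prod>i=1..n. block_radius b n z i ^ p i)\<^sup>2 \<le> K"
    unfolding block_growth_def by auto
  have "cmod (U z) * (\<Prod>i=1..n. block_radius b n z i ^ (\<alpha> i + p i))\<^sup>2 \<le> K * (1 + sqnorm n z) ^ m"
    if z: "\<forall>i\<in>{1..n}. z i \<noteq> 0" for z
  proof -
    let ?Q = "\<Prod>i=1..n. block_radius b n z i ^ \<alpha> i"
    have "?Q\<^sup>2 \<le> (sqrt (1 + sqnorm n z) ^ m)\<^sup>2"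
      using prod_block_radius_le[OF assms]
      by (intro power_mono prod_nonneg) (auto simp: block_radius_nonneg)
    also have "\<dots> = ((sqrt (1 + sqnorm n z))\<^sup>2) ^ m" by (simp only: power_mult[symmetric] mult.commute)
    also have "\<dots> = (1 + sqnorm n z) ^ m" using sqnorm_nonneg[of n z] by simp
    finally have Q: "?Q\<^sup>2 \<le> (1 + sqnorm n z) ^ m" .
    have K0: "0 \<le> cmod (U z) * (\<Prod>i=1..n. block_radius b n z i ^ p i)\<^sup>2" by simp
    have "cmod (U z) * (\<Prod>i=1..n. block_radius b n z i ^ (\<alpha> i + p i))\<^sup>2 =
       (cmod (U z) * (\<Prod>i=1..n. block_radius b n z i ^ p i)\<^sup>2) * (\<Prod>i=1..n. block_radius b n z i ^ \<alpha> i)\<^sup>2"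
      by (simp add: power_add prod.distrib power_mult_distrib mult_ac)
    also have "\<dots> \<le> K * (1 + sqnorm n z) ^ m"
      using K[OF z] order_trans[OF K0 K[OF z]] Q by (intro mult_mono) auto
    finally show ?thesis .
  qed
  then show ?thesis unfolding block_growth_def by blast
qed

lemma matrix_coefficient:
  assumes \<alpha>: "\<alpha> \<in> indices n m" and \<beta>: "\<beta> \<in> indices n m"
  shows "(LINT z|nu n m. \<Phi> z * monomial n \<alpha> z * cnj (monomial n \<beta> z)) =
    (if (\<lambda>i. \<alpha> i + p i) = (\<lambda>i. \<beta> i + q i) then moment n m U (\<lambda>i. \<alpha> i + p i) else 0)"
  (is "?L = ?R")
proof -
  let ?a = "\<lambda>i. \<alpha> i + p i" and ?b = "\<lambda>i. \<beta> i + q i"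
  have mult: "monomial n (\<lambda>i. \<alpha> i + p i) z = monomial n \<alpha> z * monomial n p z" for \<alpha> p z
    by (simp add: monomial_def power_add prod.distrib)
  have "?L = (LINT z|nu n m. U z * monomial n ?a z * cnj (monomial n ?b z))"
  proof (rule integral_cong_AE)
    note [measurable] = \<Phi>_measurable U_measurable
    show "(\<lambda>z. \<Phi> z * monomial n \<alpha> z * cnj (monomial n \<beta> z)) \<in> borel_measurable (nu n m)"
      "(\<lambda>z. U z * monomial n ?a z * cnj (monomial n ?b z)) \<in> borel_measurable (nu n m)"
      by measurable
    show "AE z in nu n m. \<Phi> z * monomial n \<alpha> z * cnj (monomial n \<beta> z) = U z * monomial n ?a z * cnj (monomial n ?b z)"
      using nu_AE_nonzero by eventually_elim (simp add: factor mult mult_ac)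
  qed
  also have "\<dots> = ?R"
  proof (cases "?a = ?b")
    case True
    then show ?thesis by (simp add: moment_def)
  next
    case False
    then obtain i where i: "?a i \<noteq> ?b i" by (auto simp: fun_eq_iff)
    have "i \<in> {1..n}"
    proof (rule ccontr)
      assume "i \<notin> {1..n}"
      with outside[of i] \<alpha> \<beta> i show False by (auto simp: indices_def multi_indices_def)
    qed
    from integral_monomials_orthogonal[of U n i ?a ?b m, OF U_measurable block_radial_phase[OF U_radial] this i] False
    show ?thesis by simp
  qed
  finally show ?thesis .
qed

lemma shift_sum:
  assumes "shiftable \<alpha>"
  shows "same_block_degree b n (shift \<alpha>) \<alpha>"
  unfolding same_block_degree_def
proof
  fix y
  let ?S = "{r\<in>{1..n}. b r = y}"
  have "sum (shift \<alpha>) ?S + sum q ?S = sum \<alpha> ?S + sum p ?S"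
    unfolding sum.distrib[symmetric] using assms
    by (intro sum.cong refl) (simp add: shift_def shiftable_def)
  with degrees show "sum (shift \<alpha>) ?S = sum \<alpha> ?S" by (simp add: same_block_degree_def)
qed

lemma shift_indices:
  assumes "\<alpha> \<in> indices n m" "shiftable \<alpha>"
  shows "shift \<alpha> \<in> indices n m"
  using assms same_block_degree_total[OF shift_sum[OF assms(2)]] outside
  by (auto simp: indices_def multi_indices_def shift_def)

text \<open>
  The operator is a weighted shift of exponents: by orthogonality the only nonzero matrix entry in the
  column of \<open>\<alpha>\<close> is the one with \<open>\<beta> + q = \<alpha> + p\<close>, which exists if the subtraction of \<open>q\<close> is possible.
\<close>

lemma toeplitz_monomial:
  assumes \<phi>: "bounded_measurable n \<phi>" "chart_symbol n \<phi> = \<Phi>" and \<alpha>: "\<alpha> \<in> indices n m"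
  shows "toeplitz n m \<phi> (monomial n \<alpha>) = (\<lambda>z. shift_coeff m \<alpha> * monomial n (shift \<alpha>) z)"
proof
  fix z
  have eq: "(\<lambda>i. \<alpha> i + p i) = (\<lambda>i. \<beta> i + q i) \<longleftrightarrow> shiftable \<alpha> \<and> \<beta> = shift \<alpha>" for \<beta>
  proof
    assume *: "(\<lambda>i. \<alpha> i + p i) = (\<lambda>i. \<beta> i + q i)"
    have "\<alpha> i + p i = \<beta> i + q i" for i using fun_cong[OF *, of i] .
    then show "shiftable \<alpha> \<and> \<beta> = shift \<alpha>" by (auto simp: shiftable_def shift_def fun_eq_iff)
  qed (auto simp: shiftable_def shift_def fun_eq_iff)
  have "toeplitz n m \<phi> (monomial n \<alpha>) z = (\<Sum>\<beta>\<in>indices n m.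
     (kernel_coeff n m \<beta> * (if shiftable \<alpha> \<and> \<beta> = shift \<alpha> then moment n m U (\<lambda>i. \<alpha> i + p i) else 0)) * monomial n \<beta> z)"
    unfolding toeplitz_apply[OF \<phi>(1) bergman_monomial[OF \<alpha>]] \<phi>(2)
    by (intro sum.cong refl) (simp only: matrix_coefficient[OF \<alpha>] eq)
  also have "\<dots> = (\<Sum>\<beta>\<in>indices n m. if \<beta> = shift \<alpha> then shift_coeff m \<alpha> * monomial n \<beta> z else 0)"
    by (intro sum.cong refl) (simp add: shift_coeff_def)
  also have "\<dots> = shift_coeff m \<alpha> * monomial n (shift \<alpha>) z"
    using shift_indices[OF \<alpha>] by (simp add: shift_coeff_def)
  finally show "toeplitz n m \<phi> (monomial n \<alpha>) z = shift_coeff m \<alpha> * monomial n (shift \<alpha>) z" .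
qed

end

text \<open>
  Each product of coefficients consists of two kernel coefficients and two moments. The last kernel
  coefficient is the same on both sides, since the shifts commute; the first is a function of the total
  degree divided by a factorial. By \<open>moment_block_degree\<close>, a moment of \<open>U\<close> is a factorial times a
  function of the block degrees, and these are left unchanged by the shifts. What remains is an identity
  between factorials. It holds coordinatewise: on \<open>P\<close> both shifts only raise the exponent, off \<open>P\<close> both only
  lower it.
\<close>

lemma shift_coeff_commute:
  assumes A: "quasi_radial b n P \<Phi> U p q" and B: "quasi_radial b n P \<Phi>' U' p' q'"
    and \<alpha>: "\<alpha> \<in> indices n m"
  defines "\<sigma> \<equiv> quasi_radial.shift p q" and "\<sigma>' \<equiv> quasi_radial.shift p' q'"
  shows "\<sigma>' (\<sigma> \<alpha>) = \<sigma> (\<sigma>' \<alpha>)"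
    and "quasi_radial.shift_coeff n U p q m \<alpha> * quasi_radial.shift_coeff n U' p' q' m (\<sigma> \<alpha>) =
         quasi_radial.shift_coeff n U' p' q' m \<alpha> * quasi_radial.shift_coeff n U p q m (\<sigma>' \<alpha>)"
proof -
  interpret A: quasi_radial b n P \<Phi> U p q by fact
  interpret B: quasi_radial b n P \<Phi>' U' p' q' by fact
  note sh = \<sigma>_def \<sigma>'_def A.shift_def B.shift_def
  have PQ: "(q i = 0 \<and> q' i = 0) \<or> (p i = 0 \<and> p' i = 0)" for i
    using A.q_P[of i] B.q_P[of i] A.p_P[of i] B.p_P[of i] by (cases "i \<in> P") simp_all
  show comm: "\<sigma>' (\<sigma> \<alpha>) = \<sigma> (\<sigma>' \<alpha>)"
  proof
    fix i show "\<sigma>' (\<sigma> \<alpha>) i = \<sigma> (\<sigma>' \<alpha>) i" using PQ[of i] by (auto simp: sh)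
  qed
  have "q i \<le> \<alpha> i + p i \<and> q' i \<le> \<sigma> \<alpha> i + p' i \<longleftrightarrow> q' i \<le> \<alpha> i + p' i \<and> q i \<le> \<sigma>' \<alpha> i + p i" for i
    using PQ[of i] by (auto simp: sh)
  then have ok: "A.shiftable \<alpha> \<and> B.shiftable (\<sigma> \<alpha>) \<longleftrightarrow> B.shiftable \<alpha> \<and> A.shiftable (\<sigma>' \<alpha>)"
    unfolding A.shiftable_def B.shiftable_def by blast
  show "A.shift_coeff m \<alpha> * B.shift_coeff m (\<sigma> \<alpha>) = B.shift_coeff m \<alpha> * A.shift_coeff m (\<sigma>' \<alpha>)"
  proof (cases "A.shiftable \<alpha> \<and> B.shiftable (\<sigma> \<alpha>)")
    case False
    then have "A.shift_coeff m \<alpha> * B.shift_coeff m (\<sigma> \<alpha>) = 0" by (auto simp: A.shift_coeff_def B.shift_coeff_def)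
    moreover have "B.shift_coeff m \<alpha> * A.shift_coeff m (\<sigma>' \<alpha>) = 0"
      using False unfolding ok by (auto simp: A.shift_coeff_def B.shift_coeff_def)
    ultimately show ?thesis by (simp only:)
  next
    case True
    with ok have s: "A.shiftable \<alpha>" "B.shiftable (\<sigma> \<alpha>)" "B.shiftable \<alpha>" "A.shiftable (\<sigma>' \<alpha>)" by auto
    define F where "F \<gamma> = ((\<Prod>i=1..n. fact (\<gamma> i)) :: complex)" for \<gamma> :: "nat \<Rightarrow> nat"
    have F0: "F \<gamma> \<noteq> 0" for \<gamma> by (simp add: F_def prod_zero_iff)
    \<comment> \<open>the exponents of the four moments; \<open>\<gamma>\<close> and \<open>\<delta>\<close> have equal block degrees, as do their primed versions\<close>
    let ?\<gamma> = "\<lambda>i. \<alpha> i + p i" and ?\<delta> = "\<lambda>i. \<sigma>' \<alpha> i + p i"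
    let ?\<gamma>' = "\<lambda>i. \<alpha> i + p' i" and ?\<delta>' = "\<lambda>i. \<sigma> \<alpha> i + p' i"
    have dA: "same_block_degree b n (\<sigma> \<alpha>) \<alpha>" unfolding \<sigma>_def by (rule A.shift_sum[OF s(1)])
    have dB: "same_block_degree b n (\<sigma>' \<alpha>) \<alpha>" unfolding \<sigma>'_def by (rule B.shift_sum[OF s(3)])
    have mA: "F ?\<delta> * moment n m U ?\<gamma> = F ?\<gamma> * moment n m U ?\<delta>" unfolding F_def
      by (rule moment_block_degree[OF A.U_measurable A.U_radial A.growth_shifted[OF \<alpha>]])
         (use dB in \<open>simp add: same_block_degree_def sum.distrib\<close>)
    have mB: "F ?\<delta>' * moment n m U' ?\<gamma>' = F ?\<gamma>' * moment n m U' ?\<delta>'" unfolding F_def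
      by (rule moment_block_degree[OF B.U_measurable B.U_radial B.growth_shifted[OF \<alpha>]])
         (use dA in \<open>simp add: same_block_degree_def sum.distrib\<close>)
    have "F ?\<gamma> * F ?\<delta>' * F (\<sigma>' \<alpha>) = F ?\<delta> * F ?\<gamma>' * F (\<sigma> \<alpha>)"
      unfolding F_def prod.distrib[symmetric]
    proof (intro prod.cong refl)
      fix i show "fact (?\<gamma> i) * fact (?\<delta>' i) * fact (\<sigma>' \<alpha> i) = (fact (?\<delta> i) * fact (?\<gamma>' i) * fact (\<sigma> \<alpha> i) :: complex)"
        using PQ[of i] by (auto simp: sh add_ac)
    qed
    note FF = this
    have kc: "kernel_coeff n m \<beta> = (fact m / fact (m - (\<Sum>i=1..n. \<alpha> i))) / F \<beta>"
      if "same_block_degree b n \<beta> \<alpha>" for \<beta>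
      using same_block_degree_total[OF that] by (simp add: kernel_coeff_def F_def)
    have kA: "kernel_coeff n m (\<sigma> \<alpha>) * F (\<sigma> \<alpha>) = kernel_coeff n m (\<sigma>' \<alpha>) * F (\<sigma>' \<alpha>)"
      using F0 by (simp add: kc[OF dA] kc[OF dB])
    let ?k = "kernel_coeff n m (\<sigma> \<alpha>)" and ?k' = "kernel_coeff n m (\<sigma>' \<alpha>)"
    let ?m = "moment n m U" and ?m' = "moment n m U'"
    let ?C = "F ?\<delta> * F ?\<gamma>' * F (\<sigma> \<alpha>)"
    have "?C * (?k * ?m ?\<gamma> * ?m' ?\<delta>') = (?k * F (\<sigma> \<alpha>)) * (F ?\<delta> * ?m ?\<gamma>) * (F ?\<gamma>' * ?m' ?\<delta>')"
      by (simp only: mult_ac)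
    also have "\<dots> = (?k' * F (\<sigma>' \<alpha>)) * (F ?\<gamma> * ?m ?\<delta>) * (F ?\<delta>' * ?m' ?\<gamma>')"
      by (simp only: kA mA mB)
    also have "\<dots> = (F ?\<gamma> * F ?\<delta>' * F (\<sigma>' \<alpha>)) * (?k' * ?m' ?\<gamma>' * ?m ?\<delta>)"
      by (simp only: mult_ac)
    also have "\<dots> = ?C * (?k' * ?m' ?\<gamma>' * ?m ?\<delta>)" by (simp only: FF)
    finally have main: "?k * ?m ?\<gamma> * ?m' ?\<delta>' = ?k' * ?m' ?\<gamma>' * ?m ?\<delta>"
      using F0 by (simp only: mult_left_cancel[OF no_zero_divisors[OF no_zero_divisors[OF F0 F0] F0]])
    have "A.shift_coeff m \<alpha> * B.shift_coeff m (\<sigma> \<alpha>) = (?k * ?m ?\<gamma> * ?m' ?\<delta>') * kernel_coeff n m (\<sigma>' (\<sigma> \<alpha>))"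
      using s by (simp add: A.shift_coeff_def B.shift_coeff_def \<sigma>_def \<sigma>'_def mult_ac)
    also have "\<dots> = (?k' * ?m' ?\<gamma>' * ?m ?\<delta>) * kernel_coeff n m (\<sigma> (\<sigma>' \<alpha>))"
      by (simp only: main comm)
    also have "\<dots> = B.shift_coeff m \<alpha> * A.shift_coeff m (\<sigma>' \<alpha>)"
      using s by (simp add: A.shift_coeff_def B.shift_coeff_def \<sigma>_def \<sigma>'_def mult_ac)
    finally show ?thesis .
  qed
qed

lemma toeplitz_commute:
  assumes A: "quasi_radial b n P (chart_symbol n \<phi>) U p q" and B: "quasi_radial b n P (chart_symbol n \<psi>) U' p' q'"
    and \<phi>: "bounded_measurable n \<phi>" and \<psi>: "bounded_measurable n \<psi>"
  shows "op_comp n m (toeplitz n m \<psi>) (toeplitz n m \<phi>) = op_comp n m (toeplitz n m \<phi>) (toeplitz n m \<psi>)"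
proof -
  interpret A: quasi_radial b n P "chart_symbol n \<phi>" U p q by fact
  interpret B: quasi_radial b n P "chart_symbol n \<psi>" U' p' q' by fact
  let ?S = "toeplitz n m \<phi>" and ?T = "toeplitz n m \<psi>"
  note lin = toeplitz_linear[OF \<phi>, of m] toeplitz_linear[OF \<psi>, of m]
  have TS: "?T (?S (monomial n \<alpha>)) = (\<lambda>z. (A.shift_coeff m \<alpha> * B.shift_coeff m (A.shift \<alpha>)) * monomial n (B.shift (A.shift \<alpha>)) z)"
    if \<alpha>: "\<alpha> \<in> indices n m" for \<alpha>
  proof (cases "A.shiftable \<alpha>")
    case True
    note s = A.shift_indices[OF \<alpha> True]
    show ?thesis
      unfolding A.toeplitz_monomial[OF \<phi> refl \<alpha>] linear_operator_scale[OF lin(2) bergman_monomial[OF s]]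
        B.toeplitz_monomial[OF \<psi> refl s] by (simp only: mult.assoc)
  next
    case False
    then have 0: "A.shift_coeff m \<alpha> = 0" by (simp add: A.shift_coeff_def)
    show ?thesis
      unfolding A.toeplitz_monomial[OF \<phi> refl \<alpha>] 0
      using linear_operator_scale[OF lin(2) bergman_zero, of 0] by simp
  qed
  have ST: "?S (?T (monomial n \<alpha>)) = (\<lambda>z. (B.shift_coeff m \<alpha> * A.shift_coeff m (B.shift \<alpha>)) * monomial n (A.shift (B.shift \<alpha>)) z)"
    if \<alpha>: "\<alpha> \<in> indices n m" for \<alpha>
  proof (cases "B.shiftable \<alpha>")
    case True
    note s = B.shift_indices[OF \<alpha> True]
    show ?thesis
      unfolding B.toeplitz_monomial[OF \<psi> refl \<alpha>] linear_operator_scale[OF lin(1) bergman_monomial[OF s]]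
        A.toeplitz_monomial[OF \<phi> refl s] by (simp only: mult.assoc)
  next
    case False
    then have 0: "B.shift_coeff m \<alpha> = 0" by (simp add: B.shift_coeff_def)
    show ?thesis
      unfolding B.toeplitz_monomial[OF \<psi> refl \<alpha>] 0
      using linear_operator_scale[OF lin(1) bergman_zero, of 0] by simp
  qed
  have eq: "op_comp n m ?T ?S (monomial n \<alpha>) = op_comp n m ?S ?T (monomial n \<alpha>)" if \<alpha>: "\<alpha> \<in> indices n m" for \<alpha>
    unfolding op_comp_apply[OF bergman_monomial[OF \<alpha>]] TS[OF \<alpha>] ST[OF \<alpha>]
    by (simp only: shift_coeff_commute[OF A B \<alpha>])
  show ?thesis
  proof (rule op_comp_eqI)
    fix f assume f: "f \<in> bergman_space n m"
    have "op_comp n m ?T ?S f = op_comp n m ?S ?T f"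
      unfolding linear_operator_expansion[OF op_comp_linear[OF lin(2) lin(1)] f]
        linear_operator_expansion[OF op_comp_linear[OF lin(1) lin(2)] f]
      by (simp only: eq cong: sum.cong)
    then show "?T (?S f) = ?S (?T f)" by (simp only: op_comp_apply[OF f])
  qed
qed

section \<open>Symbols of the class are quasi-radial\<close>

text \<open>
  The completed Lebesgue measure is complete, so changing a measurable function on a null set preserves
  measurability. This makes the radial part of a symbol measurable, which the symbol determines only
  where no coordinate vanishes.
\<close>

lemma measurable_lebesgue_Cn_AE:
  fixes f g :: "(nat \<Rightarrow> complex) \<Rightarrow> complex"
  assumes f: "f \<in> borel_measurable (lebesgue_Cn n)" and eq: "AE z in lebesgue_Cn n. f z = g z"
  shows "g \<in> borel_measurable (lebesgue_Cn n)"
proof (rule measurableI)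
  interpret complete_measure "lebesgue_Cn n" unfolding lebesgue_Cn_def by unfold_locales
  fix A :: "complex set" assume A: "A \<in> sets borel"
  show "g -` A \<inter> space (lebesgue_Cn n) \<in> sets (lebesgue_Cn n)"
  proof (rule in_sets_AE)
    show "f -` A \<inter> space (lebesgue_Cn n) \<in> sets (lebesgue_Cn n)"
      using f A by (rule measurable_sets)
    show "AE z in lebesgue_Cn n. z \<in> f -` A \<inter> space (lebesgue_Cn n) \<longleftrightarrow> z \<in> g -` A \<inter> space (lebesgue_Cn n)"
      using eq by eventually_elim auto
  qed auto
qed simp

lemma block_radius_pos:
  assumes "i \<in> {1..n}" "z i \<noteq> 0"
  shows "block_radius b n z i > 0"
proof -
  have "0 < cmod (z i)" using assms by simp
  also have "\<dots> \<le> block_radius b n z i" by (rule cmod_le_block_radius[OF assms(1)])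
  finally show ?thesis .
qed

text \<open>
  The radial part can be evaluated at any point with the same block radii. At one whose coordinates have
  equal modulus within each block, \<open>z\<^sup>p\<close> and \<open>z\<^sup>q\<close> are as large as the block radii permit up to a constant,
  so that the bound on \<open>\<Phi>\<close> becomes a bound on \<open>U\<close>.
\<close>

lemma radial_factor_growth:
  assumes K: "\<And>z. cmod (\<Phi> z) \<le> K"
    and rad: "block_radial b n U"
    and factor: "\<And>z. (\<forall>i\<in>{1..n}. z i \<noteq> 0) \<Longrightarrow> \<Phi> z = U z * monomial n p z * cnj (monomial n q z)"
    and deg: "same_block_degree b n p q"
  shows "block_growth b n 0 U p"
proof -
  define c where "c i = sqrt (card {r\<in>{1..n}. b r = b i})" for i
  have c: "c i > 0" if "i \<in> {1..n}" for i
  proof -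
    have "{r\<in>{1..n}. b r = b i} \<noteq> {}" using that by auto
    then have "card {r\<in>{1..n}. b r = b i} > 0" by (simp add: card_gt_0_iff)
    then show ?thesis unfolding c_def by simp
  qed
  have "cmod (U z) * (\<Prod>i=1..n. block_radius b n z i ^ p i)\<^sup>2 \<le> K * (\<Prod>i=1..n. c i ^ (p i + q i))"
    if z: "\<forall>i\<in>{1..n}. z i \<noteq> 0" for z
  proof -
    let ?R = "block_radius b n z"
    define z' where "z' i = complex_of_real (?R i / c i)" for i
    have R: "?R i > 0" if "i \<in> {1..n}" for i using block_radius_pos[OF that] z that by blast
    have rad': "block_radius b n z' i = ?R i" if i: "i \<in> {1..n}" for i
    proof -
      have "block_radius b n z' i = L2_set (\<lambda>r. ?R i / c i) {r\<in>{1..n}. b r = b i}"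
        unfolding block_radius_def[of _ _ z']
      proof (rule L2_set_cong[OF refl])
        fix r assume "r \<in> {r\<in>{1..n}. b r = b i}"
        then have "?R r = ?R i" "c r = c i" by (auto simp: block_radius_def c_def)
        then show "cmod (z' r) = ?R i / c i"
          using R[OF i] c[OF i] by (simp add: z'_def norm_divide)
      qed
      also have "\<dots> = c i * (?R i / c i)"
        using R[OF i] c[OF i] by (simp add: L2_set_def real_sqrt_mult c_def)
      finally show ?thesis using c[OF i] by simp
    qed
    have "U z' = U z" using rad rad' unfolding block_radial_def by blast
    moreover have "\<forall>i\<in>{1..n}. z' i \<noteq> 0" using R c by (force simp: z'_def)
    ultimately have \<Phi>: "\<Phi> z' = U z * monomial n p z' * cnj (monomial n q z')" using factor by simp
    have mon: "cmod (monomial n \<gamma> z') = (\<Prod>i=1..n. ?R i ^ \<gamma> i) / (\<Prod>i=1..n. c i ^ \<gamma> i)" for \<gamma>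
      unfolding monomial_def prod_norm[symmetric] norm_power prod_dividef[symmetric]
    proof (rule prod.cong[OF refl])
      fix i assume i: "i \<in> {1..n}"
      show "cmod (z' i) ^ \<gamma> i = ?R i ^ \<gamma> i / c i ^ \<gamma> i"
        using R[OF i] c[OF i] by (simp add: z'_def norm_divide power_divide)
    qed
    have C: "(\<Prod>i=1..n. c i ^ \<gamma> i) > 0" for \<gamma> using c by (intro prod_pos) auto
    have "cmod (\<Phi> z') = cmod (U z) * (\<Prod>i=1..n. ?R i ^ p i)\<^sup>2 / (\<Prod>i=1..n. c i ^ (p i + q i))"
      unfolding \<Phi> by (simp only: norm_mult complex_mod_cnj mon prod_block_radius_cong[OF deg, symmetric])
         (simp add: power2_eq_square power_add prod.distrib)
    with K[of z'] C[of "\<lambda>i. p i + q i"] show ?thesis by (simp only: pos_divide_le_eq)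
  qed
  then show ?thesis unfolding block_growth_def by auto
qed

text \<open>
  For indices up to \<open>sum_list k\<close> this is the number of the block containing \<open>i\<close>; block \<open>0\<close> consists of
  the homogenizing coordinate.
\<close>

definition block_of :: "nat list \<Rightarrow> nat \<Rightarrow> nat" where
  "block_of k i = (LEAST j. i < block_start k (Suc j))"

lemma block_start_Suc: "j \<le> length k \<Longrightarrow> block_start k (Suc j) = block_start k j + (1 # k) ! j"
  unfolding block_start_def by (subst take_Suc_conv_app_nth) simp_all

lemma block_start_mono: "j \<le> j' \<Longrightarrow> block_start k j \<le> block_start k j'"
proof -
  assume "j \<le> j'"
  then have "take j' (1 # k) = take j (1 # k) @ take (j' - j) (drop j (1 # k))"
    using take_add[of j "j' - j" "1 # k"] by simp
  then show ?thesis by (simp add: block_start_def)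
qed

lemma block_start_end: "block_start k (Suc (length k)) = Suc (sum_list k)"
  by (simp add: block_start_def)

lemma block_of_less: "i \<le> sum_list k \<Longrightarrow> i < block_start k (Suc (block_of k i))"
  unfolding block_of_def by (rule LeastI[of _ "length k"]) (simp add: block_start_end)

lemma block_of_le: "i \<le> sum_list k \<Longrightarrow> block_of k i \<le> length k"
  unfolding block_of_def by (rule Least_le) (simp add: block_start_end)

lemma mem_block_iff:
  assumes "j \<le> length k"
  shows "i \<in> block k j \<longleftrightarrow> i \<le> sum_list k \<and> block_of k i = j"
proof
  assume "i \<in> block k j"
  then have i: "block_start k j \<le> i" "i < block_start k (Suc j)"
    by (auto simp: block_def block_start_Suc[OF assms])
  have "block_start k (Suc j) \<le> Suc (sum_list k)"
    using block_start_mono[of "Suc j" "Suc (length k)" k] assms by (simp add: block_start_end)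
  moreover have "block_of k i = j"
    unfolding block_of_def
  proof (rule Least_equality, rule i(2))
    fix y assume y: "i < block_start k (Suc y)"
    show "j \<le> y"
    proof (rule ccontr)
      assume "\<not> j \<le> y"
      then have "block_start k (Suc y) \<le> block_start k j" by (intro block_start_mono) auto
      with i(1) y show False by simp
    qed
  qed
  ultimately show "i \<le> sum_list k \<and> block_of k i = j" using i by simp
next
  assume i: "i \<le> sum_list k \<and> block_of k i = j"
  have "block_start k j \<le> i"
  proof (cases j)
    case 0
    then show ?thesis by (simp add: block_start_def)
  next
    case (Suc y)
    then have "\<not> i < block_start k (Suc y)" using i not_less_Least[of y "\<lambda>j. i < block_start k (Suc j)"]
      by (auto simp: block_of_def)
    then show ?thesis by (simp add: Suc)
  qed
  with block_of_less[of i k] i show "i \<in> block k j"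
    by (auto simp: block_def block_start_Suc[OF assms])
qed

lemma block_0: "block k 0 = {0}"
  by (auto simp: block_def block_start_def)

lemma block_eq:
  assumes "1 \<le> j" "j \<le> length k"
  shows "block k j = {r\<in>{1..sum_list k}. block_of k r = j}"
proof -
  have "0 \<notin> block k j" using mem_block_iff[of 0 k 0] mem_block_iff[OF assms(2), of 0] assms block_0[of k] by auto
  then show ?thesis using mem_block_iff[OF assms(2)] by (fastforce simp: Suc_le_eq intro: gr0I)
qed

lemma block_of_bounds:
  assumes "i \<in> {1..sum_list k}"
  shows "1 \<le> block_of k i" "block_of k i \<le> length k" "i \<in> block k (block_of k i)"
proof -
  show le: "block_of k i \<le> length k" using assms block_of_le by simp
  show "i \<in> block k (block_of k i)" using mem_block_iff[OF le] assms by simp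
  then show "1 \<le> block_of k i" using assms block_0[of k] by (cases "block_of k i") auto
qed

lemma block_norm_chart:
  assumes "i \<in> {1..sum_list k}"
  shows "block_norm k (z(0 := 1)) (block_of k i) = block_radius (block_of k) (sum_list k) z i"
  unfolding block_norm_def block_radius_def block_eq[OF block_of_bounds(1,2)[OF assms]]
  by (rule L2_set_cong) auto

lemma block_norm_0: "block_norm k (z(0 := 1)) 0 = 1"
  by (simp add: block_norm_def block_0)

lemma block_nonempty:
  assumes k: "\<forall>x\<in>set k. 0 < x" and j: "1 \<le> j" "j \<le> length k"
  obtains i where "i \<in> {1..sum_list k}" "block_of k i = j"
proof -
  have "(1 # k) ! j > 0" using k j by (cases j) auto
  then have "block_start k j \<in> block k j" by (simp add: block_def)
  then show thesis using that unfolding block_eq[OF j] by blast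
qed

text \<open>
  In the chart \<open>w\<^sub>0 = 1\<close> the block \<open>0\<close> drops out: its norm is \<open>1\<close>, and \<open>p 0 = q 0\<close> with \<open>p 0 * q 0 = 0\<close> leaves no
  factor. The powers of the block norms in the denominators are functions of the block radii and go into
  \<open>U\<close>. The set \<open>P\<close> consists of the first \<open>h\<^sub>j\<close> coordinates of each block and hence is common to all
  symbols of the class.
\<close>

lemma symbol_quasi_radial:
  assumes part: "is_partition k n" and len: "length h = length k"
    and sym: "\<phi> \<in> symbol_class k h" and bm: "bounded_measurable n \<phi>"
  defines "P \<equiv> {i. i - block_start k (block_of k i) < h ! (block_of k i - 1)}"
  obtains U p q where "quasi_radial (block_of k) n P (chart_symbol n \<phi>) U p q"
proof -
  have n: "n = sum_list k" and kpos: "\<forall>x\<in>set k. 0 < x" using part by (auto simp: is_partition_def)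
  let ?b = "block_of k"
  obtain a p q where adm: "admissible_indices k h p q"
    and \<phi>: "\<And>w. (\<forall>j\<le>length k. block_norm k w j \<noteq> 0) \<Longrightarrow>
           \<phi> (proj_point n w) =
             a (map (block_norm k w) [0..<length k + 1]) *
             (\<Prod>j\<le>length k.
                (\<Prod>i\<in>block k j. (w i / of_real (block_norm k w j)) ^ p i) *
                (\<Prod>i\<in>block k j. (cnj (w i) / of_real (block_norm k w j)) ^ q i))"
    using sym unfolding symbol_class_def n by blast
  have pq0: "p 0 = 0" "q 0 = 0"
  proof -
    have "sum p (block k 0) = sum q (block k 0)" using adm by (auto simp: admissible_indices_def)
    then have "p 0 = q 0" by (simp add: block_0)
    moreover have "p 0 * q 0 = 0" using adm by (auto simp: admissible_indices_def)
    ultimately show "p 0 = 0" "q 0 = 0" by auto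
  qed
  \<comment> \<open>the indices are unconstrained beyond \<open>n\<close>; cutting them off makes shifted multi-indices determined by their entries up to \<open>n\<close>\<close>
  define p' where "p' i = (if i \<in> {1..n} then p i else 0)" for i
  define q' where "q' i = (if i \<in> {1..n} then q i else 0)" for i
  define U where "U z = a (map (block_norm k (z(0 := 1))) [0..<length k + 1]) /
     (\<Prod>i=1..n. of_real (block_radius ?b n z i) ^ (p i + q i))" for z
  have rad: "block_radial ?b n U"
    unfolding block_radial_def
  proof (intro allI impI)
    fix z z' assume eq: "\<forall>i\<in>{1..n}. block_radius ?b n z i = block_radius ?b n z' i"
    have "block_norm k (z(0 := 1)) j = block_norm k (z'(0 := 1)) j" if j: "j \<le> length k" for j
    proof (cases "j = 0")
      case True
      then show ?thesis by (simp add: block_norm_0)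
    next
      case False
      then obtain i where i: "i \<in> {1..sum_list k}" "?b i = j" using block_nonempty[OF kpos, of j] j by auto
      then show ?thesis using eq block_norm_chart[OF i(1), of z] block_norm_chart[OF i(1), of z'] by (simp add: n)
    qed
    then have "map (block_norm k (z(0 := 1))) [0..<length k + 1] = map (block_norm k (z'(0 := 1))) [0..<length k + 1]"
      by (intro map_cong) auto
    moreover have "(\<Prod>i=1..n. of_real (block_radius ?b n z i) ^ (p i + q i)) =
          ((\<Prod>i=1..n. of_real (block_radius ?b n z' i) ^ (p i + q i)) :: complex)"
      using eq by (intro prod.cong) auto
    ultimately show "U z = U z'" by (simp only: U_def)
  qed
  have mon: "monomial n p' = monomial n p" "monomial n q' = monomial n q"
    by (auto intro!: monomial_cong simp: p'_def q'_def)
  have factor: "chart_symbol n \<phi> z = U z * monomial n p' z * cnj (monomial n q' z)"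
    if z: "\<forall>i\<in>{1..n}. z i \<noteq> 0" for z
  proof -
    let ?w = "z(0 := 1)" and ?N = "block_norm k (z(0 := 1))"
    define g where "g i = (?w i / of_real (?N (?b i))) ^ p i * (cnj (?w i) / of_real (?N (?b i))) ^ q i" for i
    have "?N j \<noteq> 0" if j: "j \<le> length k" for j
    proof (cases "j = 0")
      case True
      then show ?thesis by (simp add: block_norm_0)
    next
      case False
      then obtain i where i: "i \<in> {1..sum_list k}" "?b i = j" using block_nonempty[OF kpos, of j] j by auto
      then show ?thesis using block_norm_chart[OF i(1), of z] block_radius_pos[of i n z ?b] z by (simp add: n)
    qed
    then have "chart_symbol n \<phi> z = a (map ?N [0..<length k + 1]) *
             (\<Prod>j\<le>length k. (\<Prod>i\<in>block k j. (?w i / of_real (?N j)) ^ p i) *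
                             (\<Prod>i\<in>block k j. (cnj (?w i) / of_real (?N j)) ^ q i))"
      unfolding chart_symbol_def affine_chart_def by (intro \<phi>) blast
    also have "(\<Prod>j\<le>length k. (\<Prod>i\<in>block k j. (?w i / of_real (?N j)) ^ p i) *
                             (\<Prod>i\<in>block k j. (cnj (?w i) / of_real (?N j)) ^ q i)) =
        (\<Prod>j\<le>length k. \<Prod>i\<in>{i\<in>{..n}. ?b i = j}. g i)"
    proof (intro prod.cong refl)
      fix j assume "j \<in> {..length k}"
      then have "block k j = {i\<in>{..n}. ?b i = j}" using mem_block_iff[of j k] by (auto simp: n)
      then show "(\<Prod>i\<in>block k j. (?w i / of_real (?N j)) ^ p i) * (\<Prod>i\<in>block k j. (cnj (?w i) / of_real (?N j)) ^ q i) =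
            (\<Prod>i\<in>{i\<in>{..n}. ?b i = j}. g i)"
        unfolding prod.distrib[symmetric] by (intro prod.cong) (auto simp: g_def)
    qed
    also have "\<dots> = (\<Prod>i\<in>{..n}. g i)"
      by (rule prod.group) (auto simp: n block_of_le)
    also have "{..n} = insert 0 {1..n}" by auto
    also have "(\<Prod>i\<in>insert 0 {1..n}. g i) = (\<Prod>i=1..n. g i)"
      by (simp add: g_def pq0)
    also have "\<dots> = (\<Prod>i=1..n. z i ^ p i * cnj (z i) ^ q i / of_real (block_radius ?b n z i) ^ (p i + q i))"
    proof (rule prod.cong[OF refl])
      fix i assume i: "i \<in> {1..n}"
      then have "?N (?b i) = block_radius ?b n z i" using block_norm_chart by (simp add: n)
      with i show "g i = z i ^ p i * cnj (z i) ^ q i / of_real (block_radius ?b n z i) ^ (p i + q i)"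
        by (simp add: g_def power_divide power_add)
    qed
    also have "\<dots> = monomial n p z * cnj (monomial n q z) / (\<Prod>i=1..n. of_real (block_radius ?b n z i) ^ (p i + q i))"
      by (simp add: prod_dividef prod.distrib monomial_def)
    finally show ?thesis unfolding U_def mon by (simp only: times_divide_eq_left times_divide_eq_right mult.assoc)
  qed
  have deg: "same_block_degree ?b n p' q'"
    unfolding same_block_degree_def
  proof
    fix y
    have "sum p' {r\<in>{1..n}. ?b r = y} = sum p {r\<in>{1..n}. ?b r = y}"
      "sum q' {r\<in>{1..n}. ?b r = y} = sum q {r\<in>{1..n}. ?b r = y}"
      by (auto intro!: sum.cong simp: p'_def q'_def)
    moreover have "sum p {r\<in>{1..n}. ?b r = y} = sum q {r\<in>{1..n}. ?b r = y}"
    proof (cases "1 \<le> y \<and> y \<le> length k")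
      case True
      then have "block k y = {r\<in>{1..n}. ?b r = y}" unfolding n by (intro block_eq) auto
      then show ?thesis using adm True by (auto simp: admissible_indices_def)
    next
      case False
      then have "{r\<in>{1..n}. ?b r = y} = {}" using block_of_bounds[of _ k] by (auto simp: n)
      then show ?thesis by (simp only: sum.empty)
    qed
    ultimately show "sum p' {r\<in>{1..n}. ?b r = y} = sum q' {r\<in>{1..n}. ?b r = y}" by simp
  qed
  have split: "(i \<in> P \<longrightarrow> q i = 0) \<and> (i \<notin> P \<longrightarrow> p i = 0)" if i: "i \<in> {1..n}" for i
  proof -
    have j: "1 \<le> ?b i" "?b i \<le> length k" "i \<in> block k (?b i)" using block_of_bounds i by (auto simp: n)
    \<comment> \<open>the position of \<open>i\<close> within its block, counted from \<open>1\<close>\<close>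
    let ?r = "i - block_start k (?b i) + 1"
    have r: "block_start k (?b i) + ?r - 1 = i" "1 \<le> ?r" "?r \<le> k ! (?b i - 1)"
      using j by (auto simp: block_def nth_Cons')
    have p: "\<And>r. h ! (?b i - 1) < r \<Longrightarrow> r \<le> k ! (?b i - 1) \<Longrightarrow> entry k p (?b i) r = 0"
      and q: "\<And>s. 1 \<le> s \<Longrightarrow> s \<le> h ! (?b i - 1) \<Longrightarrow> entry k q (?b i) s = 0"
      using adm j(1,2) unfolding admissible_indices_def by auto
    show ?thesis
      using p[of ?r] q[of ?r] r unfolding entry_def P_def by (auto simp: not_less)
  qed
  obtain K where K: "\<And>z. cmod (chart_symbol n \<phi> z) \<le> K" using bounded_measurable_chart(2)[OF bm] by blast
  note meas [measurable] = bounded_measurable_chart(1)[OF bm]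
  have Umeas: "U \<in> borel_measurable (lebesgue_Cn n)"
  proof (rule measurable_lebesgue_Cn_AE)
    show "(\<lambda>z. chart_symbol n \<phi> z / (monomial n p' z * cnj (monomial n q' z))) \<in> borel_measurable (lebesgue_Cn n)"
      by measurable
    show "AE z in lebesgue_Cn n. chart_symbol n \<phi> z / (monomial n p' z * cnj (monomial n q' z)) = U z"
      using lebesgue_Cn_AE_nonzero
    proof eventually_elim
      case (elim z)
      then have "monomial n p' z \<noteq> 0" "monomial n q' z \<noteq> 0" by (auto simp: monomial_def prod_zero_iff)
      then show ?case by (simp add: factor[OF elim])
    qed
  qed
  have "quasi_radial ?b n P (chart_symbol n \<phi>) U p' q'"
  proof
    show "block_growth ?b n 0 U p'" by (rule radial_factor_growth[OF K rad factor deg])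
    show "p' i = 0 \<and> q' i = 0" if "i \<notin> {1..n}" for i using that by (auto simp: p'_def q'_def)
    show "q' i = 0" if "i \<in> P" for i using that split by (auto simp: q'_def)
    show "p' i = 0" if "i \<notin> P" for i using that split by (auto simp: p'_def)
  qed (fact meas Umeas rad factor deg)+
  then show thesis by (rule that)
qed

theorem theorem4p7:
  fixes n :: nat and k h :: "nat list"
  assumes "is_partition k n"
    and "length h = length k"
    and "\<forall>j\<in>{1..length k}. 1 \<le> h ! (j - 1) \<and> h ! (j - 1) \<le> k ! (j - 1) - 1"
  shows "\<forall>m::nat. commutative_operators n m
           (generated_banach_algebra n m
              {toeplitz n m \<phi> | \<phi>. \<phi> \<in> symbol_class k h \<and> bounded_measurable n \<phi>})"
proof (intro allI commutative_generated)
  fix m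
  let ?G = "{toeplitz n m \<phi> | \<phi>. \<phi> \<in> symbol_class k h \<and> bounded_measurable n \<phi>}"
  show "?G \<subseteq> linear_operators n m" using toeplitz_linear by blast
  fix S T assume S: "S \<in> ?G" and T: "T \<in> ?G"
  from S obtain \<phi> where \<phi>: "S = toeplitz n m \<phi>" "\<phi> \<in> symbol_class k h" "bounded_measurable n \<phi>" by blast
  from T obtain \<psi> where \<psi>: "T = toeplitz n m \<psi>" "\<psi> \<in> symbol_class k h" "bounded_measurable n \<psi>" by blast
  let ?P = "{i. i - block_start k (block_of k i) < h ! (block_of k i - 1)}"
  obtain U p q where A: "quasi_radial (block_of k) n ?P (chart_symbol n \<phi>) U p q"
    by (rule symbol_quasi_radial[OF assms(1,2) \<phi>(2,3)])
  obtain U' p' q' where B: "quasi_radial (block_of k) n ?P (chart_symbol n \<psi>) U' p' q'"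
    by (rule symbol_quasi_radial[OF assms(1,2) \<psi>(2,3)])
  show "op_comp n m S T = op_comp n m T S"
    unfolding \<phi>(1) \<psi>(1) by (rule toeplitz_commute[OF B A \<psi>(3) \<phi>(3)])
qed

end
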